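(* Suppose $v$ satisfies Assumptions A1 and A2 (stated in the context) with constants $s_0,c_0$, and additionally $v\in C^5(\Theta)$. Let $G:\mathbb R^d\to\mathbb R$ satisfy, for some $a_G\ge 0$, $$\Big|G(x)-\int G\,d\hat\gamma\Big|\le a_G\exp\big(c_0\sqrt d\,\|x-\hat x\|_{H_V}/2\big)\qquad\forall x\in\mathbb R^d,$$ and let $$g(x)=\frac{G(x)-\int G\,d\hat\gamma}{\sqrt{\mathrm{Var}_{\hat\gamma}(G)}},\qquad a_g=\frac{a_G}{\sqrt{\mathrm{Var}_{\hat\gamma}(G)}}.$$ Let $s\ge s^*$ be such that $\mathcal U(s)\subset\Theta$, and suppose $\epsilon_3,\epsilon_4(s)\lesssim 1$. If $g$ is odd about $\hat x$, then $$\Big|\int g\,d\pi-\int g\,d\hat\gamma_S\Big|\lesssim E_s\big(\epsilon_3^2+\epsilon_4(s)^2\big)\big(\epsilon_3+\epsilon_4(s)^2\big)+d^{-1/2}\epsilon_5(s)^3+(a_g\vee1)\tau_s .$$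
   Context: Setting: $d\ge1$ is an integer, $n>0$, $\Theta\subseteq\mathbb R^d$ is open, $v:\Theta\to\mathbb R$, $V=nv$, and $\pi$ is the probability measure with density proportional to $e^{-V}$ on $\Theta$ (and zero outside $\Theta$). Notation: $\langle T,S\rangle$ is the entrywise inner product of tensors of the same order. For a symmetric positive definite matrix $H$, $\|x\|_H=\sqrt{x^\top Hx}$ for vectors and $\|T\|_H=\sup_{\|u\|_H=1}|\langle T,u^{\otimes k}\rangle|$ for symmetric tensors of order $k\ge2$. $a\vee b=\max(a,b)$. Assumption A1: $v\in C^4(\Theta)$ has a unique global minimizer $\hat x\in\Theta$, and $H_v:=\nabla^2v(\hat x)\succ0$. Local region: $\mathcal U(s)=\{x\in\mathbb R^d:\|x-\hat x\|_{H_v}\le s\sqrt{d/n}\}$. Assumption A2: there exist $s_0>0$ and $c_0$ with $1\ge c_0>C/\sqrt d$ for some absolute constant $C>0$ such that $v(x)-v(\hat x)\ge c_0\sqrt{d/n}\,\|x-\hat x\|_{H_v}$ for all $x\in\Theta\setminus\mathcal U(s_0)$. Laplace approximation and correction: $H_V=\nabla^2V(\hat x)=nH_v$, $\hat\gamma=\mathcal N(\hat x,H_V^{-1})$, $S(x)=-\frac16\langle\nabla^3V(\hat x),(x-\hat x)^{\otimes3}\rangle$, and $\hat\gamma_S$ is the signed measure $d\hat\gamma_S=(1+S)\,d\hat\gamma$. Small quantities: $\epsilon_3=d\,\|\nabla^3V(\hat x)\|_{H_V}$, $\epsilon_4(s)=d\sup_{x\in\mathcal U(s)}\|\nabla^4V(x)\|_{H_V}^{1/2}$,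 $\epsilon_5(s)=d\sup_{x\in\mathcal U(s)}\|\nabla^5V(x)\|_{H_V}^{1/3}$. Also $E_s=\exp\big((\epsilon_3^2+\epsilon_4(s)^2)s^4\big)$, $\tau_s=d\,e^{-c_0sd/8}$, $s^*=\max\big(s_0,\frac{8}{c_0}\log\frac{2e}{c_0}\big)$. Convention: $a\lesssim b$ means $a\le Cb$ for an absolute constant $C>0$; the hypothesis "$\epsilon_3,\epsilon_4(s)\lesssim1$" means both are bounded by some absolute constant, and the constant in the conclusion may depend on that bound and on the absolute constant in A2, but on nothing else. $g$ is odd about $\hat x$ if $g(\hat x+y)=-g(\hat x-y)$ for all $y$. $G$ is measurable with $\mathrm{Var}_{\hat\gamma}(G)>0$.
   Formalization: The growth bound on G uses the norm of H_V = nH_v instead of H_v: as printed, for small n, G may outgrow the decay of π and the claim fails; for n ≥ 1 the version proved is more general, for n < 1 it asks for slower growth of G. *)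

theory Defs
  imports "HOL-Analysis.Analysis" "Jordan_Normal_Form.Determinant"
begin

text \<open>
  The constants hidden in \<open>\<lesssim>\<close> must not depend on the dimension \<open>d\<close>, so \<open>d\<close> is quantified inside
  the statement and cannot be a type. The space \<open>\<real>\<^sup>d\<close> is the set of extensional functions on
  \<open>{..<d}\<close>, which is the space of the product measure \<open>PiM {..<d} (\<lambda>_. lborel)\<close>; it inherits
  its Euclidean topology from the product topology on \<^typ>\<open>nat \<Rightarrow> real\<close>. Matrices and tensors are
  functions of their indices, only read at indices below \<open>d\<close>.
\<close>

type_synonym point = "nat \<Rightarrow> real"

abbreviation Rd :: "nat \<Rightarrow> point set" where
  "Rd d \<equiv> {..<d} \<rightarrow>\<^sub>E UNIV"

abbreviation lebesgue_Rd :: "nat \<Rightarrow> point measure" where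
  "lebesgue_Rd d \<equiv> PiM {..<d} (\<lambda>_. lborel)"


subsection \<open>Partial derivatives\<close>

text \<open>\<open>pderivs [i\<^sub>1, \<dots>, i\<^sub>k] f = \<partial>\<^bsub>i\<^sub>1\<^esub> \<dots> \<partial>\<^bsub>i\<^sub>k\<^esub> f\<close>.\<close>

fun pderivs :: "nat list \<Rightarrow> (point \<Rightarrow> real) \<Rightarrow> point \<Rightarrow> real" where
  "pderivs [] f = f"
| "pderivs (i # is) f = (\<lambda>x. deriv (\<lambda>t. pderivs is f (x(i := t))) (x i))"

text \<open>\<open>f \<in> C\<^sup>k(\<Theta>)\<close>, for \<open>\<Theta>\<close> open in \<open>\<real>\<^sup>d\<close>. The values of \<open>f\<close> outside \<open>\<Theta>\<close> are irrelevant.\<close>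

definition C_k_on :: "nat \<Rightarrow> nat \<Rightarrow> point set \<Rightarrow> (point \<Rightarrow> real) \<Rightarrow> bool" where
  "C_k_on d k \<Theta> f \<longleftrightarrow>
     (\<forall>is. set is \<subseteq> {..<d} \<and> length is < k \<longrightarrow>
        (\<forall>i<d. \<forall>x\<in>\<Theta>. (\<lambda>t. pderivs is f (x(i := t))) field_differentiable (at (x i)))) \<and>
     (\<forall>is. set is \<subseteq> {..<d} \<and> length is \<le> k \<longrightarrow> continuous_on \<Theta> (pderivs is f))"


subsection \<open>Matrices and tensors\<close>

type_synonym matrix = "nat \<Rightarrow> nat \<Rightarrow> real"

definition quad_form :: "nat \<Rightarrow> matrix \<Rightarrow> point \<Rightarrow> real" where
  "quad_form d H u = (\<Sum>i<d. \<Sum>j<d. u i * H i j * u j)"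

definition pos_def :: "nat \<Rightarrow> matrix \<Rightarrow> bool" where
  "pos_def d H \<longleftrightarrow> (\<forall>i<d. \<forall>j<d. H i j = H j i) \<and>
     (\<forall>u. (\<exists>i<d. u i \<noteq> 0) \<longrightarrow> quad_form d H u > 0)"

definition mnorm :: "nat \<Rightarrow> matrix \<Rightarrow> point \<Rightarrow> real" where
  "mnorm d H u = sqrt (quad_form d H u)"

definition hessian :: "(point \<Rightarrow> real) \<Rightarrow> point \<Rightarrow> matrix" where
  "hessian f x = (\<lambda>i j. pderivs [i, j] f x)"

text \<open>An order \<open>k\<close> tensor maps an index list of length \<open>k\<close> to the entry at that multi-index.\<close>

type_synonym tensor = "nat list \<Rightarrow> real"

definition tensor_inner :: "nat \<Rightarrow> nat \<Rightarrow> tensor \<Rightarrow> tensor \<Rightarrow> real" where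
  "tensor_inner d k T S = (\<Sum>is | set is \<subseteq> {..<d} \<and> length is = k. T is * S is)"

definition tensor_power :: "point \<Rightarrow> tensor" where
  "tensor_power u = (\<lambda>is. prod_list (map u is))"

definition tensor_norm :: "nat \<Rightarrow> nat \<Rightarrow> matrix \<Rightarrow> tensor \<Rightarrow> real" where
  "tensor_norm d k H T =
     (SUP u \<in> {u \<in> Rd d. mnorm d H u = 1}. \<bar>tensor_inner d k T (tensor_power u)\<bar>)"

text \<open>Read on index lists of length \<open>k\<close>, this is the tensor \<open>\<nabla>\<^sup>k f(x)\<close>.\<close>

definition nabla :: "(point \<Rightarrow> real) \<Rightarrow> point \<Rightarrow> tensor" where
  "nabla f x = (\<lambda>is. pderivs is f x)"


subsection \<open>Target measure, assumptions and Laplace approximation\<close>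

definition gibbs :: "nat \<Rightarrow> point set \<Rightarrow> (point \<Rightarrow> real) \<Rightarrow> point measure" where
  "gibbs d \<Theta> V = density (lebesgue_Rd d)
     (\<lambda>x. ennreal (indicator \<Theta> x * exp (- V x) /
                   (\<integral>y. indicator \<Theta> y * exp (- V y) \<partial>lebesgue_Rd d)))"

text \<open>\<open>\<N>(m, P\<^sup>-\<^sup>1)\<close>, parametrised by the inverse \<open>P\<close> of the covariance matrix.\<close>

definition gaussian :: "nat \<Rightarrow> point \<Rightarrow> matrix \<Rightarrow> point measure" where
  "gaussian d m P = density (lebesgue_Rd d)
     (\<lambda>x. ennreal (sqrt (Determinant.det (Matrix.mat d d (\<lambda>(i, j). P i j)) / (2 * pi) ^ d) *
                   exp (- quad_form d P (\<lambda>i. x i - m i) / 2)))"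

definition local_region :: "nat \<Rightarrow> real \<Rightarrow> (point \<Rightarrow> real) \<Rightarrow> point \<Rightarrow> real \<Rightarrow> point set" where
  "local_region d n v xh s =
     {x \<in> Rd d. mnorm d (hessian v xh) (\<lambda>i. x i - xh i) \<le> s * sqrt (real d / n)}"

definition assumption_A1 :: "nat \<Rightarrow> point set \<Rightarrow> (point \<Rightarrow> real) \<Rightarrow> point \<Rightarrow> bool" where
  "assumption_A1 d \<Theta> v xh \<longleftrightarrow> C_k_on d 4 \<Theta> v \<and>
     xh \<in> \<Theta> \<and> (\<forall>x\<in>\<Theta>. x \<noteq> xh \<longrightarrow> v xh < v x) \<and> pos_def d (hessian v xh)"

definition assumption_A2 ::
  "real \<Rightarrow> nat \<Rightarrow> real \<Rightarrow> point set \<Rightarrow> (point \<Rightarrow> real) \<Rightarrow> point \<Rightarrow> real \<Rightarrow> real \<Rightarrow> bool" where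
  "assumption_A2 C d n \<Theta> v xh s0 c0 \<longleftrightarrow> s0 > 0 \<and> 1 \<ge> c0 \<and> c0 > C / sqrt (real d) \<and>
     (\<forall>x \<in> \<Theta> - local_region d n v xh s0.
        v x - v xh \<ge> c0 * sqrt (real d / n) * mnorm d (hessian v xh) (\<lambda>i. x i - xh i))"

definition laplace :: "nat \<Rightarrow> (point \<Rightarrow> real) \<Rightarrow> point \<Rightarrow> point measure" where
  "laplace d V xh = gaussian d xh (hessian V xh)"

definition skew_correction :: "nat \<Rightarrow> (point \<Rightarrow> real) \<Rightarrow> point \<Rightarrow> point \<Rightarrow> real" where
  "skew_correction d V xh x =
     - (1 / 6) * tensor_inner d 3 (nabla V xh) (tensor_power (\<lambda>i. x i - xh i))"

text \<open>The integral against the signed measure with density \<open>1 + S\<close> relative to the Laplace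
  approximation.\<close>

definition corrected_integral ::
  "nat \<Rightarrow> (point \<Rightarrow> real) \<Rightarrow> point \<Rightarrow> (point \<Rightarrow> real) \<Rightarrow> real" where
  "corrected_integral d V xh g = (\<integral>x. g x * (1 + skew_correction d V xh x) \<partial>laplace d V xh)"

definition variance_of :: "'a measure \<Rightarrow> ('a \<Rightarrow> real) \<Rightarrow> real" where
  "variance_of M G = (\<integral>x. (G x - (\<integral>y. G y \<partial>M))\<^sup>2 \<partial>M)"

definition standardized :: "'a measure \<Rightarrow> ('a \<Rightarrow> real) \<Rightarrow> 'a \<Rightarrow> real" where
  "standardized M G x = (G x - (\<integral>y. G y \<partial>M)) / sqrt (variance_of M G)"

definition odd_about :: "nat \<Rightarrow> point \<Rightarrow> (point \<Rightarrow> real) \<Rightarrow> bool" where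
  "odd_about d xh g \<longleftrightarrow>
     (\<forall>y \<in> Rd d. g (\<lambda>i\<in>{..<d}. xh i + y i) = - g (\<lambda>i\<in>{..<d}. xh i - y i))"


subsection \<open>Small quantities\<close>

definition eps3 :: "nat \<Rightarrow> (point \<Rightarrow> real) \<Rightarrow> point \<Rightarrow> real" where
  "eps3 d V xh = real d * tensor_norm d 3 (hessian V xh) (nabla V xh)"

definition eps4 :: "nat \<Rightarrow> (point \<Rightarrow> real) \<Rightarrow> point \<Rightarrow> point set \<Rightarrow> real" where
  "eps4 d V xh U = real d * (SUP x\<in>U. sqrt (tensor_norm d 4 (hessian V xh) (nabla V x)))"

definition eps5 :: "nat \<Rightarrow> (point \<Rightarrow> real) \<Rightarrow> point \<Rightarrow> point set \<Rightarrow> real" where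
  "eps5 d V xh U = real d * (SUP x\<in>U. root 3 (tensor_norm d 5 (hessian V xh) (nabla V x)))"

definition tau :: "nat \<Rightarrow> real \<Rightarrow> real \<Rightarrow> real" where
  "tau d c0 s = real d * exp (- c0 * s * real d / 8)"

definition s_star :: "real \<Rightarrow> real \<Rightarrow> real" where
  "s_star s0 c0 = max s0 (8 / c0 * ln (2 * exp 1 / c0))"

end

theory Submission
  imports Defs "HOL-Probability.Distributions"
begin

text \<open>
  In the coordinates \<open>z\<close> in which \<open>H\<^sub>V\<close> is the identity, \<open>\<pi>\<close> has density proportional to \<open>exp r\<close>
  relative to the standard Gaussian measure, with \<open>r = S - Q + O(\<bar>z\<bar>\<^sup>5)\<close> for the cubic form \<open>S\<close> and
  the quartic form \<open>Q\<close> of the Taylor expansion. On the ball \<open>\<bar>z\<bar> \<le> s \<surd>d\<close> one expands \<open>exp r\<close>. Since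
  \<open>g\<close> is odd, the even terms \<open>1\<close>, \<open>S\<^sup>2 / 2\<close> and \<open>Q\<close> integrate to \<open>0\<close> against \<open>g\<close>; what remains beyond
  \<open>S\<close> has third order. Outside of the ball the linear growth of \<open>v\<close> applies.

  The point is that \<open>S\<close> has size \<open>\<epsilon>\<^sub>3\<close> and not \<open>\<epsilon>\<^sub>3 \<surd>d\<close>. Both the moments of \<open>S\<close> and the bound
  on \<open>exp r\<close> over the ball by \<open>E\<^sub>s\<close> follow from one exponential inequality for cubic forms,
  \<open>\<integral> exp (p - 9 \<tau>\<^sup>2 \<bar>z\<bar>\<^sup>4) \<le> exp (C \<tau>\<^sup>2 d\<^sup>2)\<close> whenever \<open>\<bar>p z\<bar> \<le> \<tau> \<bar>z\<bar>\<^sup>3\<close>, obtained by the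
  rotation argument of Maurey and Pisier.
\<close>


section \<open>Gaussian measures and linear changes of variables\<close>

text \<open>The expectation under \<pi> is a quotient, yet its denominator is expanded only to
  second order: the corrected integral has size \<open>e3\<close> itself, so an error of second
  order in the denominator contributes at third order. That expansion cannot bound the inverse of
  the denominator, because its error carries the possibly large factor \<open>E\<close>; a separate
  lower bound depending only on \<open>M\<close> does.

  The exponent in \<open>E\<close> leaves little room. Since \<open>g\<close> is controlled only in
  L2, the remainder \<open>h ^ 3 * (1 + exp r)\<close> has to be bounded in L2, and separating
  \<open>exp (2 * r)\<close> from \<open>h ^ 6\<close> by Cauchy-Schwarz asks for the fourth moment
  of \<open>exp r\<close> with bound \<open>E ^ 4\<close>. On the ball the normalised square norm
  \<open>m\<close> is at most \<open>s\<^sup>2\<close>, so for \<open>exp (4 * S)\<close> a weight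
  \<open>4 * e3\<^sup>2 * (m z)\<^sup>2\<close> is affordable and nothing larger. This is why the
  gradient of a cubic form is estimated with explicit decimals.

  The threshold \<open>s_star\<close> plays a different part: it makes the exponential decay outside
  the ball beat the factor \<open>(2 * exp 1 / c0) ^ d\<close> that integration over d coordinates
  produces.\<close>

interpretation lborel_product: product_sigma_finite "\<lambda>_::nat. lborel :: real measure" ..

section \<open>The standard Gaussian measure and its exponential moments\<close>

definition sqnorm :: "nat \<Rightarrow> point \<Rightarrow> real" where
  "sqnorm d z = (\<Sum>i<d. (z i)\<^sup>2)"

definition std_gauss :: "nat \<Rightarrow> point measure" where
  "std_gauss d = density (lebesgue_Rd d) (\<lambda>z. ennreal (\<Prod>i<d. std_normal_density (z i)))"

lemma sqnorm_nonneg [simp]: "0 \<le> sqnorm d z"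
  by (simp add: sqnorm_def sum_nonneg)

lemma sqnorm_measurable [measurable]: "sqnorm d \<in> borel_measurable (lebesgue_Rd d)"
  unfolding sqnorm_def by measurable

lemma prod_std_normal_density:
  "(\<Prod>i<d. std_normal_density (z i)) = exp (- sqnorm d z / 2) / sqrt (2 * pi) ^ d"
  by (simp add: std_normal_density_def sqnorm_def prod_dividef exp_sum sum_divide_distrib
      sum_negf[symmetric])

lemma sets_std_gauss [simp, measurable_cong]: "sets (std_gauss d) = sets (lebesgue_Rd d)"
  by (simp add: std_gauss_def)

lemma space_std_gauss [simp]: "space (std_gauss d) = Rd d"
  by (simp add: std_gauss_def space_PiM)

lemma nn_integral_std_gauss:
  assumes [measurable]: "f \<in> borel_measurable (lebesgue_Rd d)"
  shows "(\<integral>\<^sup>+z. f z \<partial>std_gauss d) =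
    (\<integral>\<^sup>+z. ennreal (\<Prod>i<d. std_normal_density (z i)) * f z \<partial>lebesgue_Rd d)"
  unfolding std_gauss_def by (subst nn_integral_density) auto

lemma nn_integral_std_gauss_prod:
  assumes [measurable]: "\<And>i. f i \<in> borel_measurable borel"
  shows "(\<integral>\<^sup>+z. (\<Prod>i<d. f i (z i)) \<partial>std_gauss d) =
    (\<Prod>i<d. \<integral>\<^sup>+x. ennreal (std_normal_density x) * f i x \<partial>lborel)"
proof -
  have "(\<integral>\<^sup>+z. (\<Prod>i<d. f i (z i)) \<partial>std_gauss d) =
    (\<integral>\<^sup>+z. (\<Prod>i<d. ennreal (std_normal_density (z i)) * f i (z i)) \<partial>lebesgue_Rd d)"
    by (subst nn_integral_std_gauss) (auto simp: prod_ennreal prod.distrib)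
  also have "\<dots> = (\<Prod>i<d. \<integral>\<^sup>+x. ennreal (std_normal_density x) * f i x \<partial>lborel)"
    by (subst lborel_product.product_nn_integral_prod) auto
  finally show ?thesis .
qed

lemma nn_integral_normal_density:
  "\<sigma> > 0 \<Longrightarrow> (\<integral>\<^sup>+x. ennreal (normal_density \<mu> \<sigma> x) \<partial>lborel) = 1"
  by (subst nn_integral_eq_integral) auto

lemma prob_space_std_gauss: "prob_space (std_gauss d)"
proof
  have "emeasure (std_gauss d) (space (std_gauss d)) = (\<integral>\<^sup>+z. (\<Prod>i<d. 1) \<partial>std_gauss d)"
    by (simp add: nn_integral_const)
  also have "\<dots> = 1"
    by (subst nn_integral_std_gauss_prod) (auto simp: nn_integral_normal_density)
  finally show "emeasure (std_gauss d) (space (std_gauss d)) = 1" .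
qed

text \<open>Completing the square in each coordinate. This evaluates the average over the velocity
  in the rotation argument.\<close>

lemma nn_integral_std_gauss_exp_linear:
  "(\<integral>\<^sup>+z. ennreal (exp (\<Sum>i<d. a i * z i)) \<partial>std_gauss d) = ennreal (exp (sqnorm d a / 2))"
proof -
  have 1: "(\<integral>\<^sup>+x. ennreal (std_normal_density x) * ennreal (exp (c * x)) \<partial>lborel) =
    ennreal (exp (c\<^sup>2 / 2))" for c :: real
  proof -
    have "std_normal_density x * exp (c * x) = exp (c\<^sup>2 / 2) * normal_density c 1 x" for x
      by (simp add: normal_density_def exp_add[symmetric] power2_eq_square field_simps)
    then have "(\<integral>\<^sup>+x. ennreal (std_normal_density x) * ennreal (exp (c * x)) \<partial>lborel) =
      (\<integral>\<^sup>+x. ennreal (exp (c\<^sup>2 / 2)) * ennreal (normal_density c 1 x) \<partial>lborel)"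
      by (simp add: ennreal_mult[symmetric])
    then show ?thesis
      by (simp add: nn_integral_cmult nn_integral_normal_density)
  qed
  have "(\<integral>\<^sup>+z. ennreal (exp (\<Sum>i<d. a i * z i)) \<partial>std_gauss d) =
    (\<integral>\<^sup>+z. (\<Prod>i<d. ennreal (exp (a i * z i))) \<partial>std_gauss d)"
    by (simp add: exp_sum prod_ennreal)
  also have "\<dots> = ennreal (\<Prod>i<d. exp ((a i)\<^sup>2 / 2))"
    by (subst nn_integral_std_gauss_prod) (auto simp: 1 prod_ennreal)
  finally show ?thesis
    by (simp add: exp_sum[symmetric] sqnorm_def sum_divide_distrib)
qed

text \<open>In each coordinate the integrand is a multiple of the normal density of variance
  \<open>1 / (1 - 2 * b)\<close>, and the multiple is its standard deviation.\<close>

lemma nn_integral_std_gauss_exp_sqnorm: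
  assumes "b < 1 / 2"
  shows "(\<integral>\<^sup>+z. ennreal (exp (b * sqnorm d z)) \<partial>std_gauss d) = ennreal ((1 / sqrt (1 - 2 * b)) ^ d)"
proof -
  have 1: "(\<integral>\<^sup>+x. ennreal (std_normal_density x) * ennreal (exp (b * x\<^sup>2)) \<partial>lborel) =
    ennreal (1 / sqrt (1 - 2 * b))"
  proof -
    define \<sigma> where "\<sigma> = 1 / sqrt (1 - 2 * b)"
    have \<sigma>: "\<sigma> > 0" "\<sigma>\<^sup>2 = 1 / (1 - 2 * b)"
      using assms by (auto simp: \<sigma>_def power_divide)
    have s: "sqrt (2 * pi * \<sigma>\<^sup>2) = sqrt (2 * pi) * \<sigma>"
      using \<sigma>(1) by (simp add: real_sqrt_mult)
    have "- (x\<^sup>2) / 2 + b * x\<^sup>2 = - (x\<^sup>2) / (2 * \<sigma>\<^sup>2)" for x :: real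
      using assms by (simp add: \<sigma>(2) field_simps)
    then have "exp (- (x\<^sup>2) / 2) * exp (b * x\<^sup>2) = exp (- (x\<^sup>2) / (2 * \<sigma>\<^sup>2))" for x :: real
      by (metis exp_add)
    then have "std_normal_density x * exp (b * x\<^sup>2) = \<sigma> * normal_density 0 \<sigma> x" for x
      using \<sigma>(1) by (simp add: normal_density_def s)
    then have "(\<integral>\<^sup>+x. ennreal (std_normal_density x) * ennreal (exp (b * x\<^sup>2)) \<partial>lborel) =
      (\<integral>\<^sup>+x. ennreal \<sigma> * ennreal (normal_density 0 \<sigma> x) \<partial>lborel)"
      using \<sigma>(1) by (simp add: ennreal_mult[symmetric])
    then show ?thesis
      using \<sigma>(1) by (simp add: nn_integral_cmult nn_integral_normal_density \<sigma>_def)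
  qed
  have "(\<integral>\<^sup>+z. ennreal (exp (b * sqnorm d z)) \<partial>std_gauss d) =
    (\<integral>\<^sup>+z. (\<Prod>i<d. ennreal (exp (b * (z i)\<^sup>2))) \<partial>std_gauss d)"
    by (simp add: exp_sum prod_ennreal sqnorm_def sum_distrib_left)
  also have "\<dots> = (\<Prod>i<d. ennreal (1 / sqrt (1 - 2 * b)))"
    by (subst nn_integral_std_gauss_prod) (auto simp: 1)
  finally show ?thesis
    using assms by (simp add: ennreal_power)
qed

section \<open>Triangular affine changes of variables\<close>

definition tri_map :: "nat \<Rightarrow> point \<Rightarrow> matrix \<Rightarrow> point \<Rightarrow> point" where
  "tri_map d m A z = (\<lambda>i\<in>{..<d}. m i + (\<Sum>j\<le>i. A i j * z j))"

lemma tri_map_measurable [measurable]: "tri_map d m A \<in> measurable (lebesgue_Rd d) (lebesgue_Rd d)"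
  unfolding tri_map_def
proof (rule measurable_restrict)
  fix i assume "i \<in> {..<d}"
  then have [measurable]: "(\<lambda>z. z j) \<in> borel_measurable (lebesgue_Rd d)" if "j \<le> i" for j
    using that measurable_component_singleton[of j "{..<d}" "\<lambda>_. lborel"] by simp
  show "(\<lambda>z. m i + (\<Sum>j\<le>i. A i j * z j)) \<in> lebesgue_Rd d \<rightarrow>\<^sub>M lborel"
    by simp
qed

lemma tri_map_upd:
  assumes "z \<in> Rd d"
  shows "tri_map (Suc d) m A (z(d := y)) = (tri_map d m A z)(d := (m d + (\<Sum>j<d. A d j * z j)) + A d d * y)"
proof
  fix i
  have "(\<Sum>j\<le>i. A i j * (if j = d then y else z j)) = (\<Sum>j\<le>i. A i j * z j)" if "i < d"
    using that by (intro sum.cong) auto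
  moreover have "(\<Sum>j\<le>d. A d j * (if j = d then y else z j)) = (\<Sum>j<d. A d j * z j) + A d d * y"
    by (subst lessThan_Suc_atMost[symmetric]) simp
  ultimately show "tri_map (Suc d) m A (z(d := y)) i =
    ((tri_map d m A z)(d := (m d + (\<Sum>j<d. A d j * z j)) + A d d * y)) i"
    by (auto simp: tri_map_def)
qed

text \<open>Induction on the dimension. In a triangular map the last coordinate enters only the last
  component, so Tonelli splits it off, a one-dimensional affine substitution contributes
  \<open>\<bar>A d d\<bar>\<close>, and the induction hypothesis treats the other coordinates.
  Absolute values are kept because the reflection has diagonal entries \<open>- 1\<close>.\<close>

lemma nn_integral_tri_map:
  assumes "\<And>i. i < d \<Longrightarrow> A i i \<noteq> 0" and "f \<in> borel_measurable (lebesgue_Rd d)"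
  shows "(\<integral>\<^sup>+x. f x \<partial>lebesgue_Rd d) =
    ennreal (\<Prod>i<d. \<bar>A i i\<bar>) * (\<integral>\<^sup>+z. f (tri_map d m A z) \<partial>lebesgue_Rd d)"
  using assms
proof (induction d arbitrary: f)
  case 0
  then show ?case
    by (simp add: tri_map_def restrict_def PiM_empty nn_integral_count_space_finite)
next
  case (Suc d)
  note [measurable] = Suc.prems(2)
  have ins: "{..<Suc d} = insert d {..<d}" by auto
  have [measurable]: "f \<in> borel_measurable (Pi\<^sub>M (insert d {..<d}) (\<lambda>_. lborel))"
    using Suc.prems(2) by (simp add: ins)
  have f_upd: "(\<lambda>(x, y). f (x(d := y))) \<in> borel_measurable (lebesgue_Rd d \<Otimes>\<^sub>M lborel)"
    using measurable_compose[OF measurable_add_dim \<open>f \<in> borel_measurable (Pi\<^sub>M (insert d {..<d}) _)\<close>]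
    by (simp add: split_beta')
  have tri: "tri_map (Suc d) m A \<in> measurable (Pi\<^sub>M (insert d {..<d}) (\<lambda>_. lborel)) (Pi\<^sub>M (insert d {..<d}) (\<lambda>_. lborel))"
    using tri_map_measurable[of "Suc d" m A] by (simp only: ins)
  have f_tri: "(\<lambda>(x, y). f (tri_map (Suc d) m A (x(d := y)))) \<in> borel_measurable (lebesgue_Rd d \<Otimes>\<^sub>M lborel)"
    using measurable_compose[OF measurable_compose[OF measurable_add_dim tri]
        \<open>f \<in> borel_measurable (Pi\<^sub>M (insert d {..<d}) _)\<close>]
    by (simp add: split_beta')
  have "(\<integral>\<^sup>+x. f x \<partial>lebesgue_Rd (Suc d)) = (\<integral>\<^sup>+x. (\<integral>\<^sup>+y. f (x(d := y)) \<partial>lborel) \<partial>lebesgue_Rd d)"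
    unfolding ins by (subst lborel_product.product_nn_integral_insert) auto
  \<comment> \<open>The induction hypothesis is applied to the function of the first d coordinates
    obtained by integrating out the last one, hence the generalisation over
    \<open>f\<close>.\<close>
  also have "\<dots> = ennreal (\<Prod>i<d. \<bar>A i i\<bar>) * (\<integral>\<^sup>+z. (\<integral>\<^sup>+y. f ((tri_map d m A z)(d := y)) \<partial>lborel) \<partial>lebesgue_Rd d)"
    using Suc.prems(1) by (intro Suc.IH lborel.borel_measurable_nn_integral f_upd) auto
  also have "(\<integral>\<^sup>+z. (\<integral>\<^sup>+y. f ((tri_map d m A z)(d := y)) \<partial>lborel) \<partial>lebesgue_Rd d) =
    (\<integral>\<^sup>+z. ennreal \<bar>A d d\<bar> * (\<integral>\<^sup>+y. f (tri_map (Suc d) m A (z(d := y))) \<partial>lborel) \<partial>lebesgue_Rd d)"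
  proof (rule nn_integral_cong)
    fix z assume "z \<in> space (lebesgue_Rd d)"
    then have z: "z \<in> Rd d" by (simp add: space_PiM)
    then have T: "tri_map d m A z \<in> space (lebesgue_Rd d)"
      by (simp add: space_PiM tri_map_def)
    have [measurable]: "(\<lambda>y. f ((tri_map d m A z)(d := y))) \<in> borel_measurable borel"
      using T by (intro measurable_compose[OF _ \<open>f \<in> borel_measurable (Pi\<^sub>M (insert d {..<d}) (\<lambda>_. lborel))\<close>]
        measurable_fun_upd[where J="{..<d}"]) auto
    have "A d d \<noteq> 0" using Suc.prems(1) by simp
    then show "(\<integral>\<^sup>+y. f ((tri_map d m A z)(d := y)) \<partial>lborel) =
      ennreal \<bar>A d d\<bar> * (\<integral>\<^sup>+y. f (tri_map (Suc d) m A (z(d := y))) \<partial>lborel)"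
      using z by (subst nn_integral_real_affine[where c="A d d" and t="m d + (\<Sum>j<d. A d j * z j)"])
        (auto simp: tri_map_upd)
  qed
  also have "\<dots> = ennreal \<bar>A d d\<bar> * (\<integral>\<^sup>+z. (\<integral>\<^sup>+y. f (tri_map (Suc d) m A (z(d := y))) \<partial>lborel) \<partial>lebesgue_Rd d)"
    by (intro nn_integral_cmult lborel.borel_measurable_nn_integral f_tri)
  also have "(\<integral>\<^sup>+z. (\<integral>\<^sup>+y. f (tri_map (Suc d) m A (z(d := y))) \<partial>lborel) \<partial>lebesgue_Rd d) =
     (\<integral>\<^sup>+z. f (tri_map (Suc d) m A z) \<partial>lebesgue_Rd (Suc d))"
    unfolding ins using tri by (subst lborel_product.product_nn_integral_insert) auto
  moreover have P: "ennreal ((\<Prod>i<d. \<bar>A i i\<bar>) * \<bar>A d d\<bar>) = ennreal (\<Prod>i<d. \<bar>A i i\<bar>) * ennreal \<bar>A d d\<bar>"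
    by (intro ennreal_mult prod_nonneg) auto
  ultimately show ?case
    by (simp add: mult.assoc P)
qed


text \<open>The density is the Jacobian of the map times the reciprocal of the Gaussian density. As
  an equality of measures, the fact transfers Bochner integrals as well as nonnegative ones.\<close>

lemma lebesgue_Rd_eq_distr:
  assumes A: "\<And>i. i < d \<Longrightarrow> A i i > 0"
  defines "c \<equiv> (\<Prod>i<d. A i i) * sqrt (2 * pi) ^ d"
  shows "lebesgue_Rd d = distr (density (std_gauss d) (\<lambda>z. ennreal (c * exp (sqnorm d z / 2)))) (lebesgue_Rd d) (tri_map d p A)"
proof -
  define P where "P = (\<Prod>i<d. A i i)"
  have c_eq: "c = P * sqrt (2 * pi) ^ d" by (simp add: c_def P_def)
  have P: "P > 0" unfolding P_def by (intro prod_pos) (auto intro: A)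
  then have c: "c > 0" by (simp add: c_eq)
  show ?thesis
  proof (rule measure_eqI)
    fix X assume X [measurable]: "X \<in> sets (lebesgue_Rd d)"
    have "emeasure (lebesgue_Rd d) X = (\<integral>\<^sup>+x. indicator X x \<partial>lebesgue_Rd d)" by simp
    also have "\<dots> = ennreal (\<Prod>i<d. \<bar>A i i\<bar>) * (\<integral>\<^sup>+z. indicator X (tri_map d p A z) \<partial>lebesgue_Rd d)"
      using A by (intro nn_integral_tri_map) (auto simp: less_imp_neq[symmetric])
    also have "(\<Prod>i<d. \<bar>A i i\<bar>) = P"
      unfolding P_def using A by (intro prod.cong refl) (simp add: less_imp_le)
    also have "ennreal P * (\<integral>\<^sup>+z. indicator X (tri_map d p A z) \<partial>lebesgue_Rd d) =
      (\<integral>\<^sup>+z. ennreal P * indicator X (tri_map d p A z) \<partial>lebesgue_Rd d)"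
      by (intro nn_integral_cmult[symmetric]) measurable
    also have "\<dots> = (\<integral>\<^sup>+z. ennreal (exp (- sqnorm d z / 2) / sqrt (2 * pi) ^ d) *
      (ennreal (c * exp (sqnorm d z / 2)) * indicator X (tri_map d p A z)) \<partial>lebesgue_Rd d)"
    proof (intro nn_integral_cong)
      fix z
      have "exp (- sqnorm d z / 2) / sqrt (2 * pi) ^ d * (c * exp (sqnorm d z / 2)) = P"
        by (simp add: c_eq exp_minus field_simps)
      then have "ennreal (exp (- sqnorm d z / 2) / sqrt (2 * pi) ^ d) * ennreal (c * exp (sqnorm d z / 2)) = ennreal P"
        by (subst ennreal_mult'[symmetric]) auto
      then show "ennreal P * indicator X (tri_map d p A z) = ennreal (exp (- sqnorm d z / 2) / sqrt (2 * pi) ^ d) *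
        (ennreal (c * exp (sqnorm d z / 2)) * indicator X (tri_map d p A z))"
        by (simp only: mult.assoc[symmetric])
    qed
    also have "\<dots> = (\<integral>\<^sup>+z. ennreal (c * exp (sqnorm d z / 2)) * indicator X (tri_map d p A z) \<partial>std_gauss d)"
      by (subst nn_integral_std_gauss) (auto simp: prod_std_normal_density)
    also have "\<dots> = (\<integral>\<^sup>+z. indicator X (tri_map d p A z) \<partial>density (std_gauss d) (\<lambda>z. ennreal (c * exp (sqnorm d z / 2))))"
      by (subst nn_integral_density) auto
    also have "\<dots> = (\<integral>\<^sup>+x. indicator X x \<partial>distr (density (std_gauss d) (\<lambda>z. ennreal (c * exp (sqnorm d z / 2)))) (lebesgue_Rd d) (tri_map d p A))"
      by (subst nn_integral_distr) auto
    finally show "emeasure (lebesgue_Rd d) X =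
      emeasure (distr (density (std_gauss d) (\<lambda>z. ennreal (c * exp (sqnorm d z / 2)))) (lebesgue_Rd d) (tri_map d p A)) X"
      by simp
  qed simp
qed

section \<open>Cholesky factorisation and Gaussian measures with a given precision matrix\<close>

definition tri_lin :: "matrix \<Rightarrow> point \<Rightarrow> point" where
  "tri_lin A z = (\<lambda>i. \<Sum>j\<le>i. A i j * z j)"

lemma tri_map_eq: "tri_map d m A z = (\<lambda>i\<in>{..<d}. m i + tri_lin A z i)"
  by (simp add: tri_map_def tri_lin_def)

lemma tri_lin_add: "tri_lin A (\<lambda>i. z i + w i) = (\<lambda>i. tri_lin A z i + tri_lin A w i)"
  by (simp add: tri_lin_def distrib_left sum.distrib)

lemma quad_form_cong:
  "(\<And>i. i < d \<Longrightarrow> u i = w i) \<Longrightarrow> quad_form d H u = quad_form d H w"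
  by (simp add: quad_form_def)

text \<open>Completing the square in the last coordinate; the matrix that remains is the Schur
  complement of the entry \<open>H d d\<close>.\<close>

lemma quad_form_Suc:
  assumes sym: "\<And>i j. i < Suc d \<Longrightarrow> j < Suc d \<Longrightarrow> H i j = H j i" and c: "H d d \<noteq> 0"
  shows "quad_form (Suc d) H u =
    quad_form d (\<lambda>i j. H i j - H d i * H d j / H d d) u +
    H d d * (u d + (\<Sum>i<d. H d i * u i) / H d d)\<^sup>2"
proof -
  define q where "q = (\<Sum>i<d. H d i * u i)"
  have 1: "quad_form (Suc d) H u = quad_form d H u + 2 * u d * q + H d d * (u d)\<^sup>2"
  proof -
    have "(\<Sum>i<d. u i * H i d * u d) = u d * q"
      unfolding q_def sum_distrib_left by (intro sum.cong) (auto simp: sym[of _ d])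
    moreover have "(\<Sum>j<d. u d * H d j * u j) = u d * q"
      unfolding q_def sum_distrib_left by (intro sum.cong) auto
    ultimately show ?thesis
      by (simp add: quad_form_def sum.distrib power2_eq_square)
  qed
  have "(\<Sum>i<d. \<Sum>j<d. u i * (H d i * H d j / H d d) * u j) = q * q / H d d"
    by (simp add: q_def sum_product sum_divide_distrib mult_ac)
  then have 2: "quad_form d (\<lambda>i j. H i j - H d i * H d j / H d d) u = quad_form d H u - q * q / H d d"
    by (simp add: quad_form_def sum_subtractf left_diff_distrib right_diff_distrib)
  show ?thesis
    unfolding 1 2 q_def[symmetric] using c by (simp add: power2_eq_square field_simps)
qed

lemma pos_def_sym: "pos_def d H \<Longrightarrow> i < d \<Longrightarrow> j < d \<Longrightarrow> H i j = H j i"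
  unfolding pos_def_def by blast

lemma pos_def_pos: "pos_def d H \<Longrightarrow> i < d \<Longrightarrow> u i \<noteq> 0 \<Longrightarrow> quad_form d H u > 0"
  unfolding pos_def_def by blast

text \<open>Induction through the Schur complement: a factor for it is extended by one row. The
  factor is lower triangular because \<open>tri_lin\<close> reads only the entries with
  \<open>j \<le> i\<close>; it turns the quadratic form into the Euclidean one, and the last
  property replaces an explicit inverse.\<close>

lemma cholesky:
  assumes "pos_def d H"
  obtains A where "\<And>i. i < d \<Longrightarrow> A i i > 0"
    and "\<And>z. quad_form d H (tri_lin A z) = sqnorm d z"
    and "\<And>x. \<exists>z. \<forall>i<d. tri_lin A z i = x i"
proof -
  have "\<exists>A. (\<forall>i<d. A i i > 0) \<and> (\<forall>z. quad_form d H (tri_lin A z) = sqnorm d z) \<and>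
    (\<forall>x. \<exists>z. \<forall>i<d. tri_lin A z i = x i)"
    using assms
  proof (induction d arbitrary: H)
    case 0
    then show ?case by (simp add: quad_form_def sqnorm_def)
  next
    case (Suc d)
    define c where "c = H d d"
    define H' where "H' = (\<lambda>i j. H i j - H d i * H d j / H d d)"
    have sym: "H i j = H j i" if "i < Suc d" "j < Suc d" for i j
      using Suc.prems that by (rule pos_def_sym)
    have c: "c > 0"
    proof -
      define e where "e = (\<lambda>i. if i = d then 1 else 0 :: real)"
      have "quad_form (Suc d) H e = c"
        by (simp add: quad_form_def e_def c_def)
      moreover have "e d \<noteq> 0" by (simp add: e_def)
      ultimately show ?thesis
        using pos_def_pos[OF Suc.prems, of d e] by simp
    qed
    have qf: "quad_form (Suc d) H u = quad_form d H' u + c * (u d + (\<Sum>i<d. H d i * u i) / c)\<^sup>2" for u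
      unfolding c_def H'_def using c c_def by (intro quad_form_Suc sym) auto
    have "pos_def d H'"
      unfolding pos_def_def
    proof (intro conjI allI impI)
      fix i j assume "i < d" "j < d"
      then show "H' i j = H' j i"
        using sym[of i j] by (simp add: H'_def)
    next
      fix u :: point assume u: "\<exists>i<d. u i \<noteq> 0"
      \<comment> \<open>The last coordinate is chosen to annihilate the completed square, so the
        Schur complement at \<open>u\<close> takes the value of the positive form \<open>H\<close>
        at \<open>w\<close>.\<close>
      define w where "w = u(d := - (\<Sum>i<d. H d i * u i) / c)"
      have "quad_form (Suc d) H w = quad_form d H' w"
        unfolding qf using c by (simp add: w_def)
      also have "\<dots> = quad_form d H' u"
        by (intro quad_form_cong) (simp add: w_def)
      finally have "quad_form (Suc d) H w = quad_form d H' u" .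
      moreover from u obtain i where "i < d" "u i \<noteq> 0" by blast
      then have "quad_form (Suc d) H w > 0"
        by (intro pos_def_pos[OF Suc.prems, of i]) (auto simp: w_def)
      ultimately show "quad_form d H' u > 0" by simp
    qed
    from Suc.IH[OF this] obtain A' where A': "\<And>i. i < d \<Longrightarrow> A' i i > 0"
      "\<And>z. quad_form d H' (tri_lin A' z) = sqnorm d z" "\<And>x. \<exists>z. \<forall>i<d. tri_lin A' z i = x i"
      by blast
    \<comment> \<open>The new row is chosen so that the linear form inside the completed square
      becomes \<open>z d / sqrt c\<close>; the square then contributes exactly
      \<open>(z d)\<^sup>2\<close>.\<close>
    define A where "A = (\<lambda>i j. if i < d then A' i j else if j < d
      then - (\<Sum>k<d. if j \<le> k then H d k * A' k j else 0) / c else 1 / sqrt c)"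
    have Alt: "tri_lin A z i = tri_lin A' z i" if "i < d" for i z
      using that by (simp add: tri_lin_def A_def)
    have "(\<Sum>k<d. H d k * tri_lin A' z k) =
      (\<Sum>j<d. (\<Sum>k<d. if j \<le> k then H d k * A' k j else 0) * z j)" for z
    proof -
      have "tri_lin A' z k = (\<Sum>j<d. if j \<le> k then A' k j * z j else 0)" if "k < d" for k
        unfolding tri_lin_def using that
        by (subst sum.inter_filter[symmetric]) (auto intro!: sum.cong)
      then have "(\<Sum>k<d. H d k * tri_lin A' z k) =
          (\<Sum>k<d. \<Sum>j<d. (if j \<le> k then H d k * A' k j else 0) * z j)"
        by (intro sum.cong) (auto simp: sum_distrib_left intro!: sum.cong)
      also have "\<dots> = (\<Sum>j<d. \<Sum>k<d. (if j \<le> k then H d k * A' k j else 0) * z j)"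
        by (rule sum.swap)
      finally show ?thesis
        by (simp add: sum_distrib_right)
    qed
    then have Ad: "tri_lin A z d = z d / sqrt c - (\<Sum>k<d. H d k * tri_lin A' z k) / c" for z
    proof -
      have "tri_lin A z d = (\<Sum>j<d. A d j * z j) + A d d * z d"
        unfolding tri_lin_def by (subst lessThan_Suc_atMost[symmetric]) simp
      also have "(\<Sum>j<d. A d j * z j) =
        - (\<Sum>j<d. (\<Sum>k<d. if j \<le> k then H d k * A' k j else 0) * z j) / c"
      proof -
        have "(\<Sum>j<d. A d j * z j) =
          (\<Sum>j<d. (- 1 / c) * ((\<Sum>k<d. if j \<le> k then H d k * A' k j else 0) * z j))"
          by (intro sum.cong) (auto simp: A_def)
        then show ?thesis
          unfolding sum_distrib_left[symmetric] by simp
      qed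
      finally show ?thesis
        using \<open>(\<Sum>k<d. H d k * tri_lin A' z k) = _\<close> by (simp add: A_def)
    qed
    have "A i i > 0" if "i < Suc d" for i
      using that c A'(1) by (auto simp: A_def less_Suc_eq)
    moreover have "quad_form (Suc d) H (tri_lin A z) = sqnorm (Suc d) z" for z
    proof -
      have "quad_form d H' (tri_lin A z) = sqnorm d z"
        using A'(2)[of z] by (metis (mono_tags, lifting) Alt quad_form_cong)
      moreover have "c * (tri_lin A z d + (\<Sum>i<d. H d i * tri_lin A z i) / c)\<^sup>2 = (z d)\<^sup>2"
        using c by (simp add: Ad Alt power_divide)
      ultimately show ?thesis by (simp add: qf sqnorm_def)
    qed
    moreover have "\<exists>z. \<forall>i<Suc d. tri_lin A z i = x i" for x
    proof -
      obtain z where z: "\<forall>i<d. tri_lin A' z i = x i" using A'(3) by blast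
      define w where "w = z(d := sqrt c * (x d + (\<Sum>k<d. H d k * x k) / c))"
      have w: "tri_lin A' w i = x i" if "i < d" for i
      proof -
        have "tri_lin A' w i = tri_lin A' z i"
          using that by (simp add: tri_lin_def w_def)
        with z that show ?thesis by simp
      qed
      have "tri_lin A w i = x i" if "i < Suc d" for i
        using that c w by (auto simp: less_Suc_eq Alt Ad) (simp add: w_def)
      then show ?thesis by blast
    qed
    ultimately show ?case by blast
  qed
  then show ?thesis using that by blast
qed

text \<open>Polarising the identity of quadratic forms gives the matrix identity that the transpose
  of L times H times L is 1; the determinant of the triangular L is the product of its
  diagonal.\<close>

lemma det_cholesky:
  assumes sym: "\<And>i j. i < d \<Longrightarrow> j < d \<Longrightarrow> H i j = H j i"
    and qf: "\<And>z. quad_form d H (tri_lin A z) = sqnorm d z"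
  shows "Determinant.det (Matrix.mat d d (\<lambda>(i, j). H i j)) * (\<Prod>i<d. A i i)\<^sup>2 = 1"
proof -
  define b where "b = (\<lambda>z w. \<Sum>i<d. \<Sum>j<d. tri_lin A z i * H i j * tri_lin A w j)"
  have bs: "b z w = b w z" for z w
    unfolding b_def by (subst sum.swap) (auto intro!: sum.cong simp: sym)
  have bzw: "b z w = (\<Sum>i<d. z i * w i)" for z w
  proof -
    have "quad_form d H (tri_lin A (\<lambda>i. z i + w i)) =
      quad_form d H (tri_lin A z) + b z w + b w z + quad_form d H (tri_lin A w)"
      by (simp add: tri_lin_add quad_form_def b_def distrib_left distrib_right sum.distrib)
    then show ?thesis
      using bs[of z w] by (simp add: qf sqnorm_def power2_sum sum.distrib sum_distrib_left[symmetric] mult.assoc)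
  qed
  define M where "M = Matrix.mat d d (\<lambda>(i, j). H i j)"
  define L where "L = Matrix.mat d d (\<lambda>(i, j). if j \<le> i then A i j else 0)"
  have M: "M \<in> carrier_mat d d" and L: "L \<in> carrier_mat d d" by (auto simp: M_def L_def)
  have "transpose_mat L * (M * L) = 1\<^sub>m d"
  proof (rule eq_matI)
    fix a c assume "a < dim_row (1\<^sub>m d :: real mat)" "c < dim_col (1\<^sub>m d :: real mat)"
    then have ac: "a < d" "c < d" by auto
    define e :: "nat \<Rightarrow> point" where "e = (\<lambda>a i. if i = a then 1 else 0)"
    have te: "tri_lin A (e a) i = (if a \<le> i then A i a else 0)" for a i
      by (simp add: tri_lin_def e_def if_distrib cong: if_cong)
    have "(transpose_mat L * (M * L)) $$ (a, c) = b (e a) (e c)"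
      using ac L M unfolding b_def te
      by (simp add: L_def M_def scalar_prod_def sum_distrib_left atLeast0LessThan mult.assoc)
    also have "\<dots> = (if a = c then 1 else 0)"
    proof -
      have "b (e a) (e c) = (\<Sum>i<d. if i = c then e a i else 0)"
        unfolding bzw by (intro sum.cong) (auto simp: e_def)
      then show ?thesis using ac by (simp add: e_def)
    qed
    finally show "(transpose_mat L * (M * L)) $$ (a, c) = 1\<^sub>m d $$ (a, c)"
      using ac by simp
  qed (auto simp: L_def M_def)
  then have "Determinant.det (transpose_mat L * (M * L)) = 1" by simp
  then have "Determinant.det L * (Determinant.det M * Determinant.det L) = 1"
    using L M by (simp add: det_mult[of _ d] det_transpose[of _ d])
  moreover have "Determinant.det L = prod_list (diag_mat L)"
    using L by (intro det_lower_triangular[of d]) (auto simp: L_def)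
  moreover have "prod_list (diag_mat L) = (\<Prod>i<d. A i i)"
    by (simp add: diag_mat_def L_def prod.list_conv_set_nth atLeast0LessThan)
  ultimately show ?thesis
    by (simp add: M_def power2_eq_square mult_ac)
qed

text \<open>By \<open>det_cholesky\<close> the normalising factor is the reciprocal of the Jacobian
  constant \<open>c\<close>, so the Gaussian density, read through the map, cancels the density of
  Lebesgue measure relative to \<open>std_gauss\<close>.\<close>

lemma gaussian_eq_distr:
  assumes A: "\<And>i. i < d \<Longrightarrow> A i i > 0" and qf: "\<And>z. quad_form d H (tri_lin A z) = sqnorm d z"
    and sym: "\<And>i j. i < d \<Longrightarrow> j < d \<Longrightarrow> H i j = H j i"
  shows "gaussian d m H = distr (std_gauss d) (lebesgue_Rd d) (tri_map d m A)"
proof -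
  define P where "P = (\<Prod>i<d. A i i)"
  define k where "k = sqrt (Determinant.det (Matrix.mat d d (\<lambda>(i, j). H i j)) / (2 * pi) ^ d)"
  define c where "c = P * sqrt (2 * pi) ^ d"
  define f where "f = (\<lambda>x. ennreal (k * exp (- quad_form d H (\<lambda>i. x i - m i) / 2)))"
  have [measurable]: "f \<in> borel_measurable (lebesgue_Rd d)"
    unfolding f_def quad_form_def by measurable
  have P: "P > 0" unfolding P_def by (intro prod_pos) (auto intro: A)
  have "Determinant.det (Matrix.mat d d (\<lambda>(i, j). H i j)) = 1 / P\<^sup>2"
    using det_cholesky[OF sym qf] P unfolding P_def[symmetric] by (simp add: eq_divide_eq)
  then have "k = sqrt (1 / P\<^sup>2) / sqrt ((2 * pi) ^ d)"
    unfolding k_def by (simp only: real_sqrt_divide)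
  also have "\<dots> = 1 / P / sqrt (2 * pi) ^ d"
  proof -
    have "sqrt (1 / P\<^sup>2) = 1 / P" using P by (simp add: real_sqrt_divide)
    then show ?thesis by (simp only: real_sqrt_power)
  qed
  finally have ck: "c * k = 1" "c > 0" using P by (simp_all add: c_def)
  have one: "ennreal (c * exp (sqnorm d z / 2)) * f (tri_map d m A z) = 1" for z
  proof -
    have "quad_form d H (\<lambda>i. tri_map d m A z i - m i) = sqnorm d z"
      unfolding qf[symmetric] by (intro quad_form_cong) (simp add: tri_map_eq)
    moreover have "c * exp (sqnorm d z / 2) * (k * exp (- sqnorm d z / 2)) = (c * k) * exp (sqnorm d z / 2 + - sqnorm d z / 2)"
      by (simp only: exp_add mult_ac)
    ultimately show ?thesis
      using ck by (simp add: f_def ennreal_mult'[symmetric])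
  qed
  have "gaussian d m H = density (lebesgue_Rd d) f"
    by (simp add: gaussian_def f_def k_def)
  also have "\<dots> = density (distr (density (std_gauss d) (\<lambda>z. ennreal (c * exp (sqnorm d z / 2)))) (lebesgue_Rd d) (tri_map d m A)) f"
    unfolding c_def P_def by (subst lebesgue_Rd_eq_distr[OF A, symmetric]) auto
  also have "\<dots> = distr (density (std_gauss d) (\<lambda>z. ennreal (c * exp (sqnorm d z / 2)) * f (tri_map d m A z)))
      (lebesgue_Rd d) (tri_map d m A)"
    by (subst density_distr) (auto simp: density_density_eq)
  finally show ?thesis by (simp add: one density_1)
qed

section \<open>Rotation and reflection invariance\<close>

definition lincomb :: "nat \<Rightarrow> real \<Rightarrow> point \<Rightarrow> real \<Rightarrow> point \<Rightarrow> point" where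
  "lincomb d a x b y = (\<lambda>i\<in>{..<d}. a * x i + b * y i)"

lemma lincomb_measurable [measurable]:
  assumes [measurable]: "a \<in> borel_measurable M" "b \<in> borel_measurable M"
    "f \<in> measurable M (lebesgue_Rd d)" "g \<in> measurable M (lebesgue_Rd d)"
  shows "(\<lambda>w. lincomb d (a w) (f w) (b w) (g w)) \<in> measurable M (lebesgue_Rd d)"
  unfolding lincomb_def
proof (rule measurable_restrict)
  fix i assume i: "i \<in> {..<d}"
  have [measurable]: "(\<lambda>w. f w i) \<in> borel_measurable M" "(\<lambda>w. g w i) \<in> borel_measurable M"
    using i measurable_compose[OF assms(3) measurable_component_singleton[OF i]]
      measurable_compose[OF assms(4) measurable_component_singleton[OF i]] by simp_all
  show "(\<lambda>w. a w * f w i + b w * g w i) \<in> M \<rightarrow>\<^sub>M lborel"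
    by simp
qed

lemma lincomb_in_Rd [simp]: "lincomb d a x b y \<in> Rd d"
  by (simp add: lincomb_def)

lemma nn_integral_lebesgue_Rd_shift:
  assumes [measurable]: "f \<in> borel_measurable (lebesgue_Rd d)"
  shows "(\<integral>\<^sup>+x. f (lincomb d 1 x a y) \<partial>lebesgue_Rd d) = (\<integral>\<^sup>+x. f x \<partial>lebesgue_Rd d)"
proof -
  define A :: matrix where "A = (\<lambda>i j. if i = j then 1 else 0)"
  have "tri_map d (\<lambda>i. a * y i) A x = lincomb d 1 x a y" for x
    by (auto simp: tri_map_def lincomb_def A_def fun_eq_iff if_distrib[of "\<lambda>c. c * _"] cong: if_cong)
  moreover have "(\<Prod>i<d. \<bar>A i i\<bar>) = 1"
    by (simp add: A_def)
  ultimately show ?thesis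
    by (subst (2) nn_integral_tri_map[of d A _ "\<lambda>i. a * y i"]) (auto simp: A_def)
qed

lemma pair_sigma_finite_lebesgue_Rd: "pair_sigma_finite (lebesgue_Rd d) (lebesgue_Rd d)"
  by (simp add: pair_sigma_finite_def lborel_product.sigma_finite)

text \<open>A rotation is a composition of three shears, each of which is a translation of one variable
  with the other one fixed.\<close>

lemma nn_integral_lebesgue_Rd_rotation:
  assumes f [measurable]: "case_prod f \<in> borel_measurable (lebesgue_Rd d \<Otimes>\<^sub>M lebesgue_Rd d)"
    and cs: "c\<^sup>2 + s\<^sup>2 = 1" "c \<ge> 0"
  shows "(\<integral>\<^sup>+x. \<integral>\<^sup>+y. f (lincomb d c x (- s) y) (lincomb d c y s x) \<partial>lebesgue_Rd d \<partial>lebesgue_Rd d) =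
    (\<integral>\<^sup>+x. \<integral>\<^sup>+y. f x y \<partial>lebesgue_Rd d \<partial>lebesgue_Rd d)"
proof -
  interpret pair_sigma_finite "lebesgue_Rd d" "lebesgue_Rd d"
    by (rule pair_sigma_finite_lebesgue_Rd)
  have shy: "(\<integral>\<^sup>+x. \<integral>\<^sup>+y. g x (lincomb d 1 y a x) \<partial>lebesgue_Rd d \<partial>lebesgue_Rd d) =
    (\<integral>\<^sup>+x. \<integral>\<^sup>+y. g x y \<partial>lebesgue_Rd d \<partial>lebesgue_Rd d)"
    if [measurable]: "case_prod g \<in> borel_measurable (lebesgue_Rd d \<Otimes>\<^sub>M lebesgue_Rd d)" for g :: "point \<Rightarrow> point \<Rightarrow> ennreal" and a
    by (intro nn_integral_cong nn_integral_lebesgue_Rd_shift) measurable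
  have shx: "(\<integral>\<^sup>+x. \<integral>\<^sup>+y. g (lincomb d 1 x a y) y \<partial>lebesgue_Rd d \<partial>lebesgue_Rd d) =
    (\<integral>\<^sup>+x. \<integral>\<^sup>+y. g x y \<partial>lebesgue_Rd d \<partial>lebesgue_Rd d)"
    if [measurable]: "case_prod g \<in> borel_measurable (lebesgue_Rd d \<Otimes>\<^sub>M lebesgue_Rd d)" for g :: "point \<Rightarrow> point \<Rightarrow> ennreal" and a
  proof -
    have "(\<integral>\<^sup>+x. \<integral>\<^sup>+y. g (lincomb d 1 x a y) y \<partial>lebesgue_Rd d \<partial>lebesgue_Rd d) =
      (\<integral>\<^sup>+y. \<integral>\<^sup>+x. g (lincomb d 1 x a y) y \<partial>lebesgue_Rd d \<partial>lebesgue_Rd d)"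
      by (subst Fubini') auto
    also have "\<dots> = (\<integral>\<^sup>+y. \<integral>\<^sup>+x. g x y \<partial>lebesgue_Rd d \<partial>lebesgue_Rd d)"
      by (intro nn_integral_cong nn_integral_lebesgue_Rd_shift) measurable
    also have "\<dots> = (\<integral>\<^sup>+x. \<integral>\<^sup>+y. g x y \<partial>lebesgue_Rd d \<partial>lebesgue_Rd d)"
      by (subst Fubini') auto
    finally show ?thesis .
  qed
  \<comment> \<open>For a rotation by an angle \<theta> this is tan (\<theta> / 2), the coefficient
    of the outer two shears; \<open>c \<ge> 0\<close> keeps the denominator away from 0.\<close>
  define t where "t = s / (1 + c)"
  have t: "t * (1 + c) = s" using cs(2) by (simp add: t_def)
  have "t * s * (1 + c) = (1 - c) * (1 + c)"
    using cs(1) t by (simp add: power2_eq_square algebra_simps)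
  then have ts: "t * s = 1 - c" using cs(2) by simp
  define x1 where "x1 = (\<lambda>x y. lincomb d 1 x (- t) y)"
  define y1 where "y1 = (\<lambda>x y. lincomb d 1 y s x)"
  have y: "y1 (x1 x y) y = lincomb d c y s x" for x y
  proof
    fix i
    have "y i + s * (x i - t * y i) = (1 - t * s) * y i + s * x i"
      by (simp add: algebra_simps)
    then show "y1 (x1 x y) y i = lincomb d c y s x i"
      by (simp add: y1_def x1_def lincomb_def ts)
  qed
  have x: "x1 (x1 x y) (lincomb d c y s x) = lincomb d c x (- s) y" for x y
  proof
    fix i
    have "(x i - t * y i) - t * (c * y i + s * x i) = (1 - t * s) * x i - t * (1 + c) * y i"
      by (simp add: algebra_simps)
    also have "\<dots> = c * x i - s * y i"
      unfolding t ts by simp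
    finally show "x1 (x1 x y) (lincomb d c y s x) i = lincomb d c x (- s) y i"
      by (simp add: x1_def lincomb_def)
  qed
  have [measurable]: "case_prod x1 \<in> lebesgue_Rd d \<Otimes>\<^sub>M lebesgue_Rd d \<rightarrow>\<^sub>M lebesgue_Rd d"
    "case_prod y1 \<in> lebesgue_Rd d \<Otimes>\<^sub>M lebesgue_Rd d \<rightarrow>\<^sub>M lebesgue_Rd d"
    unfolding x1_def y1_def by measurable
  have shx1: "(\<integral>\<^sup>+x. \<integral>\<^sup>+y. g (x1 x y) y \<partial>lebesgue_Rd d \<partial>lebesgue_Rd d) =
    (\<integral>\<^sup>+x. \<integral>\<^sup>+y. g x y \<partial>lebesgue_Rd d \<partial>lebesgue_Rd d)"
    if "case_prod g \<in> borel_measurable (lebesgue_Rd d \<Otimes>\<^sub>M lebesgue_Rd d)" for g :: "point \<Rightarrow> point \<Rightarrow> ennreal"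
    using shx[OF that, of "- t"] by (simp only: x1_def)
  have shy1: "(\<integral>\<^sup>+x. \<integral>\<^sup>+y. g x (y1 x y) \<partial>lebesgue_Rd d \<partial>lebesgue_Rd d) =
    (\<integral>\<^sup>+x. \<integral>\<^sup>+y. g x y \<partial>lebesgue_Rd d \<partial>lebesgue_Rd d)"
    if "case_prod g \<in> borel_measurable (lebesgue_Rd d \<Otimes>\<^sub>M lebesgue_Rd d)" for g :: "point \<Rightarrow> point \<Rightarrow> ennreal"
    using shy[OF that, of s] by (simp only: y1_def)
  define g1 where "g1 = (\<lambda>x y. f (x1 x y) y)"
  define g2 where "g2 = (\<lambda>x y. g1 x (y1 x y))"
  have g1 [measurable]: "case_prod g1 \<in> borel_measurable (lebesgue_Rd d \<Otimes>\<^sub>M lebesgue_Rd d)"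
    unfolding g1_def by measurable
  have g2: "case_prod g2 \<in> borel_measurable (lebesgue_Rd d \<Otimes>\<^sub>M lebesgue_Rd d)"
    unfolding g2_def by measurable
  have "g2 (x1 x y) y = f (lincomb d c x (- s) y) (lincomb d c y s x)" for x y
    by (simp only: g2_def g1_def y x)
  then show ?thesis
    using shx1[OF f] shy1[OF g1] shx1[OF g2] by (simp only: g1_def[symmetric] g2_def) (simp only: g1_def)
qed

lemma sqnorm_rotation:
  assumes "c\<^sup>2 + s\<^sup>2 = 1"
  shows "sqnorm d (lincomb d c x (- s) y) + sqnorm d (lincomb d c y s x) = sqnorm d x + sqnorm d y"
proof -
  have "(c * a + - s * b)\<^sup>2 + (c * b + s * a)\<^sup>2 = (c\<^sup>2 + s\<^sup>2) * (a\<^sup>2 + b\<^sup>2)" for a b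
    by (simp add: power2_eq_square algebra_simps)
  then show ?thesis
    unfolding sqnorm_def sum.distrib[symmetric] by (intro sum.cong refl) (simp add: lincomb_def assms)
qed

text \<open>Exhibits the joint density as a function of \<open>sqnorm d x + sqnorm d y\<close>, the
  quantity that a rotation of the pair preserves.\<close>

lemma nn_integral_std_gauss_pair:
  assumes [measurable]: "case_prod f \<in> borel_measurable (lebesgue_Rd d \<Otimes>\<^sub>M lebesgue_Rd d)"
  shows "(\<integral>\<^sup>+x. \<integral>\<^sup>+y. f x y \<partial>std_gauss d \<partial>std_gauss d) =
    (\<integral>\<^sup>+x. \<integral>\<^sup>+y. ennreal (exp (- (sqnorm d x + sqnorm d y) / 2) / (2 * pi) ^ d) * f x y
      \<partial>lebesgue_Rd d \<partial>lebesgue_Rd d)"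
proof -
  have c: "sqrt (2 * pi) ^ d * sqrt (2 * pi) ^ d = (2 * pi) ^ d"
    by (subst power_mult_distrib[symmetric]) simp
  have e: "(exp (- a / 2) / sqrt (2 * pi) ^ d) * (exp (- b / 2) / sqrt (2 * pi) ^ d) =
     exp (- (a + b) / 2) / (2 * pi) ^ d" for a b
  proof -
    have "- (a + b) / 2 = - a / 2 + - b / 2" by (simp add: field_simps)
    then show ?thesis
      by (simp only: times_divide_times_eq c exp_add)
  qed
  have E: "ennreal (exp (- a / 2) / sqrt (2 * pi) ^ d) * (ennreal (exp (- b / 2) / sqrt (2 * pi) ^ d) * F) =
     ennreal (exp (- (a + b) / 2) / (2 * pi) ^ d) * F" for a b F
    unfolding mult.assoc[symmetric] e[symmetric] by (subst ennreal_mult) auto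
  interpret pair_sigma_finite "lebesgue_Rd d" "lebesgue_Rd d"
    by (rule pair_sigma_finite_lebesgue_Rd)
  define \<phi> where "\<phi> = (\<lambda>x. ennreal (exp (- sqnorm d x / 2) / sqrt (2 * pi) ^ d))"
  have \<phi> [measurable]: "\<phi> \<in> borel_measurable (lebesgue_Rd d)"
    unfolding \<phi>_def by measurable
  have single: "(\<integral>\<^sup>+y. g y \<partial>std_gauss d) = (\<integral>\<^sup>+y. \<phi> y * g y \<partial>lebesgue_Rd d)"
    if "g \<in> borel_measurable (lebesgue_Rd d)" for g
    using nn_integral_std_gauss[OF that] by (simp only: \<phi>_def prod_std_normal_density)
  have sec: "f x \<in> borel_measurable (lebesgue_Rd d)" if "x \<in> Rd d" for x
    using that by (intro measurable_compose[OF _ assms, of "\<lambda>y. (x, y)", simplified]) (simp add: space_PiM)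
  have *: "(\<lambda>x. \<integral>\<^sup>+y. \<phi> y * f x y \<partial>lebesgue_Rd d) \<in> borel_measurable (lebesgue_Rd d)"
    by (intro M1.borel_measurable_nn_integral) measurable
  have "(\<integral>\<^sup>+x. \<integral>\<^sup>+y. f x y \<partial>std_gauss d \<partial>std_gauss d) =
    (\<integral>\<^sup>+x. \<integral>\<^sup>+y. \<phi> y * f x y \<partial>lebesgue_Rd d \<partial>std_gauss d)"
    using sec single by (intro nn_integral_cong) simp
  also have "\<dots> = (\<integral>\<^sup>+x. \<phi> x * (\<integral>\<^sup>+y. \<phi> y * f x y \<partial>lebesgue_Rd d) \<partial>lebesgue_Rd d)"
    by (rule single[OF *])
  also have "\<dots> = (\<integral>\<^sup>+x. \<integral>\<^sup>+y. \<phi> x * (\<phi> y * f x y) \<partial>lebesgue_Rd d \<partial>lebesgue_Rd d)"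
    by (intro nn_integral_cong nn_integral_cmult[symmetric] borel_measurable_times_ennreal \<phi> sec)
      (simp add: space_PiM)
  also have "\<dots> = (\<integral>\<^sup>+x. \<integral>\<^sup>+y. ennreal (exp (- (sqnorm d x + sqnorm d y) / 2) / (2 * pi) ^ d) * f x y
      \<partial>lebesgue_Rd d \<partial>lebesgue_Rd d)"
    by (simp only: E \<phi>_def)
  finally show ?thesis .
qed

lemma nn_integral_std_gauss_rotation:
  assumes [measurable]: "case_prod f \<in> borel_measurable (lebesgue_Rd d \<Otimes>\<^sub>M lebesgue_Rd d)"
    and cs: "c\<^sup>2 + s\<^sup>2 = 1" "c \<ge> 0"
  shows "(\<integral>\<^sup>+x. \<integral>\<^sup>+y. f (lincomb d c x (- s) y) (lincomb d c y s x) \<partial>std_gauss d \<partial>std_gauss d) =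
    (\<integral>\<^sup>+x. \<integral>\<^sup>+y. f x y \<partial>std_gauss d \<partial>std_gauss d)"
proof -
  define g where "g = (\<lambda>x y. ennreal (exp (- (sqnorm d x + sqnorm d y) / 2) / (2 * pi) ^ d) * f x y)"
  have [measurable]: "case_prod g \<in> borel_measurable (lebesgue_Rd d \<Otimes>\<^sub>M lebesgue_Rd d)"
    unfolding g_def by measurable
  have g: "ennreal (exp (- (sqnorm d x + sqnorm d y) / 2) / (2 * pi) ^ d) *
      f (lincomb d c x (- s) y) (lincomb d c y s x) =
    g (lincomb d c x (- s) y) (lincomb d c y s x)" for x y
    by (simp only: g_def sqnorm_rotation[OF cs(1)])
  have "(\<integral>\<^sup>+x. \<integral>\<^sup>+y. f (lincomb d c x (- s) y) (lincomb d c y s x) \<partial>std_gauss d \<partial>std_gauss d) =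
    (\<integral>\<^sup>+x. \<integral>\<^sup>+y. g (lincomb d c x (- s) y) (lincomb d c y s x) \<partial>lebesgue_Rd d \<partial>lebesgue_Rd d)"
    unfolding g[symmetric] by (rule nn_integral_std_gauss_pair) measurable
  also have "\<dots> = (\<integral>\<^sup>+x. \<integral>\<^sup>+y. g x y \<partial>lebesgue_Rd d \<partial>lebesgue_Rd d)"
    by (intro nn_integral_lebesgue_Rd_rotation cs) measurable
  also have "\<dots> = (\<integral>\<^sup>+x. \<integral>\<^sup>+y. f x y \<partial>std_gauss d \<partial>std_gauss d)"
    unfolding g_def by (rule nn_integral_std_gauss_pair[symmetric]) measurable
  finally show ?thesis .
qed

definition reflect :: "nat \<Rightarrow> point \<Rightarrow> point" where
  "reflect d z = (\<lambda>i\<in>{..<d}. - z i)"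

lemma reflect_measurable [measurable]: "reflect d \<in> measurable (lebesgue_Rd d) (lebesgue_Rd d)"
proof -
  have "reflect d = (\<lambda>z. lincomb d (- 1) z 0 z)"
    by (auto simp: reflect_def lincomb_def fun_eq_iff)
  then show ?thesis by simp
qed

lemma sqnorm_reflect [simp]: "sqnorm d (reflect d z) = sqnorm d z"
  by (simp add: sqnorm_def reflect_def)

lemma nn_integral_std_gauss_reflect:
  assumes [measurable]: "f \<in> borel_measurable (lebesgue_Rd d)"
  shows "(\<integral>\<^sup>+z. f (reflect d z) \<partial>std_gauss d) = (\<integral>\<^sup>+z. f z \<partial>std_gauss d)"
proof -
  define A :: matrix where "A = (\<lambda>i j. if i = j then - 1 else 0)"
  have T: "tri_map d (\<lambda>i. 0) A z = reflect d z" for z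
    by (auto simp: tri_map_def reflect_def A_def fun_eq_iff if_distrib[of "\<lambda>c. c * _"] cong: if_cong)
  moreover have "(\<Prod>i<d. \<bar>A i i\<bar>) = 1"
    by (simp add: A_def)
  ultimately have "(\<integral>\<^sup>+z. g (reflect d z) \<partial>lebesgue_Rd d) = (\<integral>\<^sup>+z. g z \<partial>lebesgue_Rd d)"
    if "g \<in> borel_measurable (lebesgue_Rd d)" for g
    using that by (subst (2) nn_integral_tri_map[of d A _ "\<lambda>i. 0"]) (auto simp: A_def)
  from this[of "\<lambda>z. ennreal (exp (- sqnorm d z / 2) / sqrt (2 * pi) ^ d) * f z"]
  show ?thesis
    by (subst (1 2) nn_integral_std_gauss) (auto simp: prod_std_normal_density)
qed

lemma distr_std_gauss_reflect: "distr (std_gauss d) (lebesgue_Rd d) (reflect d) = std_gauss d"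
proof (rule measure_eqI)
  fix X assume X: "X \<in> sets (distr (std_gauss d) (lebesgue_Rd d) (reflect d))"
  then have [measurable]: "X \<in> sets (lebesgue_Rd d)" by simp
  have "emeasure (distr (std_gauss d) (lebesgue_Rd d) (reflect d)) X =
    (\<integral>\<^sup>+z. indicator X z \<partial>distr (std_gauss d) (lebesgue_Rd d) (reflect d))"
    using X by simp
  also have "\<dots> = (\<integral>\<^sup>+z. indicator X (reflect d z) \<partial>std_gauss d)"
    by (subst nn_integral_distr) auto
  also have "\<dots> = emeasure (std_gauss d) X"
    by (subst nn_integral_std_gauss_reflect) auto
  finally show "emeasure (distr (std_gauss d) (lebesgue_Rd d) (reflect d)) X = emeasure (std_gauss d) X" .
qed simp

text \<open>The reflection preserves the measure and turns the integral into its negative. This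
  covers every measurable odd function, a non-integrable one having Bochner integral 0.\<close>

lemma integral_std_gauss_odd:
  fixes f :: "point \<Rightarrow> real"
  assumes [measurable]: "f \<in> borel_measurable (lebesgue_Rd d)"
    and odd: "\<And>z. z \<in> Rd d \<Longrightarrow> f (reflect d z) = - f z"
  shows "(\<integral>z. f z \<partial>std_gauss d) = 0"
proof -
  have "(\<integral>z. f z \<partial>std_gauss d) = (\<integral>z. f z \<partial>distr (std_gauss d) (lebesgue_Rd d) (reflect d))"
    by (simp add: distr_std_gauss_reflect)
  also have "\<dots> = (\<integral>z. f (reflect d z) \<partial>std_gauss d)"
    by (subst integral_distr) auto
  also have "\<dots> = (\<integral>z. - f z \<partial>std_gauss d)"
    by (intro Bochner_Integration.integral_cong) (auto simp: odd)
  finally show ?thesis by simp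
qed


section \<open>Cubic forms of Gaussian vectors\<close>

definition trilin :: "nat \<Rightarrow> (nat \<Rightarrow> nat \<Rightarrow> nat \<Rightarrow> real) \<Rightarrow> point \<Rightarrow> point \<Rightarrow> point \<Rightarrow> real" where
  "trilin d T x y z = (\<Sum>i<d. \<Sum>j<d. \<Sum>k<d. T i j k * x i * y j * z k)"

abbreviation cubic :: "nat \<Rightarrow> (nat \<Rightarrow> nat \<Rightarrow> nat \<Rightarrow> real) \<Rightarrow> point \<Rightarrow> real" where
  "cubic d T z \<equiv> trilin d T z z z"

text \<open>The derivative of the cubic form at \<open>z\<close> in direction \<open>w\<close>. The
  three slots are listed separately since the coefficients \<open>T\<close> carry no
  symmetry.\<close>

definition dcubic :: "nat \<Rightarrow> (nat \<Rightarrow> nat \<Rightarrow> nat \<Rightarrow> real) \<Rightarrow> point \<Rightarrow> point \<Rightarrow> real" where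
  "dcubic d T z w = trilin d T w z z + trilin d T z w z + trilin d T z z w"

definition cubic_grad :: "nat \<Rightarrow> (nat \<Rightarrow> nat \<Rightarrow> nat \<Rightarrow> real) \<Rightarrow> point \<Rightarrow> point" where
  "cubic_grad d T z l = (\<Sum>j<d. \<Sum>k<d. (T l j k + T j l k + T j k l) * z j * z k)"

lemma borel_measurable_component_Rd:
  "f \<in> measurable M (lebesgue_Rd d) \<Longrightarrow> i < d \<Longrightarrow> (\<lambda>w. f w i) \<in> borel_measurable M"
  using measurable_compose[OF _ measurable_component_singleton, of f M "{..<d}" "\<lambda>_. lborel" i] by simp

lemma trilin_measurable [measurable]:
  assumes "f \<in> measurable M (lebesgue_Rd d)" "g \<in> measurable M (lebesgue_Rd d)"
    "h \<in> measurable M (lebesgue_Rd d)"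
  shows "(\<lambda>w. trilin d T (f w) (g w) (h w)) \<in> borel_measurable M"
  unfolding trilin_def
  by (intro borel_measurable_sum borel_measurable_times borel_measurable_const
      borel_measurable_component_Rd[OF assms(1)] borel_measurable_component_Rd[OF assms(2)]
      borel_measurable_component_Rd[OF assms(3)]) auto

lemma dcubic_measurable [measurable]:
  assumes [measurable]: "f \<in> measurable M (lebesgue_Rd d)" "g \<in> measurable M (lebesgue_Rd d)"
  shows "(\<lambda>w. dcubic d T (f w) (g w)) \<in> borel_measurable M"
  unfolding dcubic_def by measurable

lemma trilin_cong:
  assumes "\<And>i. i < d \<Longrightarrow> x i = x' i" "\<And>i. i < d \<Longrightarrow> y i = y' i" "\<And>i. i < d \<Longrightarrow> z i = z' i"
  shows "trilin d T x y z = trilin d T x' y' z'"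
  unfolding trilin_def by (intro sum.cong refl) (simp add: assms)

lemma trilin_lincomb:
  "trilin d T (lincomb d a x b y) u v = a * trilin d T x u v + b * trilin d T y u v"
  "trilin d T u (lincomb d a x b y) v = a * trilin d T u x v + b * trilin d T u y v"
  "trilin d T u v (lincomb d a x b y) = a * trilin d T u v x + b * trilin d T u v y"
  unfolding trilin_def sum_distrib_left sum.distrib[symmetric]
  by (intro sum.cong refl, simp add: lincomb_def algebra_simps)+

lemma cubic_lincomb:
  "cubic d T (lincomb d a x b y) = a ^ 3 * cubic d T x + a\<^sup>2 * b * dcubic d T x y +
    a * b\<^sup>2 * dcubic d T y x + b ^ 3 * cubic d T y"
  by (simp add: trilin_lincomb dcubic_def power2_eq_square power3_eq_cube algebra_simps)

lemma dcubic_lincomb: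
  "dcubic d T (lincomb d a x b y) (lincomb d a' x b' y) =
    3 * a\<^sup>2 * a' * cubic d T x + (a\<^sup>2 * b' + 2 * a * b * a') * dcubic d T x y +
    (b\<^sup>2 * a' + 2 * a * b * b') * dcubic d T y x + 3 * b\<^sup>2 * b' * cubic d T y"
  by (simp add: trilin_lincomb dcubic_def power2_eq_square algebra_simps)

lemma dcubic_eq_grad: "dcubic d T z w = (\<Sum>l<d. cubic_grad d T z l * w l)"
proof -
  have 1: "trilin d T w z z = (\<Sum>l<d. (\<Sum>j<d. \<Sum>k<d. T l j k * z j * z k) * w l)"
    by (simp add: trilin_def sum_distrib_left sum_distrib_right mult_ac)
  have "trilin d T z w z = (\<Sum>l<d. \<Sum>j<d. \<Sum>k<d. T j l k * z j * w l * z k)"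
    unfolding trilin_def by (rule sum.swap)
  then have 2: "trilin d T z w z = (\<Sum>l<d. (\<Sum>j<d. \<Sum>k<d. T j l k * z j * z k) * w l)"
    by (simp add: sum_distrib_left sum_distrib_right mult_ac)
  have "trilin d T z z w = (\<Sum>j<d. \<Sum>l<d. \<Sum>k<d. T j k l * z j * z k * w l)"
    unfolding trilin_def by (intro sum.cong refl sum.swap)
  also have "\<dots> = (\<Sum>l<d. \<Sum>j<d. \<Sum>k<d. T j k l * z j * z k * w l)"
    by (rule sum.swap)
  finally have 3: "trilin d T z z w = (\<Sum>l<d. (\<Sum>j<d. \<Sum>k<d. T j k l * z j * z k) * w l)"
    by (simp add: sum_distrib_left sum_distrib_right mult_ac)
  show ?thesis
    unfolding dcubic_def 1 2 3 sum.distrib[symmetric]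
    by (intro sum.cong refl) (simp add: cubic_grad_def distrib_right sum.distrib)
qed

lemma dcubic_scale:
  "dcubic d T (lincomb d a z 0 z) (lincomb d b w 0 w) = a\<^sup>2 * b * dcubic d T z w"
  by (simp add: trilin_lincomb dcubic_def power2_eq_square algebra_simps)

lemma sqnorm_lincomb:
  "sqnorm d (lincomb d a x b y) = a\<^sup>2 * sqnorm d x + 2 * a * b * (\<Sum>i<d. x i * y i) + b\<^sup>2 * sqnorm d y"
  unfolding sqnorm_def sum_distrib_left sum.distrib[symmetric]
  by (intro sum.cong refl) (simp add: lincomb_def power2_eq_square algebra_simps)

lemma inner_sq_le_sqnorm: "(\<Sum>i<d. x i * y i)\<^sup>2 \<le> sqnorm d x * sqnorm d y"
  unfolding sqnorm_def by (rule Cauchy_Schwarz_ineq_sum)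

text \<open>Replaces the power 3/2 by a polynomial, so that the bound can be summed over two points
  of which only the sums of \<open>N\<close> and of \<open>N\<^sup>2\<close> are controlled.
  Equality holds at N = 16/9, close to 1 + sqrt 3 / 2, the largest square norm met in the
  application.\<close>

lemma sqrt_cubed_le: "N \<ge> 0 \<Longrightarrow> (sqrt N) ^ 3 \<le> 3 / 8 * N\<^sup>2 + 2 / 3 * N"
proof -
  assume N: "N \<ge> 0"
  have "0 \<le> (3 * sqrt N - 4)\<^sup>2" by simp
  also have "(3 * sqrt N - 4)\<^sup>2 = 9 * (sqrt N)\<^sup>2 - 24 * sqrt N + 16"
    by (simp add: power2_eq_square algebra_simps)
  finally have "24 * sqrt N \<le> 9 * N + 16"
    using N by simp
  then have "N * sqrt N \<le> N * (3 / 8 * N + 2 / 3)"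
    using N by (intro mult_left_mono) auto
  then show ?thesis
    using N by (simp add: power3_eq_cube power2_eq_square algebra_simps)
qed

text \<open>Riesz' interpolation formula for the derivative at \<open>0\<close> of the trigonometric polynomial
  \<open>\<theta> \<mapsto> cubic (cos \<theta> z + sin \<theta> w)\<close>. It controls the gradient by the values of the form with a
  constant close to the optimal factor \<open>3\<close>, which plain polarisation does not achieve.\<close>

lemma dcubic_interpolation:
  "dcubic d T z w = 4 / 3 * (cubic d T (lincomb d (sqrt 3 / 2) z (1 / 2) w) +
      cubic d T (lincomb d (- (sqrt 3 / 2)) z (1 / 2) w)) - cubic d T w / 3"
proof -
  have "sqrt 3 ^ 2 = (3 :: real)" by simp
  then show ?thesis
    unfolding cubic_lincomb by (simp add: power_divide field_simps)
qed

text \<open>The two interpolation points are not unit vectors unless \<open>z\<close> and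
  \<open>w\<close> are orthogonal. Their square norms are \<open>1 + sqrt 3 / 2 * c\<close> and
  \<open>1 - sqrt 3 / 2 * c\<close>, with sum 2 and sum of squares at most 7/2. With
  \<open>sqrt_cubed_le\<close> the interpolation formula then costs 4/3 * 127/48 + 1/3 = 139/36,
  which is below 3.8612.\<close>

lemma dcubic_unit_bound:
  assumes bd: "\<And>z. \<bar>cubic d T z\<bar> \<le> \<tau> * (sqrt (sqnorm d z)) ^ 3" and \<tau>: "\<tau> \<ge> 0"
    and z: "sqnorm d z = 1" and w: "sqnorm d w = 1"
  shows "\<bar>dcubic d T z w\<bar> \<le> 3.8612 * \<tau>"
proof -
  define y1 where "y1 = lincomb d (sqrt 3 / 2) z (1 / 2) w"
  define y2 where "y2 = lincomb d (- (sqrt 3 / 2)) z (1 / 2) w"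
  define c where "c = (\<Sum>i<d. z i * w i)"
  have c: "c\<^sup>2 \<le> 1"
    using inner_sq_le_sqnorm[of z w d] by (simp add: c_def z w)
  have 1: "sqnorm d y1 = 1 + sqrt 3 / 2 * c" "sqnorm d y2 = 1 - sqrt 3 / 2 * c"
    unfolding y1_def y2_def sqnorm_lincomb z w c_def[symmetric] by (simp_all add: power_divide)
  have "(sqnorm d y1)\<^sup>2 + (sqnorm d y2)\<^sup>2 = 2 + 3 / 2 * c\<^sup>2"
    unfolding 1 by (simp add: power2_eq_square algebra_simps)
  then have 2: "(sqnorm d y1)\<^sup>2 + (sqnorm d y2)\<^sup>2 \<le> 7 / 2" "sqnorm d y1 + sqnorm d y2 = 2"
    using c 1 by auto
  have 3: "\<bar>cubic d T y\<bar> \<le> \<tau> * (3 / 8 * (sqnorm d y)\<^sup>2 + 2 / 3 * sqnorm d y)" for y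
    using bd[of y] mult_left_mono[OF sqrt_cubed_le[of "sqnorm d y"] \<tau>] by simp
  have "\<bar>cubic d T y1\<bar> + \<bar>cubic d T y2\<bar> \<le>
    \<tau> * (3 / 8 * (sqnorm d y1)\<^sup>2 + 2 / 3 * sqnorm d y1) + \<tau> * (3 / 8 * (sqnorm d y2)\<^sup>2 + 2 / 3 * sqnorm d y2)"
    by (rule add_mono 3)+
  also have "\<dots> = \<tau> * (3 / 8 * ((sqnorm d y1)\<^sup>2 + (sqnorm d y2)\<^sup>2) + 2 / 3 * (sqnorm d y1 + sqnorm d y2))"
    by (simp add: field_simps)
  also have "\<dots> \<le> \<tau> * (3 / 8 * (7 / 2) + 2 / 3 * 2)"
    using 2 \<tau> by (intro mult_left_mono add_mono) auto
  finally have "\<bar>cubic d T y1\<bar> + \<bar>cubic d T y2\<bar> \<le> \<tau> * (127 / 48)" by simp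
  moreover have "\<bar>cubic d T w\<bar> \<le> \<tau>" using bd[of w] w by simp
  ultimately have "4 / 3 * (\<bar>cubic d T y1\<bar> + \<bar>cubic d T y2\<bar>) + \<bar>cubic d T w\<bar> / 3 \<le> \<tau> * (139 / 36)"
  proof -
    have "4 / 3 * a + b / 3 \<le> \<tau> * (139 / 36)" if "a \<le> \<tau> * (127 / 48)" "b \<le> \<tau>" for a b
      using that by linarith
    then show ?thesis
      using \<open>\<bar>cubic d T y1\<bar> + \<bar>cubic d T y2\<bar> \<le> \<tau> * (127 / 48)\<close> \<open>\<bar>cubic d T w\<bar> \<le> \<tau>\<close> by blast
  qed
  also have "\<dots> \<le> 3.8612 * \<tau>" using \<tau> by simp
  finally have "4 / 3 * (\<bar>cubic d T y1\<bar> + \<bar>cubic d T y2\<bar>) + \<bar>cubic d T w\<bar> / 3 \<le> 3.8612 * \<tau>" .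
  moreover have "\<bar>4 / 3 * (a + b) - c / 3\<bar> \<le> 4 / 3 * (\<bar>a\<bar> + \<bar>b\<bar>) + \<bar>c\<bar> / 3" for a b c :: real
    by (auto simp: abs_if field_simps)
  ultimately show ?thesis
    unfolding dcubic_interpolation y1_def[symmetric] y2_def[symmetric] by (rule order_trans[rotated])
qed

text \<open>The unit bound is applied to the normalised point and the normalised gradient;
  homogeneity of degree 2 in the point restores the scale. The factor 14.91 is 3.8612 squared,
  rounded up.\<close>

lemma cubic_grad_bound:
  assumes bd: "\<And>z. \<bar>cubic d T z\<bar> \<le> \<tau> * (sqrt (sqnorm d z)) ^ 3" and \<tau>: "\<tau> \<ge> 0"
  shows "sqnorm d (cubic_grad d T z) \<le> 14.91 * \<tau>\<^sup>2 * (sqnorm d z)\<^sup>2"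
proof (cases "sqnorm d z = 0 \<or> sqnorm d (cubic_grad d T z) = 0")
  case True
  moreover have "sqnorm d (cubic_grad d T z) = 0" if "sqnorm d z = 0"
  proof -
    have "z i = 0" if "i < d" for i
      using \<open>sqnorm d z = 0\<close> that by (simp add: sqnorm_def sum_nonneg_eq_0_iff)
    then show ?thesis by (simp add: sqnorm_def cubic_grad_def)
  qed
  ultimately show ?thesis by auto
next
  case False
  define N where "N = sqnorm d z"
  define g where "g = cubic_grad d T z"
  define G where "G = sqnorm d g"
  have pos: "N > 0" "G > 0"
    using False sqnorm_nonneg[of d z] sqnorm_nonneg[of d g] by (auto simp: N_def G_def g_def less_le)
  define u where "u = lincomb d (1 / sqrt N) z 0 z"
  define v where "v = lincomb d (1 / sqrt G) g 0 g"
  have "sqnorm d u = 1" "sqnorm d v = 1"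
    using pos by (simp_all add: u_def v_def sqnorm_lincomb power_divide N_def[symmetric] G_def[symmetric])
  then have 1: "\<bar>dcubic d T u v\<bar> \<le> 3.8612 * \<tau>"
    by (intro dcubic_unit_bound bd \<tau>)
  have "dcubic d T z g = G"
    by (simp add: dcubic_eq_grad G_def sqnorm_def g_def power2_eq_square)
  then have "dcubic d T u v = sqrt G / N"
    using pos unfolding u_def v_def dcubic_scale by (simp add: power_divide field_simps)
  with 1 pos have "sqrt G \<le> 3.8612 * \<tau> * N"
    by (simp add: field_simps)
  then have "(sqrt G)\<^sup>2 \<le> (3.8612 * \<tau> * N)\<^sup>2"
    using pos by (intro power_mono) auto
  then have "G \<le> 3.8612\<^sup>2 * (\<tau>\<^sup>2 * N\<^sup>2)"
    using pos by (simp only: power_mult_distrib mult.assoc real_sqrt_pow2 less_imp_le)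
  also have "\<dots> \<le> 14.91 * (\<tau>\<^sup>2 * N\<^sup>2)"
    by (intro mult_right_mono) (auto simp: power2_eq_square)
  finally show ?thesis by (simp add: G_def g_def N_def mult.assoc)
qed

section \<open>Jensen's inequality, rotation paths and the weighted exponential inequality\<close>

lemma (in prob_space) exp_integral_le:
  fixes f :: "'a \<Rightarrow> real"
  assumes f: "has_bochner_integral M f c"
  shows "ennreal (exp c) \<le> (\<integral>\<^sup>+x. ennreal (exp (f x)) \<partial>M)"
proof (cases "(\<integral>\<^sup>+x. ennreal (exp (f x)) \<partial>M) = \<infinity>")
  case False
  have int: "integrable M f" and I: "(\<integral>x. f x \<partial>M) = c"
    using f by (auto simp: has_bochner_integral_iff)
  then have [measurable]: "f \<in> borel_measurable M" by simp
  have e: "integrable M (\<lambda>x. exp (f x))"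
    using False by (intro integrableI_nonneg) (auto simp: less_top)
  \<comment> \<open>The tangent of \<open>exp\<close> at the mean \<open>c\<close> is integrated; it
    lies below \<open>exp\<close> everywhere and its integral is \<open>exp c\<close>.\<close>
  have "exp c = (\<integral>x. exp c * (1 + (f x - c)) \<partial>M)"
    using int I by (simp add: prob_space)
  also have "\<dots> \<le> (\<integral>x. exp (f x) \<partial>M)"
  proof (rule integral_mono)
    fix x
    have "exp c * (1 + (f x - c)) \<le> exp c * exp (f x - c)"
      by (intro mult_left_mono exp_ge_add_one_self) auto
    then show "exp c * (1 + (f x - c)) \<le> exp (f x)"
      by (simp add: exp_add[symmetric])
  qed (use int e in auto)
  finally show ?thesis
    using e by (subst nn_integral_eq_integral) (auto intro: ennreal_leI)
qed simp

text \<open>Machin's formula with the negative term dropped and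
  \<open>arctan (1 / 5) \<le> 1 / 5\<close> gives exactly 16/5.\<close>

lemma pi_le_32: "pi \<le> 3.2"
proof -
  have "pi = 16 * arctan (1 / 5) - 4 * arctan (1 / 239)"
    using machin by simp
  moreover have "arctan (1 / 5) \<le> 1 / 5" by (rule arctan_le_self) simp
  moreover have "arctan (1 / 239) \<ge> 0" by (simp add: zero_le_arctan_iff)
  ultimately show ?thesis by linarith
qed

text \<open>Scaling the exponent by the dimension makes the moment independent of \<open>d\<close>:
  Bernoulli's inequality gives \<open>(1 - 1 / (2 * real d)) ^ d \<ge> 1 / 2\<close>, so the moment
  is at most sqrt 2.\<close>

lemma nn_integral_std_gauss_exp_scaled:
  assumes "d \<ge> 1"
  shows "(\<integral>\<^sup>+z. ennreal (exp (sqnorm d z / (4 * real d))) \<partial>std_gauss d) \<le> ennreal (3 / 2)"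
proof -
  define t where "t = 1 - 1 / (2 * real d)"
  have t: "t \<ge> 1 / 2" "1 - 2 * (1 / (4 * real d)) = t"
    using assms by (auto simp: t_def field_simps)
  have "1 + real d * (- (1 / (2 * real d))) \<le> (1 + (- (1 / (2 * real d)))) ^ d"
    using assms by (intro Bernoulli_inequality) (auto simp: field_simps)
  then have td: "t ^ d \<ge> 1 / 2" using assms by (simp add: t_def)
  have "(\<integral>\<^sup>+z. ennreal (exp (1 / (4 * real d) * sqnorm d z)) \<partial>std_gauss d) = ennreal ((1 / sqrt t) ^ d)"
    by (rule nn_integral_std_gauss_exp_sqnorm[of "1 / (4 * real d)" d, unfolded t(2)])
      (use assms in \<open>simp add: field_simps\<close>)
  moreover have "(1 / sqrt t) ^ d \<le> 3 / 2"
  proof -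
    have "(1 / sqrt t) ^ d = 1 / sqrt (t ^ d)"
      by (simp add: power_divide real_sqrt_power)
    also have "\<dots> \<le> 1 / sqrt (1 / 2)"
      using td t by (intro divide_left_mono real_sqrt_le_mono mult_pos_pos real_sqrt_gt_zero) auto
    also have "\<dots> = sqrt 2"
      by (simp add: real_sqrt_divide)
    also have "\<dots> \<le> 3 / 2"
      by (rule real_le_lsqrt) (auto simp: power2_eq_square)
    finally show ?thesis .
  qed
  ultimately show ?thesis by (simp add: ennreal_leI)
qed

text \<open>The fundamental theorem of calculus along the quarter turn from \<open>y\<close> to
  \<open>x\<close>, with explicit antiderivatives of \<open>sin ^ 4\<close> and
  \<open>cos ^ 4\<close>, each of which has integral 3 \<pi> / 16. The parameter runs over the unit
  interval so that Jensen's inequality applies to a probability measure; the factor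
  \<open>pi / 2\<close> is the speed.\<close>

lemma has_bochner_integral_interpolation:
  fixes d T x y and \<alpha> \<beta> :: real
  defines "X \<equiv> \<lambda>\<theta>. lincomb d (cos \<theta>) y (sin \<theta>) x"
    and "X' \<equiv> \<lambda>\<theta>. lincomb d (- sin \<theta>) y (cos \<theta>) x"
  shows "has_bochner_integral lborel
    (\<lambda>u. pi / 2 * (dcubic d T (X (pi / 2 * u)) (X' (pi / 2 * u)) -
        (\<alpha> * sin (pi / 2 * u) ^ 4 + \<beta> * cos (pi / 2 * u) ^ 4)) * indicator {0..1} u)
    (cubic d T x - cubic d T y - 3 * pi / 16 * (\<alpha> + \<beta>))"
proof -
  define \<Phi> where "\<Phi> = (\<lambda>\<theta>. cubic d T (X \<theta>) -
    (\<alpha> * (3 / 8 * \<theta> - 3 / 8 * (sin \<theta> * cos \<theta>) - 1 / 4 * (sin \<theta> ^ 3 * cos \<theta>)) +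
     \<beta> * (3 / 8 * \<theta> + 3 / 8 * (sin \<theta> * cos \<theta>) + 1 / 4 * (cos \<theta> ^ 3 * sin \<theta>))))"
  define \<phi> where "\<phi> = (\<lambda>\<theta>. dcubic d T (X \<theta>) (X' \<theta>) - (\<alpha> * sin \<theta> ^ 4 + \<beta> * cos \<theta> ^ 4))"
  have D1: "((\<lambda>\<theta>. cubic d T (X \<theta>)) has_real_derivative dcubic d T (X \<theta>) (X' \<theta>)) (at \<theta>)" for \<theta>
    unfolding X_def X'_def cubic_lincomb dcubic_lincomb
    by (rule derivative_eq_intros refl)+
      (simp add: power2_eq_square power3_eq_cube algebra_simps)
  have c2: "cos \<theta> * cos \<theta> = 1 - sin \<theta> * sin \<theta>" "cos \<theta> * (cos \<theta> * a) = a - sin \<theta> * (sin \<theta> * a)" for \<theta> a :: real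
  proof -
    show *: "cos \<theta> * cos \<theta> = 1 - sin \<theta> * sin \<theta>"
      using sin_cos_squared_add[of \<theta>] by (simp add: power2_eq_square algebra_simps)
    show "cos \<theta> * (cos \<theta> * a) = a - sin \<theta> * (sin \<theta> * a)"
      unfolding mult.assoc[symmetric] * by (simp add: algebra_simps)
  qed
  have D2: "((\<lambda>\<theta>. 3 / 8 * \<theta> - 3 / 8 * (sin \<theta> * cos \<theta>) - 1 / 4 * (sin \<theta> ^ 3 * cos \<theta>))
      has_real_derivative sin \<theta> ^ 4) (at \<theta>)" for \<theta>
    by (auto intro!: derivative_eq_intros simp: power2_eq_square power3_eq_cube power4_eq_xxxx
        algebra_simps c2) (simp add: field_simps)
  have D3: "((\<lambda>\<theta>. 3 / 8 * \<theta> + 3 / 8 * (sin \<theta> * cos \<theta>) + 1 / 4 * (cos \<theta> ^ 3 * sin \<theta>))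
      has_real_derivative cos \<theta> ^ 4) (at \<theta>)" for \<theta>
    by (auto intro!: derivative_eq_intros simp: power2_eq_square power3_eq_cube power4_eq_xxxx
        algebra_simps c2) (simp add: field_simps)
  have D: "(\<Phi> has_real_derivative \<phi> \<theta>) (at \<theta>)" for \<theta>
    unfolding \<Phi>_def \<phi>_def
    by (intro DERIV_diff DERIV_add DERIV_cmult D1 D2 D3)
  have "((\<lambda>u. \<Phi> (pi / 2 * u)) has_real_derivative pi / 2 * \<phi> (pi / 2 * u)) (at u)" for u
  proof -
    have "((\<lambda>u. pi / 2 * u) has_real_derivative pi / 2) (at u)"
      by (auto intro!: derivative_eq_intros)
    from DERIV_chain2[OF D this] show ?thesis
      by (simp only: mult.commute)
  qed
  moreover have "isCont (\<lambda>u. pi / 2 * \<phi> (pi / 2 * u)) u" for u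
    unfolding \<phi>_def X_def X'_def dcubic_lincomb by (intro continuous_intros)
  ultimately have "has_bochner_integral lborel (\<lambda>u. pi / 2 * \<phi> (pi / 2 * u) * indicator {0..1} u)
    (\<Phi> (pi / 2 * 1) - \<Phi> (pi / 2 * 0))"
    by (intro has_bochner_integral_FTC_Icc_real) auto
  moreover have "\<Phi> (pi / 2 * 1) - \<Phi> (pi / 2 * 0) = cubic d T x - cubic d T y - 3 * pi / 16 * (\<alpha> + \<beta>)"
  proof -
    have "cubic d T (X (pi / 2)) = cubic d T x" "cubic d T (X 0) = cubic d T y"
      by (auto intro!: trilin_cong simp: X_def lincomb_def)
    then show ?thesis by (simp add: \<Phi>_def algebra_simps)
  qed
  ultimately show ?thesis
    by (simp add: \<phi>_def)
qed


lemma sqnorm_scale: "sqnorm d (\<lambda>i. c * z i) = c\<^sup>2 * sqnorm d z"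
  by (simp add: sqnorm_def power_mult_distrib sum_distrib_left)

lemma lincomb_commute: "lincomb d a x b y = lincomb d b y a x"
  by (auto simp: lincomb_def)

text \<open>Young's inequality with weights 1 + 3/40 = 43/40 and 1 + 40/3 = 43/3 is used twice, on
  the components and on the square of the resulting sum, hence the third powers. The weight of
  \<open>x\<close> must stay close to 1, being charged to the weighted moment; the large weight of
  \<open>y\<close> only enters a constant.\<close>

lemma sqnorm_lincomb_le:
  "(sqnorm d (lincomb d c y s x))\<^sup>2 \<le>
    (43 / 40) ^ 3 * (s ^ 4 * (sqnorm d x)\<^sup>2) + (43 / 3) ^ 3 * (c ^ 4 * (sqnorm d y)\<^sup>2)"
proof -
  have young: "(a + b)\<^sup>2 \<le> 43 / 40 * a\<^sup>2 + 43 / 3 * b\<^sup>2" for a b :: real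
  proof -
    have "0 \<le> 3 / 40 * (a - 40 / 3 * b)\<^sup>2" by simp
    then show ?thesis by (simp add: power2_eq_square field_simps)
  qed
  have "(c * y i + s * x i)\<^sup>2 \<le> 43 / 40 * (s * x i)\<^sup>2 + 43 / 3 * (c * y i)\<^sup>2" for i
    using young[of "s * x i" "c * y i"] by (simp add: add.commute)
  then have "sqnorm d (lincomb d c y s x) \<le> (\<Sum>i<d. 43 / 40 * (s * x i)\<^sup>2 + 43 / 3 * (c * y i)\<^sup>2)"
    unfolding sqnorm_def by (intro sum_mono) (simp add: lincomb_def)
  also have "\<dots> = 43 / 40 * (s\<^sup>2 * sqnorm d x) + 43 / 3 * (c\<^sup>2 * sqnorm d y)"
    by (simp add: sqnorm_def sum.distrib sum_distrib_left power_mult_distrib)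
  finally have "(sqnorm d (lincomb d c y s x))\<^sup>2 \<le> (43 / 40 * (s\<^sup>2 * sqnorm d x) + 43 / 3 * (c\<^sup>2 * sqnorm d y))\<^sup>2"
    by (intro power_mono) auto
  also have "\<dots> \<le> 43 / 40 * (43 / 40 * (s\<^sup>2 * sqnorm d x))\<^sup>2 + 43 / 3 * (43 / 3 * (c\<^sup>2 * sqnorm d y))\<^sup>2"
    by (rule young)
  also have "\<dots> = (43 / 40) ^ 3 * (s ^ 4 * (sqnorm d x)\<^sup>2) + (43 / 3) ^ 3 * (c ^ 4 * (sqnorm d y)\<^sup>2)"
    by (simp add: power_mult_distrib power2_eq_square power3_eq_cube power4_eq_xxxx mult_ac)
  finally show ?thesis .
qed

text \<open>Maurey and Pisier's argument: the rotation \<open>X\<^sub>\<theta> = cos \<theta> y + sin \<theta> x\<close> joins \<open>y\<close> to \<open>x\<close>, its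
  velocity is independent of \<open>X\<^sub>\<theta>\<close>, and Jensen's inequality is applied in \<open>\<theta>\<close>. The weight
  \<open>\<bar>X\<^sub>\<theta>\<bar>\<^sup>4\<close> dominating the squared gradient is subtracted inside the exponential, since the form
  is not globally Lipschitz.\<close>

lemma maurey_pisier_cubic:
  assumes gr: "\<And>z. sqnorm d (cubic_grad d T z) \<le> \<kappa> * (sqnorm d z)\<^sup>2" and \<kappa>: "\<kappa> \<ge> 0"
  shows "(\<integral>\<^sup>+x. \<integral>\<^sup>+y. ennreal (exp (cubic d T x - cubic d T y - 3 * pi\<^sup>2 / 64 * \<kappa> *
      ((43 / 40) ^ 3 * (sqnorm d x)\<^sup>2 + (43 / 3) ^ 3 * (sqnorm d y)\<^sup>2))) \<partial>std_gauss d \<partial>std_gauss d) \<le> 1"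
    (is "(\<integral>\<^sup>+x. \<integral>\<^sup>+y. ?L x y \<partial>_ \<partial>_) \<le> 1")
proof -
  interpret G: prob_space "std_gauss d" by (rule prob_space_std_gauss)
  interpret GG: pair_sigma_finite "std_gauss d" "std_gauss d" by unfold_locales
  define U where "U = density lborel (\<lambda>u. ennreal (indicator {0..1::real} u))"
  have sU [simp, measurable_cong]: "sets U = sets borel" by (simp add: U_def)
  interpret U: prob_space U
  proof
    show "emeasure U (space U) = 1"
      by (simp add: U_def emeasure_density ennreal_indicator)
  qed
  interpret UG: pair_sigma_finite "std_gauss d \<Otimes>\<^sub>M std_gauss d" U
    by unfold_locales
  \<comment> \<open>Here \<open>a\<close> is the velocity and \<open>b\<close> the position on the
    rotation path. The weight \<open>pi\<^sup>2 / 8\<close> is half the square of the speed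
    \<open>pi / 2\<close>, which is what Gaussian averaging over \<open>a\<close> produces.\<close>
  define F where "F = (\<lambda>a b. ennreal (exp (pi / 2 * dcubic d T b a - pi\<^sup>2 / 8 * \<kappa> * (sqnorm d b)\<^sup>2)))"
  define X where "X = (\<lambda>x y u. lincomb d (cos (pi / 2 * u)) y (sin (pi / 2 * u)) x)"
  define X' where "X' = (\<lambda>x y u. lincomb d (- sin (pi / 2 * u)) y (cos (pi / 2 * u)) x)"
  have F [measurable]: "case_prod F \<in> borel_measurable (lebesgue_Rd d \<Otimes>\<^sub>M lebesgue_Rd d)"
    unfolding F_def by measurable
  have [measurable]: "(\<lambda>(p, u). X (fst p) (snd p) u) \<in> (lebesgue_Rd d \<Otimes>\<^sub>M lebesgue_Rd d) \<Otimes>\<^sub>M borel \<rightarrow>\<^sub>M lebesgue_Rd d"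
    "(\<lambda>(p, u). X' (fst p) (snd p) u) \<in> (lebesgue_Rd d \<Otimes>\<^sub>M lebesgue_Rd d) \<Otimes>\<^sub>M borel \<rightarrow>\<^sub>M lebesgue_Rd d"
    unfolding X_def X'_def by measurable
  define H where "H = (\<lambda>p u. F (X' (fst p) (snd p) u) (X (fst p) (snd p) u))"
  have H: "case_prod H \<in> borel_measurable ((std_gauss d \<Otimes>\<^sub>M std_gauss d) \<Otimes>\<^sub>M U)"
    unfolding H_def by measurable
  have "case_prod H \<in> borel_measurable ((lebesgue_Rd d \<Otimes>\<^sub>M lebesgue_Rd d) \<Otimes>\<^sub>M borel)"
    unfolding H_def by measurable
  then have Hu: "(\<lambda>p. H p u) \<in> borel_measurable (std_gauss d \<Otimes>\<^sub>M std_gauss d)" for u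
    by measurable
  have L: "?L x y \<le> (\<integral>\<^sup>+u. H (x, y) u \<partial>U)" for x y
  proof -
    define \<alpha> where "\<alpha> = pi / 4 * \<kappa> * ((43 / 40) ^ 3 * (sqnorm d x)\<^sup>2)"
    define \<beta> where "\<beta> = pi / 4 * \<kappa> * ((43 / 3) ^ 3 * (sqnorm d y)\<^sup>2)"
    define \<psi> where "\<psi> = (\<lambda>u. pi / 2 * (dcubic d T (X x y u) (X' x y u) -
        (\<alpha> * sin (pi / 2 * u) ^ 4 + \<beta> * cos (pi / 2 * u) ^ 4)))"
    have "has_bochner_integral lborel (\<lambda>u. \<psi> u * indicator {0..1} u)
      (cubic d T x - cubic d T y - 3 * pi / 16 * (\<alpha> + \<beta>))"
      unfolding \<psi>_def X_def X'_def by (rule has_bochner_integral_interpolation)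
    moreover have "\<psi> \<in> borel_measurable borel"
      unfolding \<psi>_def X_def X'_def dcubic_lincomb by measurable
    ultimately have "has_bochner_integral U \<psi> (cubic d T x - cubic d T y - 3 * pi / 16 * (\<alpha> + \<beta>))"
      unfolding U_def by (intro has_bochner_integral_density) (auto simp: mult.commute)
    from U.exp_integral_le[OF this]
    have "ennreal (exp (cubic d T x - cubic d T y - 3 * pi / 16 * (\<alpha> + \<beta>))) \<le> (\<integral>\<^sup>+u. ennreal (exp (\<psi> u)) \<partial>U)" .
    \<comment> \<open>The factor 3 \<pi>^2 / 64 is \<pi>^2 / 8 times 3/8, the mean of sin^4 over a
      quarter turn.\<close>
    also have "3 * pi / 16 * (\<alpha> + \<beta>) = 3 * pi\<^sup>2 / 64 * \<kappa> *
      ((43 / 40) ^ 3 * (sqnorm d x)\<^sup>2 + (43 / 3) ^ 3 * (sqnorm d y)\<^sup>2)"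
      by (simp add: \<alpha>_def \<beta>_def power2_eq_square field_simps)
    also have "(\<integral>\<^sup>+u. ennreal (exp (\<psi> u)) \<partial>U) \<le> (\<integral>\<^sup>+u. H (x, y) u \<partial>U)"
    proof (intro nn_integral_mono)
      fix u
      define S where "S = (sqnorm d (X x y u))\<^sup>2"
      have "pi\<^sup>2 / 8 * \<kappa> * S \<le> pi\<^sup>2 / 8 * \<kappa> *
        ((43 / 40) ^ 3 * (sin (pi / 2 * u) ^ 4 * (sqnorm d x)\<^sup>2) + (43 / 3) ^ 3 * (cos (pi / 2 * u) ^ 4 * (sqnorm d y)\<^sup>2))"
        unfolding S_def X_def using \<kappa> by (intro mult_left_mono sqnorm_lincomb_le) auto
      also have "\<dots> = pi / 2 * (\<alpha> * sin (pi / 2 * u) ^ 4 + \<beta> * cos (pi / 2 * u) ^ 4)"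
        by (simp add: \<alpha>_def \<beta>_def power2_eq_square field_simps)
      finally show "ennreal (exp (\<psi> u)) \<le> H (x, y) u"
        unfolding H_def F_def by (intro ennreal_leI) (simp add: \<psi>_def S_def right_diff_distrib)
    qed
    finally show ?thesis .
  qed
  \<comment> \<open>For a fixed parameter the pair of velocity and position is a rotation of
    \<open>(x, y)\<close>, so it has the law of two independent standard Gaussian vectors.\<close>
  have rot: "(\<integral>\<^sup>+p. H p u \<partial>(std_gauss d \<Otimes>\<^sub>M std_gauss d)) = (\<integral>\<^sup>+x. \<integral>\<^sup>+y. F x y \<partial>std_gauss d \<partial>std_gauss d)"
    if u: "u \<in> {0..1}" for u
  proof -
    have "0 \<le> cos (pi / 2 * u)"
      using u by (intro cos_ge_zero) (auto simp: mult_left_le intro: order_trans[of _ 0])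
    moreover have X'_eq: "X' x y u = lincomb d (cos (pi / 2 * u)) x (- sin (pi / 2 * u)) y" for x y
      unfolding X'_def by (rule lincomb_commute)
    moreover have "(cos (pi / 2 * u))\<^sup>2 + (sin (pi / 2 * u))\<^sup>2 = 1" by simp
    ultimately have "(\<integral>\<^sup>+x. \<integral>\<^sup>+y. F (X' x y u) (X x y u) \<partial>std_gauss d \<partial>std_gauss d) =
      (\<integral>\<^sup>+x. \<integral>\<^sup>+y. F x y \<partial>std_gauss d \<partial>std_gauss d)"
      unfolding X'_eq X_def by (intro nn_integral_std_gauss_rotation F)
    then show ?thesis
      using G.nn_integral_fst[OF Hu, of u] by (simp add: H_def)
  qed
  have "(\<integral>\<^sup>+x. \<integral>\<^sup>+y. F x y \<partial>std_gauss d \<partial>std_gauss d) = (\<integral>\<^sup>+b. \<integral>\<^sup>+a. F a b \<partial>std_gauss d \<partial>std_gauss d)"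
    by (intro GG.Fubini'[symmetric]) measurable
  also have "\<dots> \<le> (\<integral>\<^sup>+b. 1 \<partial>std_gauss d)"
  proof (intro nn_integral_mono)
    fix b
    \<comment> \<open>With the position \<open>b\<close> fixed, the exponent is linear in the
      velocity \<open>a\<close>; the resulting Gaussian factor is absorbed by the weight because of
      the gradient bound.\<close>
    have "F a b = ennreal (exp (- pi\<^sup>2 / 8 * \<kappa> * (sqnorm d b)\<^sup>2)) *
      ennreal (exp (\<Sum>l<d. (pi / 2 * cubic_grad d T b l) * a l))" for a
      by (simp add: F_def dcubic_eq_grad sum_distrib_left ennreal_mult[symmetric] exp_add[symmetric] mult_ac)
    moreover have lin: "(\<lambda>a. ennreal (exp (\<Sum>l<d. (pi / 2 * cubic_grad d T b l) * a l))) \<in> borel_measurable (std_gauss d)"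
      by measurable
    ultimately have "(\<integral>\<^sup>+a. F a b \<partial>std_gauss d) = ennreal (exp (- pi\<^sup>2 / 8 * \<kappa> * (sqnorm d b)\<^sup>2)) *
      ennreal (exp (sqnorm d (\<lambda>l. pi / 2 * cubic_grad d T b l) / 2))"
      by (simp only: nn_integral_cmult[OF lin] nn_integral_std_gauss_exp_linear)
    also have "sqnorm d (\<lambda>l. pi / 2 * cubic_grad d T b l) / 2 = pi\<^sup>2 / 8 * sqnorm d (cubic_grad d T b)"
      by (simp only: sqnorm_scale) (simp add: power_divide)
    also have "ennreal (exp (- pi\<^sup>2 / 8 * \<kappa> * (sqnorm d b)\<^sup>2)) * ennreal (exp (pi\<^sup>2 / 8 * sqnorm d (cubic_grad d T b))) =
      ennreal (exp (pi\<^sup>2 / 8 * (sqnorm d (cubic_grad d T b) - \<kappa> * (sqnorm d b)\<^sup>2)))"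
      by (simp add: ennreal_mult[symmetric] exp_add[symmetric] right_diff_distrib)
    also have "\<dots> \<le> 1"
      using gr[of b] by (simp add: mult_nonneg_nonpos)
    finally show "(\<integral>\<^sup>+a. F a b \<partial>std_gauss d) \<le> 1" .
  qed
  also have "\<dots> = 1" by (simp add: G.emeasure_space_1[simplified])
  finally have F1: "(\<integral>\<^sup>+x. \<integral>\<^sup>+y. F x y \<partial>std_gauss d \<partial>std_gauss d) \<le> 1" .
  have "(\<integral>\<^sup>+x. \<integral>\<^sup>+y. ?L x y \<partial>std_gauss d \<partial>std_gauss d) \<le> (\<integral>\<^sup>+x. \<integral>\<^sup>+y. \<integral>\<^sup>+u. H (x, y) u \<partial>U \<partial>std_gauss d \<partial>std_gauss d)"
    by (intro nn_integral_mono L)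
  also have "\<dots> = (\<integral>\<^sup>+p. \<integral>\<^sup>+u. H p u \<partial>U \<partial>(std_gauss d \<Otimes>\<^sub>M std_gauss d))"
    using H by (intro G.nn_integral_fst U.borel_measurable_nn_integral)
  also have "\<dots> = (\<integral>\<^sup>+u. \<integral>\<^sup>+p. H p u \<partial>(std_gauss d \<Otimes>\<^sub>M std_gauss d) \<partial>U)"
    by (intro UG.Fubini'[symmetric] H)
  also have "\<dots> \<le> (\<integral>\<^sup>+u. 1 \<partial>U)"
  proof (intro nn_integral_mono_AE)
    have "AE u in U. u \<in> {0..1}"
      unfolding U_def by (subst AE_density) (auto simp: indicator_def)
    then show "AE u in U. (\<integral>\<^sup>+p. H p u \<partial>(std_gauss d \<Otimes>\<^sub>M std_gauss d)) \<le> 1"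
      by eventually_elim (simp only: rot F1)
  qed
  also have "\<dots> = 1" by (simp add: U.emeasure_space_1)
  finally show ?thesis .
qed


lemma sqnorm_sq_le_exp:
  assumes "d \<ge> 1"
  shows "(sqnorm d z)\<^sup>2 \<le> 32 * (real d)\<^sup>2 * exp (sqnorm d z / (4 * real d))"
proof -
  define t where "t = sqnorm d z / (4 * real d)"
  have t: "t \<ge> 0" "sqnorm d z = 4 * real d * t" using assms by (auto simp: t_def)
  have "t\<^sup>2 / 2 \<le> exp t"
    using exp_lower_Taylor_quadratic[OF t(1)] t(1) by simp
  then show ?thesis
    unfolding t_def[symmetric] t(2) by (simp add: power_mult_distrib)
qed

lemma integrable_exp_sqnorm:
  assumes "d \<ge> 1"
  shows "integrable (std_gauss d) (\<lambda>z. exp (sqnorm d z / (4 * real d)))"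
    and "(\<integral>z. exp (sqnorm d z / (4 * real d)) \<partial>std_gauss d) \<le> 3 / 2"
proof -
  note bd = nn_integral_std_gauss_exp_scaled[OF assms]
  show I: "integrable (std_gauss d) (\<lambda>z. exp (sqnorm d z / (4 * real d)))"
    using bd by (intro integrableI_nonneg) (auto simp: le_less_trans)
  show "(\<integral>z. exp (sqnorm d z / (4 * real d)) \<partial>std_gauss d) \<le> 3 / 2"
    using bd by (subst (asm) nn_integral_eq_integral[OF I]) auto
qed

lemma cubic_reflect: "cubic d T (reflect d z) = - cubic d T z"
proof -
  have "cubic d T (reflect d z) = cubic d T (lincomb d (- 1) z 0 z)"
    by (intro trilin_cong) (auto simp: reflect_def lincomb_def)
  then show ?thesis by (simp add: trilin_lincomb)
qed

text \<open>The constant \<open>9\<close> matters: it is what the exponent \<open>1\<close> in \<open>E\<^sub>s\<close> allows for the fourth moment of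
  \<open>exp r\<close> below. The constants in the proof are chosen so that
  \<open>3 \<pi>\<^sup>2 / 64 \<cdot> 14.91 \<cdot> (43 / 40)\<^sup>3 \<le> 9\<close> holds with \<open>\<pi> \<le> 3.2\<close>.\<close>

lemma cubic_exp_moment:
  assumes bd: "\<And>z. \<bar>cubic d T z\<bar> \<le> \<tau> * (sqrt (sqnorm d z)) ^ 3" and \<tau>: "\<tau> \<ge> 0" and d: "d \<ge> 1"
  shows "(\<integral>\<^sup>+z. ennreal (exp (cubic d T z - 9 * \<tau>\<^sup>2 * (sqnorm d z)\<^sup>2)) \<partial>std_gauss d)
    \<le> ennreal (exp (1100000 * \<tau>\<^sup>2 * (real d)\<^sup>2))"
proof -
  interpret G: prob_space "std_gauss d" by (rule prob_space_std_gauss)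
  define P where "P = (\<integral>\<^sup>+z. ennreal (exp (cubic d T z - 9 * \<tau>\<^sup>2 * (sqnorm d z)\<^sup>2)) \<partial>std_gauss d)"
  \<comment> \<open>The pair inequality bounds a product \<open>P * Q\<close>, and a lower bound for
    \<open>Q\<close> turns this into the upper bound for \<open>P\<close>. The number 21100 is 3 *
    10.24 / 64 * 14.91 * (43/3)^3, rounded up.\<close>
  define Q where "Q = (\<integral>\<^sup>+z. ennreal (exp (- cubic d T z - 21100 * \<tau>\<^sup>2 * (sqnorm d z)\<^sup>2)) \<partial>std_gauss d)"
  have pi2: "pi\<^sup>2 \<le> 10.24"
    using power_mono[OF pi_le_32, of 2] by (simp add: power2_eq_square)
  have mp: "(\<integral>\<^sup>+x. \<integral>\<^sup>+y. ennreal (exp (cubic d T x - cubic d T y - 3 * pi\<^sup>2 / 64 * (14.91 * \<tau>\<^sup>2) *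
      ((43 / 40) ^ 3 * (sqnorm d x)\<^sup>2 + (43 / 3) ^ 3 * (sqnorm d y)\<^sup>2))) \<partial>std_gauss d \<partial>std_gauss d) \<le> 1"
    by (intro maurey_pisier_cubic cubic_grad_bound bd \<tau>) auto
  have wt: "3 * pi\<^sup>2 / 64 * (14.91 * \<tau>\<^sup>2) * ((43 / 40) ^ 3 * a + (43 / 3) ^ 3 * b) \<le>
    9 * \<tau>\<^sup>2 * a + 21100 * \<tau>\<^sup>2 * b" if "a \<ge> 0" "b \<ge> 0" for a b :: real
  proof -
    have "3 * pi\<^sup>2 / 64 * (14.91 * \<tau>\<^sup>2) * ((43 / 40) ^ 3 * a + (43 / 3) ^ 3 * b) \<le>
      3 * 10.24 / 64 * (14.91 * \<tau>\<^sup>2) * ((43 / 40) ^ 3 * a + (43 / 3) ^ 3 * b)"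
      using that pi2 by (intro mult_right_mono divide_right_mono mult_left_mono) auto
    also have "\<dots> = (3 * 10.24 / 64 * 14.91 * (43 / 40) ^ 3) * (\<tau>\<^sup>2 * a) +
       (3 * 10.24 / 64 * 14.91 * (43 / 3) ^ 3) * (\<tau>\<^sup>2 * b)"
      by (simp add: field_simps)
    also have "\<dots> \<le> 9 * (\<tau>\<^sup>2 * a) + 21100 * (\<tau>\<^sup>2 * b)"
      using that by (intro add_mono mult_right_mono) (auto simp: power3_eq_cube)
    finally show ?thesis by (simp add: mult.assoc)
  qed
  have "P * Q = (\<integral>\<^sup>+x. \<integral>\<^sup>+y. ennreal (exp (cubic d T x - 9 * \<tau>\<^sup>2 * (sqnorm d x)\<^sup>2)) *
      ennreal (exp (- cubic d T y - 21100 * \<tau>\<^sup>2 * (sqnorm d y)\<^sup>2)) \<partial>std_gauss d \<partial>std_gauss d)"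
    unfolding P_def Q_def by (simp add: nn_integral_cmult nn_integral_multc)
  also have "\<dots> \<le> (\<integral>\<^sup>+x. \<integral>\<^sup>+y. ennreal (exp (cubic d T x - cubic d T y - 3 * pi\<^sup>2 / 64 * (14.91 * \<tau>\<^sup>2) *
      ((43 / 40) ^ 3 * (sqnorm d x)\<^sup>2 + (43 / 3) ^ 3 * (sqnorm d y)\<^sup>2))) \<partial>std_gauss d \<partial>std_gauss d)"
    using wt[of "(sqnorm d _)\<^sup>2" "(sqnorm d _)\<^sup>2"]
    by (intro nn_integral_mono) (auto simp only: ennreal_mult[symmetric] exp_ge_zero exp_add[symmetric]
      intro!: ennreal_leI exp_le_cancel_iff[THEN iffD2], smt (verit) wt zero_le_power2)
  also note mp
  finally have PQ: "P * Q \<le> 1" .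
  have "integrable (std_gauss d) (\<lambda>z. (sqnorm d z)\<^sup>2)"
    using sqnorm_sq_le_exp[OF d]
    by (intro Bochner_Integration.integrable_bound[OF integrable_mult_right[OF integrable_exp_sqnorm(1)[OF d], of "32 * (real d)\<^sup>2"]]) auto
  note I4 = this
  have E4: "(\<integral>z. (sqnorm d z)\<^sup>2 \<partial>std_gauss d) \<le> 48 * (real d)\<^sup>2"
  proof -
    have "(\<integral>z. (sqnorm d z)\<^sup>2 \<partial>std_gauss d) \<le> (\<integral>z. 32 * (real d)\<^sup>2 * exp (sqnorm d z / (4 * real d)) \<partial>std_gauss d)"
      using sqnorm_sq_le_exp[OF d] integrable_exp_sqnorm(1)[OF d] I4 by (intro integral_mono) auto
    also have "\<dots> = 32 * (real d)\<^sup>2 * (\<integral>z. exp (sqnorm d z / (4 * real d)) \<partial>std_gauss d)"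
      by simp
    also have "\<dots> \<le> 32 * (real d)\<^sup>2 * (3 / 2)"
      by (intro mult_left_mono integrable_exp_sqnorm(2)[OF d]) auto
    finally show ?thesis by simp
  qed
  have cb: "\<bar>cubic d T z\<bar> \<le> \<tau> * (1 + (sqnorm d z)\<^sup>2)" for z
  proof -
    have "0 \<le> (sqnorm d z - 1)\<^sup>2" by simp
    then have "2 * sqnorm d z \<le> 1 + (sqnorm d z)\<^sup>2" by (simp add: power2_eq_square algebra_simps)
    then have "(sqrt (sqnorm d z)) ^ 3 \<le> 1 + (sqnorm d z)\<^sup>2"
      using sqrt_cubed_le[of "sqnorm d z"] zero_le_power2[of "sqnorm d z"] by (simp; linarith)
    then show ?thesis
      using bd[of z] \<tau> by (meson mult_left_mono order_trans)
  qed
  have I3: "integrable (std_gauss d) (cubic d T)"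
    using cb \<tau> by (intro Bochner_Integration.integrable_bound[where f = "\<lambda>z. \<tau> * (1 + (sqnorm d z)\<^sup>2)" and g = "cubic d T"])
      (auto intro!: I4 integrable_mult_right Bochner_Integration.integrable_add)
  have "(\<integral>z. cubic d T z \<partial>std_gauss d) = 0"
    by (intro integral_std_gauss_odd) (auto simp: cubic_reflect)
  \<comment> \<open>Jensen's inequality bounds \<open>Q\<close> below by the exponential of the mean
    exponent: the odd cubic form has mean 0 and the fourth power of the norm has mean at most
    \<open>48 * (real d)\<^sup>2\<close>, and 21100 * 48 is below 1100000.\<close>
  then have "has_bochner_integral (std_gauss d) (\<lambda>z. - cubic d T z - 21100 * \<tau>\<^sup>2 * (sqnorm d z)\<^sup>2)
    (- 21100 * \<tau>\<^sup>2 * (\<integral>z. (sqnorm d z)\<^sup>2 \<partial>std_gauss d))"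
    using I3 I4 by (simp add: has_bochner_integral_iff)
  from G.exp_integral_le[OF this]
  have "ennreal (exp (- 21100 * \<tau>\<^sup>2 * (\<integral>z. (sqnorm d z)\<^sup>2 \<partial>std_gauss d))) \<le> Q"
    by (simp add: Q_def)
  moreover have "- 1100000 * \<tau>\<^sup>2 * (real d)\<^sup>2 \<le> - 21100 * \<tau>\<^sup>2 * (\<integral>z. (sqnorm d z)\<^sup>2 \<partial>std_gauss d)"
  proof -
    have "21100 * \<tau>\<^sup>2 * (\<integral>z. (sqnorm d z)\<^sup>2 \<partial>std_gauss d) \<le> 21100 * \<tau>\<^sup>2 * (48 * (real d)\<^sup>2)"
      by (intro mult_left_mono E4) auto
    also have "\<dots> \<le> 1100000 * \<tau>\<^sup>2 * (real d)\<^sup>2"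
      by (simp add: mult.assoc)
    finally show ?thesis by simp
  qed
  ultimately have "ennreal (exp (- 1100000 * \<tau>\<^sup>2 * (real d)\<^sup>2)) \<le> Q"
    by (meson ennreal_leI exp_le_cancel_iff order_trans)
  then have "P * ennreal (exp (- 1100000 * \<tau>\<^sup>2 * (real d)\<^sup>2)) \<le> 1"
    using PQ by (meson mult_left_mono order_trans zero_le)
  then have "P * ennreal (exp (- 1100000 * \<tau>\<^sup>2 * (real d)\<^sup>2)) * ennreal (exp (1100000 * \<tau>\<^sup>2 * (real d)\<^sup>2)) \<le>
    1 * ennreal (exp (1100000 * \<tau>\<^sup>2 * (real d)\<^sup>2))"
    by (intro mult_right_mono) auto
  moreover have "ennreal (exp (- 1100000 * \<tau>\<^sup>2 * (real d)\<^sup>2)) * ennreal (exp (1100000 * \<tau>\<^sup>2 * (real d)\<^sup>2)) = 1"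
    by (simp add: ennreal_mult[symmetric] exp_add[symmetric])
  ultimately show ?thesis
    unfolding P_def[symmetric] by (simp add: mult.assoc)
qed


section \<open>The expansion in standardised coordinates\<close>

lemma power_le_fact_exp: "x \<ge> 0 \<Longrightarrow> x ^ n \<le> fact n * exp (x :: real)"
proof -
  assume x: "x \<ge> 0"
  have "(\<Sum>k\<in>{n}. x ^ k /\<^sub>R fact k) \<le> (\<Sum>k. x ^ k /\<^sub>R fact k)"
    using x by (intro sum_le_suminf summable_exp_generic) auto
  then have "x ^ n / fact n \<le> exp x"
    by (simp add: exp_def divide_inverse mult.commute)
  then show ?thesis by (simp add: field_simps)
qed

lemma nn_integral_Cauchy_Schwarz_real:
  fixes f g :: "'a \<Rightarrow> real"
  assumes [measurable]: "f \<in> borel_measurable M" "g \<in> borel_measurable M"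
    and pos: "\<And>x. f x \<ge> 0" "\<And>x. g x \<ge> 0"
    and f: "(\<integral>\<^sup>+x. ennreal ((f x)\<^sup>2) \<partial>M) \<le> ennreal a" and g: "(\<integral>\<^sup>+x. ennreal ((g x)\<^sup>2) \<partial>M) \<le> ennreal b"
    and ab: "a \<ge> 0" "b \<ge> 0"
  shows "(\<integral>\<^sup>+x. ennreal (f x * g x) \<partial>M) \<le> ennreal (sqrt (a * b))"
proof -
  define I where "I = (\<integral>\<^sup>+x. ennreal (f x * g x) \<partial>M)"
  have "I\<^sup>2 = (\<integral>\<^sup>+x. ennreal (f x) * ennreal (g x) \<partial>M)\<^sup>2"
    by (simp add: I_def ennreal_mult pos)
  also have "\<dots> \<le> (\<integral>\<^sup>+x. ennreal (f x) ^ 2 \<partial>M) * (\<integral>\<^sup>+x. ennreal (g x) ^ 2 \<partial>M)"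
    by (intro Cauchy_Schwarz_nn_integral) auto
  also have "\<dots> \<le> ennreal a * ennreal b"
    using f g by (intro mult_mono) (auto simp: ennreal_power pos)
  also have "\<dots> = ennreal (sqrt (a * b)) ^ 2"
    using ab by (simp add: ennreal_mult[symmetric] ennreal_power)
  finally have le: "I\<^sup>2 \<le> ennreal (sqrt (a * b)) ^ 2" .
  show ?thesis
  proof (cases I)
    case (real i)
    then have "i\<^sup>2 \<le> (sqrt (a * b))\<^sup>2"
      using le ab by (simp add: ennreal_power)
    then have "i \<le> sqrt (a * b)"
      by (rule power2_le_imp_le) (use ab in simp)
    then show ?thesis
      using real unfolding I_def[symmetric] by (simp add: ennreal_leI)
  next
    case top
    then show ?thesis using le ab by (simp add: ennreal_power top_unique)
  qed
qed

definition weight_const :: real where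
  "weight_const = 3 ^ 12 * (1 + 2 ^ 12 * fact 12 + 4 ^ 24 * fact 24 + 4 ^ 36 * fact 36)"

text \<open>Turns weighted exponential moments of \<open>t\<close> into moments: where the weight \<open>m\<^sup>2 / 4\<close> is at
  least \<open>t / 2\<close>, the polynomial \<open>m\<^sup>2\<close> already dominates \<open>t\<close>.\<close>

lemma weight_pow_le:
  assumes t: "t \<ge> 0" and m: "m \<ge> 0"
  shows "(1 + t + m ^ 3) ^ 12 \<le> weight_const * (exp (t - m\<^sup>2 / 4) + exp (m / 4))"
proof -
  define w where "w = m\<^sup>2 / 4"
  define X where "X = exp (t - w) + exp (m / 4)"
  have X: "1 \<le> X" "exp (m / 4) \<le> X" "exp (t - w) \<le> X"
    using m by (auto simp: X_def add_increasing)
  have mp: "m ^ n \<le> 4 ^ n * fact n * X" for n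
  proof -
    have "m ^ n = 4 ^ n * (m / 4) ^ n" by (simp add: power_divide)
    also have "\<dots> \<le> 4 ^ n * (fact n * exp (m / 4))"
      using m by (intro mult_left_mono power_le_fact_exp) auto
    also have "\<dots> \<le> 4 ^ n * (fact n * X)"
      using X by (intro mult_left_mono) auto
    finally show ?thesis by simp
  qed
  have tp: "t ^ 12 \<le> (2 ^ 12 * fact 12 + 4 ^ 24 * fact 24) * X"
  proof (cases "w \<le> t / 2")
    case True
    have "t ^ 12 = 2 ^ 12 * (t / 2) ^ 12" by (simp add: power_divide)
    also have "\<dots> \<le> 2 ^ 12 * (fact 12 * exp (t / 2))"
      using t by (intro mult_left_mono power_le_fact_exp) auto
    also have "exp (t / 2) \<le> X"
      using True X(3) by (intro order_trans[OF _ X(3)]) simp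
    finally have "t ^ 12 \<le> 2 ^ 12 * fact 12 * X" by simp
    also have "\<dots> \<le> (2 ^ 12 * fact 12 + 4 ^ 24 * fact 24) * X"
      using X by (intro mult_right_mono) auto
    finally show ?thesis .
  next
    case False
    then have "t \<le> m\<^sup>2"
      unfolding w_def using zero_le_power2[of m] by linarith
    then have "t ^ 12 \<le> (m\<^sup>2) ^ 12"
      using t by (intro power_mono) auto
    also have "\<dots> = m ^ 24" by (simp add: power_mult[symmetric])
    also have "\<dots> \<le> 4 ^ 24 * fact 24 * X" by (rule mp)
    also have "\<dots> \<le> (2 ^ 12 * fact 12 + 4 ^ 24 * fact 24) * X"
      using X by (intro mult_right_mono) auto
    finally show ?thesis .
  qed
  \<comment> \<open>Bounding the three summands by their maximum costs \<open>3 ^ 12\<close>; the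
    power 36 in the constant is that of \<open>(m ^ 3) ^ 12\<close>, the power 24 that of the case
    where \<open>t\<close> is at most \<open>m\<^sup>2\<close>.\<close>
  define a where "a = max 1 (max t (m ^ 3))"
  have "(1 + t + m ^ 3) ^ 12 \<le> (3 * a) ^ 12"
    using t m by (intro power_mono) (auto simp: a_def)
  also have "\<dots> = 3 ^ 12 * a ^ 12" by (simp add: power_mult_distrib)
  also have "\<dots> \<le> 3 ^ 12 * ((1 + 2 ^ 12 * fact 12 + 4 ^ 24 * fact 24 + 4 ^ 36 * fact 36) * X)"
  proof (rule mult_left_mono)
  have "a ^ 12 \<le> 1 + t ^ 12 + (m ^ 3) ^ 12"
    using t m by (auto simp: a_def max_def add_increasing add_increasing2)
  also have "(m ^ 3) ^ 12 = m ^ 36" by (simp add: power_mult[symmetric])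
  also have "1 + t ^ 12 + m ^ 36 \<le> X + (2 ^ 12 * fact 12 + 4 ^ 24 * fact 24) * X + 4 ^ 36 * fact 36 * X"
    by (intro add_mono X tp mp)
  also have "\<dots> = (1 + 2 ^ 12 * fact 12 + 4 ^ 24 * fact 24 + 4 ^ 36 * fact 36) * X"
    by (simp add: algebra_simps)
  finally show "a ^ 12 \<le> (1 + 2 ^ 12 * fact 12 + 4 ^ 24 * fact 24 + 4 ^ 36 * fact 36) * X" .
  qed simp
  finally show ?thesis
    by (simp only: weight_const_def X_def w_def mult.assoc)
qed

definition moment_const :: real where
  "moment_const = weight_const * (exp 31000 + exp 31000 + 3 / 2)"

lemma moment_const_pos: "moment_const \<ge> 1"
proof -
  have "1 * (1 :: real) \<le> weight_const * (exp 31000 + exp 31000 + 3 / 2)"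
    by (intro mult_mono) (auto simp: weight_const_def add_increasing)
  then show ?thesis by (simp add: moment_const_def)
qed

text \<open>The factor 6 is that of the cubic Taylor term: \<open>e3 / real d\<close> stands for the
  norm of the third derivative tensor.\<close>

locale cubic_form =
  fixes d :: nat and T :: "nat \<Rightarrow> nat \<Rightarrow> nat \<Rightarrow> real" and e3 :: real
  assumes d: "d \<ge> 1" and e3: "e3 \<ge> 0"
    and bound: "\<And>z. \<bar>cubic d T z\<bar> \<le> e3 / (6 * real d) * (sqrt (sqnorm d z)) ^ 3"
begin

abbreviation "\<Gamma> \<equiv> std_gauss d"
abbreviation "S \<equiv> cubic d T"

sublocale prob_space \<Gamma> by (rule prob_space_std_gauss)

definition m :: "point \<Rightarrow> real" where "m z = sqnorm d z / real d"

text \<open>One majorant for every polynomial factor of the expansion: \<open>e3 * h\<close>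
  dominates \<open>S\<close>, and \<open>1 + m ^ 3\<close> dominates the quadratic and the 5/2-th
  power of \<open>m\<close> coming from the Taylor errors. For \<open>e3 = 0\<close> the quotient is
  0 by the convention for division, and \<open>S\<close> vanishes as well.\<close>

definition h :: "point \<Rightarrow> real" where "h z = 1 + \<bar>S z\<bar> / e3 + m z ^ 3"

lemma m_nonneg [simp]: "m z \<ge> 0" by (simp add: m_def)

lemma m_measurable [measurable]: "m \<in> borel_measurable (lebesgue_Rd d)"
  unfolding m_def by measurable

lemma h_measurable [measurable]: "h \<in> borel_measurable (lebesgue_Rd d)"
  unfolding h_def by measurable

lemma h_ge_1: "h z \<ge> 1"
  using e3 by (simp add: h_def)

lemma S_le_h: "\<bar>S z\<bar> \<le> e3 * h z"
proof (cases "e3 = 0")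
  case True
  then show ?thesis using bound[of z] by simp
next
  case False
  then have "e3 * (\<bar>S z\<bar> / e3) = \<bar>S z\<bar>" by simp
  moreover have "0 \<le> e3 * (1 + m z ^ 3)" using e3 by simp
  ultimately show ?thesis by (simp add: h_def algebra_simps)
qed

lemma m_le_h: "1 + m z ^ 3 \<le> h z"
  using e3 by (simp add: h_def)

text \<open>The exponential inequality for the form \<open>c * S\<close>, whose bound is
  \<open>\<tau> = \<bar>c\<bar> * (e3 / (6 * real d))\<close>: the 9 there and the square of 6 leave
  the factor 1/4. With \<open>c = 4\<close> this yields the fourth moment of \<open>exp S\<close>,
  with \<open>c\<close> equal to plus or minus \<open>1 / e3\<close> the moments of
  \<open>S / e3\<close>. The number 31000 is 1100000 / 36, rounded up.\<close>

lemma scaled_exp_moment: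
  "(\<integral>\<^sup>+z. ennreal (exp (c * S z - c\<^sup>2 * e3\<^sup>2 * (m z)\<^sup>2 / 4)) \<partial>\<Gamma>) \<le> ennreal (exp (31000 * (c\<^sup>2 * e3\<^sup>2)))"
proof -
  define \<tau> where "\<tau> = \<bar>c\<bar> * (e3 / (6 * real d))"
  define T' where "T' = (\<lambda>i j k. c * T i j k)"
  have T': "cubic d T' z = c * S z" for z
    by (simp add: trilin_def T'_def sum_distrib_left mult.assoc)
  have "\<bar>cubic d T' z\<bar> \<le> \<tau> * (sqrt (sqnorm d z)) ^ 3" for z
    using mult_left_mono[OF bound[of z], of "\<bar>c\<bar>"] by (simp add: T' abs_mult \<tau>_def)
  then have "(\<integral>\<^sup>+z. ennreal (exp (cubic d T' z - 9 * \<tau>\<^sup>2 * (sqnorm d z)\<^sup>2)) \<partial>\<Gamma>)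
    \<le> ennreal (exp (1100000 * \<tau>\<^sup>2 * (real d)\<^sup>2))"
    using e3 d by (intro cubic_exp_moment) (auto simp: \<tau>_def)
  moreover have "9 * \<tau>\<^sup>2 * (sqnorm d z)\<^sup>2 = c\<^sup>2 * e3\<^sup>2 * (m z)\<^sup>2 / 4" for z
    by (simp add: \<tau>_def m_def power_mult_distrib power_divide)
  moreover have "1100000 * \<tau>\<^sup>2 * (real d)\<^sup>2 = 1100000 / 36 * (c\<^sup>2 * e3\<^sup>2)"
    using d by (simp add: \<tau>_def power_mult_distrib power_divide)
  ultimately have "(\<integral>\<^sup>+z. ennreal (exp (c * S z - c\<^sup>2 * e3\<^sup>2 * (m z)\<^sup>2 / 4)) \<partial>\<Gamma>)
    \<le> ennreal (exp (1100000 / 36 * (c\<^sup>2 * e3\<^sup>2)))"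
    by (simp only: T')
  also have "\<dots> \<le> ennreal (exp (31000 * (c\<^sup>2 * e3\<^sup>2)))"
    by (intro ennreal_leI exp_le_cancel_iff[THEN iffD2] mult_right_mono) auto
  finally show ?thesis .
qed

lemma exp_m_moment: "(\<integral>\<^sup>+z. ennreal (exp (m z / 4)) \<partial>\<Gamma>) \<le> ennreal (3 / 2)"
  using nn_integral_std_gauss_exp_scaled[OF d] by (simp add: m_def mult.commute)

text \<open>One of the two signs of \<open>c\<close> covers the absolute value of \<open>S\<close>,
  and \<open>weight_pow_le\<close> converts weighted exponential moments into powers. The order 12
  is forced by the later use: \<open>h ^ 3\<close> occurs in the remainder, is squared for its L2
  norm, and is squared again by Cauchy-Schwarz.\<close>

lemma h_moment: "(\<integral>\<^sup>+z. ennreal (h z ^ 12) \<partial>\<Gamma>) \<le> ennreal moment_const"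
proof -
  define A where "A = (\<lambda>c z. ennreal (exp (c * S z - c\<^sup>2 * e3\<^sup>2 * (m z)\<^sup>2 / 4)))"
  have [measurable]: "A c \<in> borel_measurable (lebesgue_Rd d)" for c
    unfolding A_def by measurable
  have A: "(\<integral>\<^sup>+z. A c z \<partial>\<Gamma>) \<le> ennreal (exp 31000)" if "c\<^sup>2 * e3\<^sup>2 \<le> 1" for c
    using that scaled_exp_moment[of c] unfolding A_def
    by (elim order_trans) (intro ennreal_leI, simp)
  have c: "(1 / e3)\<^sup>2 * e3\<^sup>2 \<le> 1" "(- 1 / e3)\<^sup>2 * e3\<^sup>2 \<le> 1" by (auto simp: power_divide)
  have wc: "weight_const \<ge> 0" by (simp add: weight_const_def)
  have "ennreal (h z ^ 12) \<le> ennreal weight_const * (A (1 / e3) z + A (- 1 / e3) z + ennreal (exp (m z / 4)))" for z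
  proof -
    define t where "t = \<bar>S z\<bar> / e3"
    have t: "t \<ge> 0" using e3 by (simp add: t_def)
    have "exp (t - (m z)\<^sup>2 / 4) \<le> exp (1 / e3 * S z - (1 / e3)\<^sup>2 * e3\<^sup>2 * (m z)\<^sup>2 / 4) +
      exp (- 1 / e3 * S z - (- 1 / e3)\<^sup>2 * e3\<^sup>2 * (m z)\<^sup>2 / 4)"
    proof (cases "e3 = 0")
      case True
      then show ?thesis by (simp add: t_def) (rule order_trans[of _ 1], auto)
    next
      case False
      then show ?thesis
        by (cases "S z \<ge> 0") (auto simp: t_def power_divide add_increasing add_increasing2)
    qed
    then have "h z ^ 12 \<le> weight_const * (exp (1 / e3 * S z - (1 / e3)\<^sup>2 * e3\<^sup>2 * (m z)\<^sup>2 / 4) +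
      exp (- 1 / e3 * S z - (- 1 / e3)\<^sup>2 * e3\<^sup>2 * (m z)\<^sup>2 / 4) + exp (m z / 4))"
      using weight_pow_le[OF t m_nonneg[of z]] wc unfolding h_def t_def[symmetric]
      by (elim order_trans) (intro mult_left_mono add_mono, auto)
    then have "ennreal (h z ^ 12) \<le> ennreal (weight_const * (exp (1 / e3 * S z - (1 / e3)\<^sup>2 * e3\<^sup>2 * (m z)\<^sup>2 / 4) +
      exp (- 1 / e3 * S z - (- 1 / e3)\<^sup>2 * e3\<^sup>2 * (m z)\<^sup>2 / 4) + exp (m z / 4)))"
      by (rule ennreal_leI)
    also have "\<dots> = ennreal weight_const * (A (1 / e3) z + A (- 1 / e3) z + ennreal (exp (m z / 4)))"
      using wc by (simp only: A_def ennreal_mult ennreal_plus exp_ge_zero add_nonneg_nonneg)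
    finally show ?thesis .
  qed
  then have "(\<integral>\<^sup>+z. ennreal (h z ^ 12) \<partial>\<Gamma>) \<le>
    (\<integral>\<^sup>+z. ennreal weight_const * (A (1 / e3) z + A (- 1 / e3) z + ennreal (exp (m z / 4))) \<partial>\<Gamma>)"
    by (intro nn_integral_mono)
  also have "\<dots> = ennreal weight_const * ((\<integral>\<^sup>+z. A (1 / e3) z \<partial>\<Gamma>) + (\<integral>\<^sup>+z. A (- 1 / e3) z \<partial>\<Gamma>) +
     (\<integral>\<^sup>+z. ennreal (exp (m z / 4)) \<partial>\<Gamma>))"
    by (simp add: nn_integral_cmult nn_integral_add)
  also have "\<dots> \<le> ennreal weight_const * (ennreal (exp 31000) + ennreal (exp 31000) + ennreal (3 / 2))"
    by (intro mult_left_mono add_mono A exp_m_moment c) auto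
  also have "\<dots> = ennreal moment_const"
    using wc by (simp only: moment_const_def ennreal_mult ennreal_plus exp_ge_zero add_nonneg_nonneg zero_le_divide_iff zero_le_numeral simp_thms)
  finally show ?thesis .
qed

lemma h_moment_le:
  assumes "k \<le> 12"
  shows "(\<integral>\<^sup>+z. ennreal (h z ^ k) \<partial>\<Gamma>) \<le> ennreal moment_const"
proof -
  have "(\<integral>\<^sup>+z. ennreal (h z ^ k) \<partial>\<Gamma>) \<le> (\<integral>\<^sup>+z. ennreal (h z ^ 12) \<partial>\<Gamma>)"
    using assms h_ge_1 by (intro nn_integral_mono ennreal_leI power_increasing) auto
  then show ?thesis using h_moment by (rule order_trans)
qed

end

section \<open>Integral estimates inside and outside the ball\<close>

lemma nn_integral_exp_abs:
  assumes a: "a > 0"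
  shows "(\<integral>\<^sup>+x. ennreal (exp (- a * \<bar>x\<bar>)) \<partial>lborel) \<le> ennreal (2 / a)"
proof -
  have 1: "(\<integral>\<^sup>+x. ennreal (exponential_density a x) \<partial>lborel) = 1"
    using prob_space.emeasure_space_1[OF prob_space_exponential_density[OF a]]
    by (simp add: emeasure_density)
  then have 2: "(\<integral>\<^sup>+x. ennreal (exponential_density a (- x)) \<partial>lborel) = 1"
    using nn_integral_real_affine[of "\<lambda>x. ennreal (exponential_density a x)" "- 1" 0] by simp
  have "exp (- a * \<bar>x\<bar>) \<le> 1 / a * (exponential_density a x + exponential_density a (- x))" for x
    using a by (auto simp: exponential_density_def mult.commute add_increasing)
  then have "(\<integral>\<^sup>+x. ennreal (exp (- a * \<bar>x\<bar>)) \<partial>lborel) \<le>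
    (\<integral>\<^sup>+x. ennreal (1 / a) * (ennreal (exponential_density a x) + ennreal (exponential_density a (- x))) \<partial>lborel)"
    using a by (intro nn_integral_mono) (simp add: ennreal_mult'[symmetric] ennreal_plus[symmetric]
      exponential_density_nonneg ennreal_leI del: ennreal_plus)
  also have "\<dots> = ennreal (1 / a) * (1 + 1)"
    by (subst nn_integral_cmult) (auto simp: nn_integral_add 1 2)
  also have "\<dots> = ennreal (2 / a)"
    using a by (simp add: ennreal_mult'[symmetric] flip: ennreal_numeral)
  finally show ?thesis .
qed


lemma integral_abs_le_nn:
  fixes f F :: "'a \<Rightarrow> real"
  assumes [measurable]: "f \<in> borel_measurable M"
    and le: "\<And>x. x \<in> space M \<Longrightarrow> \<bar>f x\<bar> \<le> F x"
    and F: "(\<integral>\<^sup>+x. ennreal (F x) \<partial>M) \<le> ennreal C" and C: "C \<ge> 0"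
  shows "integrable M f" and "\<bar>\<integral>x. f x \<partial>M\<bar> \<le> C"
proof -
  have "(\<integral>\<^sup>+x. ennreal (norm (f x)) \<partial>M) \<le> (\<integral>\<^sup>+x. ennreal (F x) \<partial>M)"
    using le by (intro nn_integral_mono ennreal_leI) auto
  with F have b: "(\<integral>\<^sup>+x. ennreal (norm (f x)) \<partial>M) \<le> ennreal C" by (rule order_trans[rotated])
  then show I: "integrable M f"
    by (intro integrableI_bounded) (auto intro: le_less_trans)
  have "ennreal (norm (\<integral>x. f x \<partial>M)) \<le> (\<integral>\<^sup>+x. ennreal (norm (f x)) \<partial>M)"
    by (rule integral_norm_bound_ennreal[OF I])
  also note b
  finally show "\<bar>\<integral>x. f x \<partial>M\<bar> \<le> C" using C by simp
qed

lemma nn_integral_cmult_le: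
  fixes F :: "'a \<Rightarrow> real"
  assumes F [measurable]: "F \<in> borel_measurable M" and b: "(\<integral>\<^sup>+x. ennreal (F x) \<partial>M) \<le> ennreal b" and c: "c \<ge> 0"
  shows "(\<integral>\<^sup>+x. ennreal (c * F x) \<partial>M) \<le> ennreal (c * b)"
proof -
  have "(\<integral>\<^sup>+x. ennreal (c * F x) \<partial>M) = ennreal c * (\<integral>\<^sup>+x. ennreal (F x) \<partial>M)"
    using c by (subst nn_integral_cmult[symmetric]) (auto simp: ennreal_mult')
  also have "\<dots> \<le> ennreal c * ennreal b" by (intro mult_left_mono b) auto
  finally show ?thesis using c by (simp add: ennreal_mult')
qed

definition second_const :: "real \<Rightarrow> real" where
  "second_const M = 2 * moment_const + 2 * (sqrt moment_const * exp (248000 * M\<^sup>2))"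

text \<open>The factor \<open>2 * exp (4 * M\<^sup>2)\<close> bounds the inverse of the denominator;
  the three groups inside are the coefficients of the third-order term, of the fifth-derivative term
  and of the tail term.\<close>

definition core_const :: "real \<Rightarrow> real" where
  "core_const M = 2 * exp (4 * M\<^sup>2) * ((3 + 2 * M\<^sup>2) * sqrt (second_const M) * (1 + sqrt moment_const) +
    sqrt moment_const + (M * moment_const + 1 + 2 * (M * sqrt moment_const)))"

text \<open>\<open>W\<close> is \<open>V - V xh\<close> in standardised coordinates and only matters on \<open>\<Theta>\<close>; \<open>Q\<close> is its quartic
  Taylor term.\<close>

locale laplace_core = cubic_form +
  fixes e4 e5 s c0 M ag :: real and \<Theta> :: "point set" and W Q g :: "point \<Rightarrow> real"
  assumes e3M: "e3 \<le> M" and e4: "0 \<le> e4" "e4 \<le> M" and e5: "0 \<le> e5"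
    and c0: "0 < c0" "c0 \<le> 1" and s_lower: "8 * ln (2 * exp 1 / c0) \<le> c0 * s"
    and \<Theta> [measurable]: "\<Theta> \<in> sets (lebesgue_Rd d)"
    and ball: "\<And>z. z \<in> Rd d \<Longrightarrow> sqnorm d z \<le> s\<^sup>2 * real d \<Longrightarrow> z \<in> \<Theta>"
    and W [measurable]: "W \<in> borel_measurable (lebesgue_Rd d)"
    and Q [measurable]: "Q \<in> borel_measurable (lebesgue_Rd d)"
    and g [measurable]: "g \<in> borel_measurable (lebesgue_Rd d)"
    and Q_even: "\<And>z. z \<in> Rd d \<Longrightarrow> Q (reflect d z) = Q z"
    and g_odd: "\<And>z. z \<in> Rd d \<Longrightarrow> g (reflect d z) = - g z"
    and g_sq: "(\<integral>\<^sup>+z. ennreal ((g z)\<^sup>2) \<partial>std_gauss d) \<le> 1"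
    and taylor4: "\<And>z. z \<in> Rd d \<Longrightarrow> sqnorm d z \<le> s\<^sup>2 * real d \<Longrightarrow>
      \<bar>sqnorm d z / 2 - W z - cubic d T z\<bar> \<le> e4\<^sup>2 * (sqnorm d z / real d)\<^sup>2 / 24"
    and taylor5: "\<And>z. z \<in> Rd d \<Longrightarrow> sqnorm d z \<le> s\<^sup>2 * real d \<Longrightarrow>
      \<bar>sqnorm d z / 2 - W z - cubic d T z + Q z\<bar> \<le> (e5 / real d) ^ 3 * (sqrt (sqnorm d z)) ^ 5 / 120"
    and growth: "\<And>z. z \<in> \<Theta> \<Longrightarrow> s\<^sup>2 * real d < sqnorm d z \<Longrightarrow> c0 * sqrt (real d) * sqrt (sqnorm d z) \<le> W z"
    and ag: "0 \<le> ag"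
    and g_growth: "\<And>z. z \<in> Rd d \<Longrightarrow> \<bar>g z\<bar> \<le> ag * exp (c0 * sqrt (real d) * sqrt (sqnorm d z) / 2)"
begin

definition r :: "point \<Rightarrow> real" where "r z = sqnorm d z / 2 - W z"
definition iB :: "point \<Rightarrow> real" where "iB z = (if sqnorm d z \<le> s\<^sup>2 * real d then 1 else 0)"
definition iC :: "point \<Rightarrow> real" where "iC z = (if sqnorm d z \<le> s\<^sup>2 * real d then 0 else 1)"
definition E :: real where "E = exp ((e3\<^sup>2 + e4\<^sup>2) * s ^ 4)"
text \<open>Majorant of the Lagrange remainders of \<open>exp r\<close> on the ball:
  \<open>1 + exp r\<close> bounds \<open>exp\<close> at any point between 0 and
  \<open>r\<close>.\<close>

definition \<phi> :: "point \<Rightarrow> real" where "\<phi> z = h z ^ 3 * (1 + exp (r z) * iB z)"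
text \<open>The exponential factor of \<open>tau\<close>; as \<open>d \<ge> 1\<close>, it is at most
  \<open>tau\<close>.\<close>

definition tl :: real where "tl = exp (- c0 * s * real d / 8)"

lemma core_measurables [measurable]:
  "r \<in> borel_measurable (lebesgue_Rd d)" "iB \<in> borel_measurable (lebesgue_Rd d)"
  "iC \<in> borel_measurable (lebesgue_Rd d)" "\<phi> \<in> borel_measurable (lebesgue_Rd d)"
  unfolding r_def iB_def iC_def \<phi>_def[abs_def] by measurable

lemma iB_iC: "iB z + iC z = 1" "iB z \<ge> 0" "iC z \<ge> 0" "iB z \<le> 1" "iC z \<le> 1"
  by (auto simp: iB_def iC_def)

lemma i_reflect [simp]: "iB (reflect d z) = iB z" "iC (reflect d z) = iC z"
  by (auto simp: iB_def iC_def)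

lemma h_nonneg [simp]: "h z \<ge> 0"
  using h_ge_1[of z] by linarith

lemma \<phi>_nonneg [simp]: "\<phi> z \<ge> 0"
  using iB_iC(2)[of z] by (simp add: \<phi>_def)

lemma E_ge_1: "E \<ge> 1"
  by (simp add: E_def)

text \<open>As \<open>c0 \<le> 1\<close>, the logarithm in \<open>s_star\<close> is at least
  1.\<close>

lemma s_ge: "8 \<le> s" and c0s: "8 \<le> c0 * s"
proof -
  have "exp 1 \<le> 2 * exp 1 / c0"
    using c0 by (simp add: field_simps)
  then have "1 \<le> ln (2 * exp 1 / c0)"
    using c0 by (subst ln_ge_iff) auto
  then show cs: "8 \<le> c0 * s" using s_lower by linarith
  then have "s > 0" using c0(1) by (smt (verit) mult_nonneg_nonpos)
  then have "c0 * s \<le> 1 * s" using c0 by (intro mult_right_mono) auto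
  then show "8 \<le> s" using cs by simp
qed

lemma M_nonneg: "0 \<le> M" using e3 e3M by linarith

lemma r_le: "z \<in> Rd d \<Longrightarrow> iB z \<noteq> 0 \<Longrightarrow> \<bar>r z - S z\<bar> \<le> e4\<^sup>2 * (m z)\<^sup>2 / 24"
  using taylor4[of z] by (auto simp: iB_def r_def m_def split: if_splits)

text \<open>Chernoff's bound with exponent 1/4: the moment is sqrt 2 to the power d, at most
  \<open>exp (real d / 2)\<close>, and \<open>s \<ge> 8\<close> lets the quadratic exponent dominate
  the linear one that is asserted.\<close>

lemma nn_iC: "(\<integral>\<^sup>+z. ennreal (iC z) \<partial>\<Gamma>) \<le> ennreal (exp (- c0 * s * real d / 2))"
proof -
  have "iC z \<le> exp (- s\<^sup>2 * real d / 4) * exp (1 / 4 * sqnorm d z)" for z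
    by (auto simp: iC_def exp_add[symmetric])
  then have "(\<integral>\<^sup>+z. ennreal (iC z) \<partial>\<Gamma>) \<le> (\<integral>\<^sup>+z. ennreal (exp (- s\<^sup>2 * real d / 4)) * ennreal (exp (1 / 4 * sqnorm d z)) \<partial>\<Gamma>)"
    by (intro nn_integral_mono) (simp add: ennreal_mult[symmetric] ennreal_leI)
  also have "\<dots> = ennreal (exp (- s\<^sup>2 * real d / 4)) * (\<integral>\<^sup>+z. ennreal (exp (1 / 4 * sqnorm d z)) \<partial>\<Gamma>)"
    by (intro nn_integral_cmult) measurable
  also have "\<dots> = ennreal (exp (- s\<^sup>2 * real d / 4) * (1 / sqrt (1 - 2 * (1 / 4))) ^ d)"
    by (subst nn_integral_std_gauss_exp_sqnorm) (simp_all add: ennreal_mult)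
  also have "\<dots> \<le> ennreal (exp (- c0 * s * real d / 2))"
  proof (rule ennreal_leI)
    have "1 / sqrt (1 - 2 * (1 / 4)) = sqrt (2 :: real)"
      by (simp add: real_sqrt_divide)
    also have "\<dots> \<le> 3 / 2"
      by (rule real_le_lsqrt) (auto simp: power2_eq_square)
    also have "\<dots> \<le> exp (1 / 2)"
      using exp_ge_add_one_self[of "1 / 2"] by simp
    finally have "(1 / sqrt (1 - 2 * (1 / 4))) ^ d \<le> exp (1 / 2) ^ d"
      by (intro power_mono) auto
    also have "\<dots> = exp (real d / 2)"
      by (simp add: exp_of_nat_mult[symmetric])
    finally have "exp (- s\<^sup>2 * real d / 4) * (1 / sqrt (1 - 2 * (1 / 4))) ^ d \<le> exp (- s\<^sup>2 * real d / 4) * exp (real d / 2)"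
      by (intro mult_left_mono) auto
    also have "\<dots> = exp (real d * (1 / 2 - s\<^sup>2 / 4))"
      by (simp add: exp_add[symmetric] field_simps)
    also have "\<dots> \<le> exp (real d * (- (c0 * s) / 2))"
    proof -
      have "8 * s \<le> s\<^sup>2" using s_ge by (simp add: power2_eq_square)
      moreover have "c0 * s \<le> 1 * s" using c0 s_ge by (intro mult_right_mono) auto
      ultimately have "1 / 2 - s\<^sup>2 / 4 \<le> - (c0 * s) / 2" using s_ge by linarith
      then show ?thesis
        unfolding exp_le_cancel_iff by (intro mult_left_mono) auto
    qed
    finally show "exp (- s\<^sup>2 * real d / 4) * (1 / sqrt (1 - 2 * (1 / 4))) ^ d \<le> exp (- c0 * s * real d / 2)"
      by (simp add: mult_ac)
  qed
  finally show ?thesis .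
qed

lemma l1_le_l2: "(\<Sum>i<d. \<bar>z i\<bar>) \<le> sqrt (real d) * sqrt (sqnorm d z)"
proof -
  have "(\<Sum>i<d. \<bar>z i\<bar>)\<^sup>2 = (\<Sum>i<d. 1 * \<bar>z i\<bar>)\<^sup>2" by simp
  also have "\<dots> \<le> (\<Sum>i<d. 1\<^sup>2) * (\<Sum>i<d. \<bar>z i\<bar>\<^sup>2)"
    by (rule Cauchy_Schwarz_ineq_sum)
  also have "\<dots> = real d * sqnorm d z" by (simp add: sqnorm_def)
  finally have "(\<Sum>i<d. \<bar>z i\<bar>) \<le> sqrt (real d * sqnorm d z)"
    by (rule real_le_rsqrt)
  then show ?thesis by (simp add: real_sqrt_mult)
qed

text \<open>The Gaussian density times \<open>exp (r z)\<close> is \<open>exp (- W z)\<close> up to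
  normalisation, so the growth of \<open>W\<close> supplies \<open>c0 * sqrt (real d)\<close> times
  the norm. Half of it pays for the growth allowed to \<open>g\<close>. A quarter, with the norm
  exceeding \<open>s * sqrt (real d)\<close>, gives the factor \<open>k\<close>. The last quarter
  controls the l1 norm and makes the integral a product of d factors, each at most
  \<open>2 * exp 1 / c0\<close>. By the choice of \<open>s_star\<close> their product is at most
  \<open>exp (c0 * s * real d / 8)\<close>, half of the exponent in \<open>k\<close>.\<close>

lemma nn_tail:
  "(\<integral>\<^sup>+z. ennreal (indicator \<Theta> z * iC z * exp (c0 * sqrt (real d) * sqrt (sqnorm d z) / 2) * exp (r z)) \<partial>\<Gamma>)
    \<le> ennreal tl"
proof -
  define k where "k = exp (- c0 * s * real d / 4)"
  have k: "k > 0" by (simp add: k_def)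
  have pw: "exp (- sqnorm d z / 2) / sqrt (2 * pi) ^ d *
      (indicator \<Theta> z * iC z * exp (c0 * sqrt (real d) * sqrt (sqnorm d z) / 2) * exp (r z)) \<le>
    k * (\<Prod>i<d. exp (- (c0 / 4) * \<bar>z i\<bar>) / sqrt (2 * pi))" for z
  proof (cases "z \<in> \<Theta> \<and> s\<^sup>2 * real d < sqnorm d z")
    case False
    then have 0: "indicator \<Theta> z * iC z = 0" by (auto simp: iC_def indicator_def)
    show ?thesis unfolding 0 using k by (simp add: prod_nonneg)
  next
    case True
    define t where "t = sqrt (sqnorm d z)"
    have "s * sqrt (real d) = sqrt (s\<^sup>2 * real d)"
      using s_ge by (simp add: real_sqrt_mult)
    also have "\<dots> \<le> t" using True by (simp add: t_def)
    finally have "c0 / 4 * sqrt (real d) * (s * sqrt (real d)) \<le> c0 / 4 * sqrt (real d) * t"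
      using c0 by (intro mult_left_mono) auto
    then have 1: "c0 * s * real d / 4 \<le> c0 / 4 * sqrt (real d) * t"
      by (simp add: mult_ac)
    \<comment> \<open>Passing to the \<open>\<ell>\<^sup>1\<close> norm turns the radial integral into a product.\<close>
    have "c0 / 4 * (\<Sum>i<d. \<bar>z i\<bar>) \<le> c0 / 4 * (sqrt (real d) * t)"
      unfolding t_def using c0 by (intro mult_left_mono l1_le_l2) auto
    then have 2: "c0 / 4 * (\<Sum>i<d. \<bar>z i\<bar>) \<le> c0 / 4 * sqrt (real d) * t" by simp
    have "c0 * sqrt (real d) * t \<le> W z"
      using growth[of z] True by (simp add: t_def)
    then have 3: "- sqnorm d z / 2 + (c0 * sqrt (real d) * t / 2 + r z) \<le>
      - c0 * s * real d / 4 + - (c0 / 4) * (\<Sum>i<d. \<bar>z i\<bar>)"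
      using 1 2 unfolding r_def by (simp add: algebra_simps)
    have "exp (- sqnorm d z / 2) * (exp (c0 * sqrt (real d) * t / 2) * exp (r z)) \<le>
      k * exp (- (c0 / 4) * (\<Sum>i<d. \<bar>z i\<bar>))"
      unfolding k_def using 3 by (simp only: exp_add[symmetric] exp_le_cancel_iff)
    also have "exp (- (c0 / 4) * (\<Sum>i<d. \<bar>z i\<bar>)) = (\<Prod>i<d. exp (- (c0 / 4) * \<bar>z i\<bar>))"
      by (simp add: sum_distrib_left exp_sum)
    finally have "exp (- sqnorm d z / 2) * (exp (c0 * sqrt (real d) * t / 2) * exp (r z)) / sqrt (2 * pi) ^ d \<le>
      k * (\<Prod>i<d. exp (- (c0 / 4) * \<bar>z i\<bar>)) / sqrt (2 * pi) ^ d"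
      by (intro divide_right_mono) auto
    moreover have "(\<Prod>i<d. exp (- (c0 / 4) * \<bar>z i\<bar>) / sqrt (2 * pi)) =
      (\<Prod>i<d. exp (- (c0 / 4) * \<bar>z i\<bar>)) / sqrt (2 * pi) ^ d"
      by (subst prod_dividef) simp
    moreover have "indicator \<Theta> z * iC z = 1" using True by (simp add: iC_def)
    ultimately show ?thesis by (simp add: t_def[symmetric] mult_ac)
  qed
  have one_dim: "(\<integral>\<^sup>+x. ennreal (exp (- (c0 / 4) * \<bar>x\<bar>) / sqrt (2 * pi)) \<partial>lborel) \<le> ennreal (2 * exp 1 / c0)"
  proof -
    have "(\<integral>\<^sup>+x. ennreal (exp (- (c0 / 4) * \<bar>x\<bar>) / sqrt (2 * pi)) \<partial>lborel) =
      (\<integral>\<^sup>+x. ennreal (exp (- (c0 / 4) * \<bar>x\<bar>)) * ennreal (1 / sqrt (2 * pi)) \<partial>lborel)"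
      by (simp add: ennreal_mult[symmetric])
    also have "\<dots> = (\<integral>\<^sup>+x. ennreal (exp (- (c0 / 4) * \<bar>x\<bar>)) \<partial>lborel) * ennreal (1 / sqrt (2 * pi))"
      by (intro nn_integral_multc) measurable
    also have "\<dots> \<le> ennreal (2 / (c0 / 4)) * ennreal (1 / sqrt (2 * pi))"
      using c0 by (intro mult_right_mono nn_integral_exp_abs) auto
    also have "\<dots> = ennreal (8 / c0 * (1 / sqrt (2 * pi)))"
      using c0 by (subst ennreal_mult[symmetric]) auto
    also have "\<dots> \<le> ennreal (2 * exp 1 / c0)"
    proof (rule ennreal_leI)
      have "2 \<le> sqrt (2 * pi)"
        using pi_gt3 by (intro real_le_rsqrt) auto
      then have "1 / sqrt (2 * pi) \<le> 1 / 2" by (simp add: field_simps)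
      then have "8 / c0 * (1 / sqrt (2 * pi)) \<le> 8 / c0 * (1 / 2)"
        using c0 by (intro mult_left_mono) auto
      also have "\<dots> \<le> 2 * exp 1 / c0"
        using c0 exp_ge_add_one_self[of "1 :: real"] by (simp add: divide_right_mono)
      finally show "8 / c0 * (1 / sqrt (2 * pi)) \<le> 2 * exp 1 / c0" .
    qed
    finally show ?thesis .
  qed
  have "(\<integral>\<^sup>+z. ennreal (indicator \<Theta> z * iC z * exp (c0 * sqrt (real d) * sqrt (sqnorm d z) / 2) * exp (r z)) \<partial>\<Gamma>) =
    (\<integral>\<^sup>+z. ennreal (exp (- sqnorm d z / 2) / sqrt (2 * pi) ^ d) *
      ennreal (indicator \<Theta> z * iC z * exp (c0 * sqrt (real d) * sqrt (sqnorm d z) / 2) * exp (r z)) \<partial>lebesgue_Rd d)"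
    by (subst nn_integral_std_gauss) (auto simp: prod_std_normal_density)
  also have "\<dots> \<le> (\<integral>\<^sup>+z. ennreal k * (\<Prod>i<d. ennreal (exp (- (c0 / 4) * \<bar>z i\<bar>) / sqrt (2 * pi))) \<partial>lebesgue_Rd d)"
  proof (rule nn_integral_mono)
    fix z
    have "ennreal k * (\<Prod>i<d. ennreal (exp (- (c0 / 4) * \<bar>z i\<bar>) / sqrt (2 * pi))) =
      ennreal (k * (\<Prod>i<d. exp (- (c0 / 4) * \<bar>z i\<bar>) / sqrt (2 * pi)))"
      using k by (subst prod_ennreal) (simp_all add: ennreal_mult' del: times_divide_eq_right)
    moreover have "ennreal (exp (- sqnorm d z / 2) / sqrt (2 * pi) ^ d) * ennreal a =
      ennreal (exp (- sqnorm d z / 2) / sqrt (2 * pi) ^ d * a)" for a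
      by (rule ennreal_mult'[symmetric]) simp
    ultimately show "ennreal (exp (- sqnorm d z / 2) / sqrt (2 * pi) ^ d) *
        ennreal (indicator \<Theta> z * iC z * exp (c0 * sqrt (real d) * sqrt (sqnorm d z) / 2) * exp (r z)) \<le>
      ennreal k * (\<Prod>i<d. ennreal (exp (- (c0 / 4) * \<bar>z i\<bar>) / sqrt (2 * pi)))"
      using ennreal_leI[OF pw[of z]] by (simp only:)
  qed
  also have "\<dots> = ennreal k * (\<integral>\<^sup>+z. (\<Prod>i<d. ennreal (exp (- (c0 / 4) * \<bar>z i\<bar>) / sqrt (2 * pi))) \<partial>lebesgue_Rd d)"
    by (intro nn_integral_cmult) measurable
  also have "\<dots> = ennreal k * (\<Prod>i<d. \<integral>\<^sup>+x. ennreal (exp (- (c0 / 4) * \<bar>x\<bar>) / sqrt (2 * pi)) \<partial>lborel)"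
    by (subst lborel_product.product_nn_integral_prod) auto
  also have "\<dots> \<le> ennreal k * (\<Prod>i<d. ennreal (2 * exp 1 / c0))"
  proof -
    have "(\<integral>\<^sup>+x. ennreal (exp (- (c0 / 4) * \<bar>x\<bar>) / sqrt (2 * pi)) \<partial>lborel) ^ n \<le> ennreal (2 * exp 1 / c0) ^ n" for n
      by (induction n) (auto intro!: mult_mono one_dim[simplified])
    then show ?thesis
      by (intro mult_left_mono) (simp_all only: prod_constant card_lessThan zero_le)
  qed
  also have "\<dots> = ennreal (k * (2 * exp 1 / c0) ^ d)"
    using c0 k by (simp add: ennreal_power ennreal_mult)
  also have "\<dots> \<le> ennreal tl"
  proof (rule ennreal_leI)
    have "(2 * exp 1 / c0) ^ d = exp (real d * ln (2 * exp 1 / c0))"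
      using c0 by (simp add: exp_of_nat_mult)
    also have "\<dots> \<le> exp (real d * (c0 * s / 8))"
      using s_lower by (intro exp_le_cancel_iff[THEN iffD2] mult_left_mono) auto
    finally have "k * (2 * exp 1 / c0) ^ d \<le> k * exp (real d * (c0 * s / 8))"
      using k by (intro mult_left_mono) auto
    also have "\<dots> = tl"
      by (simp add: k_def tl_def exp_add[symmetric] field_simps)
    finally show "k * (2 * exp 1 / c0) ^ d \<le> tl" .
  qed
  finally show ?thesis .
qed


definition A where "A = exp (496000 * M\<^sup>2) * E ^ 4"

text \<open>On the ball \<open>m z\<close> is at most \<open>s\<^sup>2\<close>, so the weight
  subtracted in \<open>scaled_exp_moment\<close> with \<open>c = 4\<close> costs at most
  \<open>4 * e3\<^sup>2 * s ^ 4\<close>; the quartic error costs at most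
  \<open>4 * e4\<^sup>2 * s ^ 4\<close>. Together this is precisely \<open>E ^ 4\<close>. The
  constant is 31000 times 16.\<close>

lemma nn_exp4: "(\<integral>\<^sup>+z. ennreal (exp (4 * r z) * iB z) \<partial>\<Gamma>) \<le> ennreal A"
proof -
  have pw: "exp (4 * r z) * iB z \<le> E ^ 4 * exp (4 * S z - 4\<^sup>2 * e3\<^sup>2 * (m z)\<^sup>2 / 4)" if z: "z \<in> Rd d" for z
  proof (cases "iB z = 0")
    case False
    then have B: "iB z = 1" "m z \<le> s\<^sup>2"
      using d by (auto simp: iB_def m_def field_simps split: if_splits)
    then have m2: "(m z)\<^sup>2 \<le> s ^ 4"
      using power_mono[OF B(2) m_nonneg, of 2] by (simp add: power_mult[symmetric])
    have "4 * r z \<le> 4 * S z + 4 * (e4\<^sup>2 * (m z)\<^sup>2 / 24)"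
      using abs_le_D1[OF r_le[OF z False]] by linarith
    also have "\<dots> \<le> 4 * S z + 4 * (e4\<^sup>2 * s ^ 4)"
    proof -
      have "e4\<^sup>2 * (m z)\<^sup>2 \<le> e4\<^sup>2 * s ^ 4" by (intro mult_left_mono m2) auto
      moreover have "0 \<le> e4\<^sup>2 * (m z)\<^sup>2" by simp
      ultimately show ?thesis by linarith
    qed
    also have "4 * S z = (4 * S z - 4\<^sup>2 * e3\<^sup>2 * (m z)\<^sup>2 / 4) + 4 * (e3\<^sup>2 * (m z)\<^sup>2)"
      by simp
    also have "e3\<^sup>2 * (m z)\<^sup>2 \<le> e3\<^sup>2 * s ^ 4" by (intro mult_left_mono m2) auto
    finally have "4 * r z \<le> 4 * ((e3\<^sup>2 + e4\<^sup>2) * s ^ 4) + (4 * S z - 4\<^sup>2 * e3\<^sup>2 * (m z)\<^sup>2 / 4)"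
      by (simp add: distrib_right)
    then have "exp (4 * r z) \<le> exp (4 * ((e3\<^sup>2 + e4\<^sup>2) * s ^ 4)) * exp (4 * S z - 4\<^sup>2 * e3\<^sup>2 * (m z)\<^sup>2 / 4)"
      by (simp only: exp_add[symmetric] exp_le_cancel_iff)
    also have "exp (4 * ((e3\<^sup>2 + e4\<^sup>2) * s ^ 4)) = E ^ 4"
      by (simp add: E_def exp_of_nat_mult[symmetric])
    finally show ?thesis using B by simp
  qed (use E_ge_1 in simp)
  have "(\<integral>\<^sup>+z. ennreal (exp (4 * r z) * iB z) \<partial>\<Gamma>) \<le>
    (\<integral>\<^sup>+z. ennreal (E ^ 4) * ennreal (exp (4 * S z - 4\<^sup>2 * e3\<^sup>2 * (m z)\<^sup>2 / 4)) \<partial>\<Gamma>)"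
    using E_ge_1 pw by (intro nn_integral_mono) (simp add: ennreal_mult[symmetric] ennreal_leI)
  also have "\<dots> = ennreal (E ^ 4) * (\<integral>\<^sup>+z. ennreal (exp (4 * S z - 4\<^sup>2 * e3\<^sup>2 * (m z)\<^sup>2 / 4)) \<partial>\<Gamma>)"
    by (intro nn_integral_cmult) measurable
  also have "\<dots> \<le> ennreal (E ^ 4) * ennreal (exp (31000 * (4\<^sup>2 * e3\<^sup>2)))"
    by (intro mult_left_mono scaled_exp_moment) auto
  also have "\<dots> \<le> ennreal (E ^ 4) * ennreal (exp (496000 * M\<^sup>2))"
    using power_mono[OF e3M e3, of 2]
    by (intro mult_left_mono ennreal_leI exp_le_cancel_iff[THEN iffD2]) auto
  also have "\<dots> = ennreal A"
    using E_ge_1 by (simp add: A_def ennreal_mult[symmetric] mult.commute)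
  finally show ?thesis .
qed

text \<open>Cauchy-Schwarz pairs the twelfth moment of \<open>h\<close> with the fourth moment of
  \<open>exp r\<close>, and the root of \<open>E ^ 4\<close> leaves \<open>E\<^sup>2\<close>; taking
  the L2 norm of \<open>\<phi>\<close> later leaves a single \<open>E\<close>.\<close>

lemma nn_\<phi>: "(\<integral>\<^sup>+z. ennreal ((\<phi> z)\<^sup>2) \<partial>\<Gamma>) \<le> ennreal (second_const M * E\<^sup>2)"
proof -
  have A0: "A \<ge> 0" using E_ge_1 by (simp add: A_def)
  have mc: "moment_const \<ge> 0" using moment_const_pos by simp
  have "(\<integral>\<^sup>+z. ennreal (h z ^ 6 * (exp (2 * r z) * iB z)) \<partial>\<Gamma>) \<le> ennreal (sqrt (moment_const * A))"
  proof (rule nn_integral_Cauchy_Schwarz_real)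
    have "(\<integral>\<^sup>+z. ennreal ((h z ^ 6)\<^sup>2) \<partial>\<Gamma>) = (\<integral>\<^sup>+z. ennreal (h z ^ 12) \<partial>\<Gamma>)"
      by (simp add: power_mult[symmetric])
    then show "(\<integral>\<^sup>+z. ennreal ((h z ^ 6)\<^sup>2) \<partial>\<Gamma>) \<le> ennreal moment_const"
      using h_moment by simp
    have "(exp (2 * r z) * iB z)\<^sup>2 = exp (4 * r z) * iB z" for z
      by (auto simp: iB_def exp_double[symmetric] power2_eq_square exp_add[symmetric])
    then show "(\<integral>\<^sup>+z. ennreal ((exp (2 * r z) * iB z)\<^sup>2) \<partial>\<Gamma>) \<le> ennreal A"
      using nn_exp4 by simp
  qed (use A0 mc iB_iC in auto)
  also have "sqrt (moment_const * A) = sqrt moment_const * exp (248000 * M\<^sup>2) * E\<^sup>2"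
  proof -
    have "A = (exp (248000 * M\<^sup>2) * E\<^sup>2)\<^sup>2"
      by (simp add: A_def power_mult_distrib exp_double[symmetric] power_mult[symmetric])
    then show ?thesis
      using E_ge_1 by (simp add: real_sqrt_mult)
  qed
  finally have 1: "(\<integral>\<^sup>+z. ennreal (h z ^ 6 * (exp (2 * r z) * iB z)) \<partial>\<Gamma>) \<le>
    ennreal (sqrt moment_const * exp (248000 * M\<^sup>2) * E\<^sup>2)" .
  have "(\<phi> z)\<^sup>2 \<le> 2 * (h z ^ 6 + h z ^ 6 * (exp (2 * r z) * iB z))" for z
  proof -
    have "0 \<le> (1 - exp (r z) * iB z)\<^sup>2" by simp
    then have "(1 + exp (r z) * iB z)\<^sup>2 \<le> 2 * (1 + (exp (r z) * iB z)\<^sup>2)"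
      by (simp add: power2_eq_square algebra_simps)
    also have "(exp (r z) * iB z)\<^sup>2 = exp (2 * r z) * iB z"
      by (auto simp: iB_def exp_double)
    finally have "(h z ^ 3)\<^sup>2 * (1 + exp (r z) * iB z)\<^sup>2 \<le> (h z ^ 3)\<^sup>2 * (2 * (1 + exp (2 * r z) * iB z))"
      by (intro mult_left_mono) auto
    moreover have "(h z ^ 3)\<^sup>2 = h z ^ 6" by (simp add: power_mult[symmetric])
    ultimately show ?thesis
      by (simp only: \<phi>_def power_mult_distrib) (simp add: algebra_simps)
  qed
  then have "(\<integral>\<^sup>+z. ennreal ((\<phi> z)\<^sup>2) \<partial>\<Gamma>) \<le> (\<integral>\<^sup>+z. 2 * (ennreal (h z ^ 6) + ennreal (h z ^ 6 * (exp (2 * r z) * iB z))) \<partial>\<Gamma>)"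
    using iB_iC(2) by (intro nn_integral_mono) (simp add: ennreal_plus[symmetric] ennreal_mult'[symmetric] ennreal_leI
      flip: ennreal_numeral del: ennreal_plus)
  also have "\<dots> = 2 * ((\<integral>\<^sup>+z. ennreal (h z ^ 6) \<partial>\<Gamma>) + (\<integral>\<^sup>+z. ennreal (h z ^ 6 * (exp (2 * r z) * iB z)) \<partial>\<Gamma>))"
    by (subst nn_integral_cmult) (auto simp: nn_integral_add)
  also have "\<dots> \<le> 2 * (ennreal moment_const + ennreal (sqrt moment_const * exp (248000 * M\<^sup>2) * E\<^sup>2))"
    by (intro mult_left_mono add_mono 1 h_moment_le) auto
  also have "\<dots> = ennreal (2 * (moment_const + sqrt moment_const * exp (248000 * M\<^sup>2) * E\<^sup>2))"
    using mc by (simp add: ennreal_plus[symmetric] ennreal_mult'[symmetric] flip: ennreal_numeral del: ennreal_plus)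
  also have "\<dots> \<le> ennreal (second_const M * E\<^sup>2)"
  proof (rule ennreal_leI)
    have "moment_const * 1 \<le> moment_const * E\<^sup>2"
      using mc E_ge_1 by (intro mult_left_mono) (auto simp: one_le_power)
    then show "2 * (moment_const + sqrt moment_const * exp (248000 * M\<^sup>2) * E\<^sup>2) \<le> second_const M * E\<^sup>2"
      unfolding second_const_def by (simp add: algebra_simps)
  qed
  finally show ?thesis .
qed

lemma second_const_pos: "second_const M \<ge> 0"
  using moment_const_pos by (simp add: second_const_def)

lemma nn_g_mult:
  assumes [measurable]: "F \<in> borel_measurable (lebesgue_Rd d)" and pos: "\<And>z. F z \<ge> 0"
    and F: "(\<integral>\<^sup>+z. ennreal ((F z)\<^sup>2) \<partial>\<Gamma>) \<le> ennreal b" and b: "b \<ge> 0"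
  shows "(\<integral>\<^sup>+z. ennreal (\<bar>g z\<bar> * F z) \<partial>\<Gamma>) \<le> ennreal (sqrt b)"
proof -
  have "(\<integral>\<^sup>+z. ennreal (\<bar>g z\<bar> * F z) \<partial>\<Gamma>) \<le> ennreal (sqrt (1 * b))"
    using pos F b g_sq by (intro nn_integral_Cauchy_Schwarz_real) auto
  then show ?thesis by simp
qed

lemma nn_g\<phi>: "(\<integral>\<^sup>+z. ennreal (\<bar>g z\<bar> * \<phi> z) \<partial>\<Gamma>) \<le> ennreal (sqrt (second_const M) * E)"
  using nn_g_mult[OF core_measurables(4) \<phi>_nonneg nn_\<phi>] second_const_pos E_ge_1 by (simp add: real_sqrt_mult)

lemma nn_gh: "(\<integral>\<^sup>+z. ennreal (\<bar>g z\<bar> * h z) \<partial>\<Gamma>) \<le> ennreal (sqrt moment_const)"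
  using moment_const_pos by (intro nn_g_mult h_moment_le) auto

lemma nn_1\<phi>: "(\<integral>\<^sup>+z. ennreal (\<phi> z) \<partial>\<Gamma>) \<le> ennreal (sqrt (second_const M) * E)"
proof -
  have "(\<integral>\<^sup>+z. ennreal (1 * \<phi> z) \<partial>\<Gamma>) \<le> ennreal (sqrt (1 * (second_const M * E\<^sup>2)))"
    using nn_\<phi> second_const_pos
    by (intro nn_integral_Cauchy_Schwarz_real) (auto simp: emeasure_space_1[simplified])
  then show ?thesis using E_ge_1 by (simp add: real_sqrt_mult)
qed

text \<open>Two applications of Cauchy-Schwarz take a fourth root of the Gaussian mass outside the
  ball, whose bound is \<open>tl ^ 4\<close>.\<close>

lemma nn_ghC: "(\<integral>\<^sup>+z. ennreal (\<bar>g z\<bar> * (h z * iC z)) \<partial>\<Gamma>) \<le> ennreal (moment_const * tl)"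
proof -
  have mc: "moment_const \<ge> 1" by (rule moment_const_pos)
  define p where "p = exp (- c0 * s * real d / 2)"
  have tl4: "tl ^ 4 = p"
    by (simp add: tl_def p_def exp_of_nat_mult[symmetric])
  have "(\<integral>\<^sup>+z. ennreal ((h z)\<^sup>2 * iC z) \<partial>\<Gamma>) \<le> ennreal (sqrt (moment_const * p))"
  proof (rule nn_integral_Cauchy_Schwarz_real)
    show "(\<integral>\<^sup>+z. ennreal (((h z)\<^sup>2)\<^sup>2) \<partial>\<Gamma>) \<le> ennreal moment_const"
      using h_moment_le[of 4] by (simp add: power_mult[symmetric])
    have "(iC z)\<^sup>2 = iC z" for z by (simp add: iC_def)
    then show "(\<integral>\<^sup>+z. ennreal ((iC z)\<^sup>2) \<partial>\<Gamma>) \<le> ennreal p"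
      using nn_iC by (simp add: p_def)
  qed (use mc iB_iC in \<open>auto simp: p_def\<close>)
  moreover have "(h z * iC z)\<^sup>2 = (h z)\<^sup>2 * iC z" for z
    by (simp add: iC_def)
  ultimately have "(\<integral>\<^sup>+z. ennreal (\<bar>g z\<bar> * (h z * iC z)) \<partial>\<Gamma>) \<le> ennreal (sqrt (sqrt (moment_const * p)))"
    using mc iB_iC by (intro nn_g_mult) (auto simp: p_def)
  also have "\<dots> \<le> ennreal (moment_const * tl)"
  proof (intro ennreal_leI real_le_lsqrt)
    have "moment_const ^ 1 \<le> moment_const ^ 4" using mc by (intro power_increasing) auto
    then have "moment_const * p \<le> (moment_const * tl) ^ 4"
      by (simp add: power_mult_distrib tl4 p_def)
    then show "moment_const * p \<le> ((moment_const * tl)\<^sup>2)\<^sup>2"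
      by (simp add: power_mult[symmetric])
  qed (use mc in \<open>auto simp: tl_def p_def\<close>)
  finally show ?thesis .
qed

end

section \<open>Expansion of the exponential\<close>

lemma exp_taylor_remainder:
  fixes x :: real
  assumes n: "n > 0"
  shows "\<bar>exp x - (\<Sum>k<n. x ^ k / fact k)\<bar> \<le> \<bar>x\<bar> ^ n * (1 + exp x) / fact n"
proof -
  have sums: "(\<Sum>k<n. exp 0 / fact k * x ^ k) = (\<Sum>k<n. x ^ k / fact k)"
    by simp
  \<comment> \<open>The Lagrange point lies between 0 and \<open>x\<close>, so \<open>exp\<close>
    there is at most the larger of 1 and \<open>exp x\<close>; their sum serves both signs of
    \<open>x\<close>.\<close>
  have "\<exists>t. exp t \<le> 1 + exp x \<and> exp x = (\<Sum>k<n. x ^ k / fact k) + exp t / fact n * x ^ n"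
  proof (cases x "0 :: real" rule: linorder_cases)
    case greater
    then obtain t where t: "0 < t" "t < x" "exp x = (\<Sum>k<n. exp 0 / fact k * x ^ k) + exp t / fact n * x ^ n"
      using Maclaurin[of x n "\<lambda>_. exp" exp] n by auto
    have "exp t \<le> 1 + exp x"
      using exp_le_cancel_iff[of t x] t(2) by linarith
    with t(3) show ?thesis unfolding sums by blast
  next
    case less
    then obtain t where t: "x < t" "t < 0" "exp x = (\<Sum>k<n. exp 0 / fact k * x ^ k) + exp t / fact n * x ^ n"
      using Maclaurin_minus[of x n "\<lambda>_. exp" exp] n by auto
    have "exp t \<le> exp 0" using t(2) by (intro exp_le_cancel_iff[THEN iffD2]) simp
    then have "exp t \<le> 1 + exp x"
      using exp_gt_zero[of x] unfolding exp_zero by linarith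
    with t(3) show ?thesis unfolding sums by blast
  next
    case equal
    have "(\<Sum>k<n. (0 :: real) ^ k / fact k) = 1"
      using n by (simp add: power_0_left if_distrib if_distribR sum.delta cong: if_cong)
    with equal n show ?thesis by (intro exI[of _ 0]) simp
  qed
  then obtain t where t: "exp t \<le> 1 + exp x" "exp x - (\<Sum>k<n. x ^ k / fact k) = exp t / fact n * x ^ n"
    by (metis add_diff_cancel_left')
  have "\<bar>exp t / fact n * x ^ n\<bar> = \<bar>x\<bar> ^ n * exp t / fact n"
    by (simp add: abs_mult power_abs)
  also have "\<dots> \<le> \<bar>x\<bar> ^ n * (1 + exp x) / fact n"
    using t(1) by (intro divide_right_mono mult_left_mono) auto
  finally show ?thesis unfolding t(2) .
qed

lemma exp_taylor1: "\<bar>exp x - 1 - x\<bar> \<le> x\<^sup>2 * (1 + exp x) / 2" for x :: real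
  using exp_taylor_remainder[of 2 x] by (simp add: numeral_2_eq_2 algebra_simps)

lemma exp_taylor2: "\<bar>exp x - 1 - x - x\<^sup>2 / 2\<bar> \<le> \<bar>x\<bar> ^ 3 * (1 + exp x) / 6" for x :: real
  using exp_taylor_remainder[of 3 x] by (simp add: numeral_3_eq_3 numeral_2_eq_2 algebra_simps)

text \<open>The first estimate stops at second order and serves the denominator; the second keeps
  the even quadratic terms, which oddness removes from the numerator. Both rest on
  \<open>\<bar>r\<bar> \<le> \<eta> * h\<close> with
  \<open>\<eta> = e3 + e4\<^sup>2\<close>.\<close>

lemma exp_expansion_bounds:
  fixes r S Q h e3 e4 M \<delta> :: real
  assumes h: "h \<ge> 1" and S: "\<bar>S\<bar> \<le> e3 * h" and r4: "\<bar>r - S\<bar> \<le> e4\<^sup>2 * h" and Q: "\<bar>r - S + Q\<bar> \<le> \<delta> * h"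
    and e: "0 \<le> e3" "0 \<le> e4" "e4 \<le> M"
  shows "\<bar>exp r - 1 - S\<bar> \<le> (3 + 2 * M\<^sup>2) * (e3\<^sup>2 + e4\<^sup>2) * (h ^ 3 * (1 + exp r))"
    and "\<bar>exp r - 1 - S - S\<^sup>2 / 2 + Q\<bar> \<le>
      (3 + 2 * M\<^sup>2) * ((e3\<^sup>2 + e4\<^sup>2) * (e3 + e4\<^sup>2)) * (h ^ 3 * (1 + exp r)) + \<delta> * h"
proof -
  define \<eta> where "\<eta> = e3 + e4\<^sup>2"
  define L where "L = e3\<^sup>2 + e4\<^sup>2"
  define Y where "Y = h ^ 3 * (1 + exp r)"
  have \<eta>: "\<eta> \<ge> 0" and L: "L \<ge> 0" using e by (auto simp: \<eta>_def L_def)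
  have Y: "h \<le> Y" "h\<^sup>2 \<le> Y" "h\<^sup>2 * (1 + exp r) \<le> Y"
  proof -
    have p: "h ^ 1 \<le> h ^ 3" "h\<^sup>2 \<le> h ^ 3" using h by (intro power_increasing; simp)+
    have "h ^ 3 * 1 \<le> h ^ 3 * (1 + exp r)" using h by (intro mult_left_mono) auto
    with p show "h \<le> Y" "h\<^sup>2 \<le> Y" by (auto simp: Y_def)
    show "h\<^sup>2 * (1 + exp r) \<le> Y"
      unfolding Y_def using p by (intro mult_right_mono) (auto simp: add_nonneg_nonneg)
  qed
  have Y0: "Y \<ge> 0" using Y(1) h by linarith
  have r: "\<bar>r\<bar> \<le> \<eta> * h" using S r4 by (simp add: \<eta>_def distrib_right)
  \<comment> \<open>The bound \<open>e4 \<le> M\<close> turns the fourth power of \<open>e4\<close>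
    into a multiple of \<open>e4\<^sup>2\<close>; hence a square of \<open>\<eta>\<close> is of size
    \<open>L\<close> and a cube of size \<open>L * \<eta>\<close>.\<close>
  have \<eta>2: "\<eta>\<^sup>2 \<le> (2 + 2 * M\<^sup>2) * L"
  proof -
    have "0 \<le> (e3 - e4\<^sup>2)\<^sup>2" by simp
    then have "\<eta>\<^sup>2 \<le> 2 * e3\<^sup>2 + 2 * (e4\<^sup>2 * e4\<^sup>2)"
      by (simp add: \<eta>_def power2_eq_square algebra_simps)
    also have "e4\<^sup>2 * e4\<^sup>2 \<le> M\<^sup>2 * e4\<^sup>2"
      using e by (intro mult_right_mono power_mono) auto
    also have "2 * e3\<^sup>2 + 2 * (M\<^sup>2 * e4\<^sup>2) \<le> (2 + 2 * M\<^sup>2) * L"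
      by (simp add: L_def algebra_simps)
    finally show ?thesis by simp
  qed
  have e4L: "e4\<^sup>2 \<le> L" by (simp add: L_def)
  have r2: "r\<^sup>2 \<le> \<eta>\<^sup>2 * h\<^sup>2"
    using power_mono[OF r, of 2] by (simp add: power_mult_distrib)
  have r3: "\<bar>r\<bar> ^ 3 \<le> \<eta> ^ 3 * h ^ 3"
    using power_mono[OF r, of 3] by (simp add: power_mult_distrib)
  have "\<bar>exp r - 1 - S\<bar> \<le> \<bar>exp r - 1 - r\<bar> + \<bar>r - S\<bar>" by linarith
  also have "\<dots> \<le> r\<^sup>2 * (1 + exp r) / 2 + e4\<^sup>2 * h"
    by (intro add_mono exp_taylor1 r4)
  also have "r\<^sup>2 * (1 + exp r) / 2 \<le> \<eta>\<^sup>2 * h\<^sup>2 * (1 + exp r)"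
  proof -
    have "r\<^sup>2 * (1 + exp r) \<le> \<eta>\<^sup>2 * h\<^sup>2 * (1 + exp r)"
      by (intro mult_right_mono r2) (simp add: add_nonneg_nonneg)
    moreover have "0 \<le> r\<^sup>2 * (1 + exp r)" by (simp add: add_nonneg_nonneg)
    ultimately show ?thesis by linarith
  qed
  also have "\<eta>\<^sup>2 * h\<^sup>2 * (1 + exp r) \<le> (2 + 2 * M\<^sup>2) * L * Y"
    unfolding mult.assoc[of "\<eta>\<^sup>2"] using \<eta>2 Y(3) L by (intro mult_mono) (auto simp: add_nonneg_nonneg)
  also have "e4\<^sup>2 * h \<le> L * Y"
    using e4L Y(1) h L by (intro mult_mono) auto
  also have "(2 + 2 * M\<^sup>2) * L * Y + L * Y = (3 + 2 * M\<^sup>2) * L * Y"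
    by (simp add: algebra_simps)
  finally show "\<bar>exp r - 1 - S\<bar> \<le> (3 + 2 * M\<^sup>2) * (e3\<^sup>2 + e4\<^sup>2) * (h ^ 3 * (1 + exp r))"
    by (simp add: L_def Y_def)
  \<comment> \<open>The last term is half of \<open>r\<^sup>2 - S\<^sup>2\<close>, the price of
    replacing \<open>r\<^sup>2\<close> by \<open>S\<^sup>2\<close>; factoring it shows its order,
    \<open>e4\<^sup>2 * \<eta>\<close>.\<close>
  have "exp r - 1 - S - S\<^sup>2 / 2 + Q = (exp r - 1 - r - r\<^sup>2 / 2) + (r - S + Q) + (r - S) * (r + S) / 2"
    by (simp add: power2_eq_square field_simps)
  then have "\<bar>exp r - 1 - S - S\<^sup>2 / 2 + Q\<bar> \<le> \<bar>exp r - 1 - r - r\<^sup>2 / 2\<bar> + \<bar>r - S + Q\<bar> + \<bar>(r - S) * (r + S) / 2\<bar>"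
    by linarith
  also have "\<dots> \<le> (2 + 2 * M\<^sup>2) * (L * \<eta>) * Y + \<delta> * h + L * \<eta> * Y"
  proof (intro add_mono)
    have "\<bar>exp r - 1 - r - r\<^sup>2 / 2\<bar> \<le> \<bar>r\<bar> ^ 3 * (1 + exp r) / 6" by (rule exp_taylor2)
    also have "\<dots> \<le> \<bar>r\<bar> ^ 3 * (1 + exp r)"
      by (simp add: add_nonneg_nonneg)
    also have "\<dots> \<le> \<eta> ^ 3 * h ^ 3 * (1 + exp r)"
      by (intro mult_right_mono r3) (simp add: add_nonneg_nonneg)
    also have "\<dots> = \<eta>\<^sup>2 * \<eta> * Y" by (simp add: Y_def power2_eq_square power3_eq_cube)
    also have "\<dots> \<le> (2 + 2 * M\<^sup>2) * L * \<eta> * Y"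
      using \<eta> Y0 by (intro mult_right_mono \<eta>2) auto
    finally show "\<bar>exp r - 1 - r - r\<^sup>2 / 2\<bar> \<le> (2 + 2 * M\<^sup>2) * (L * \<eta>) * Y" by (simp add: mult.assoc)
    show "\<bar>r - S + Q\<bar> \<le> \<delta> * h" by (rule Q)
    have "\<bar>S\<bar> \<le> \<eta> * h"
    proof -
      have "e3 * h \<le> \<eta> * h" using h by (intro mult_right_mono) (auto simp: \<eta>_def)
      with S show ?thesis by linarith
    qed
    then have "\<bar>r + S\<bar> \<le> 2 * (\<eta> * h)" using r by linarith
    then have "\<bar>r - S\<bar> * \<bar>r + S\<bar> \<le> (e4\<^sup>2 * h) * (2 * (\<eta> * h))"
      using h by (intro mult_mono r4) auto
    then have "\<bar>(r - S) * (r + S) / 2\<bar> \<le> e4\<^sup>2 * (\<eta> * h\<^sup>2)"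
      by (simp add: abs_mult power2_eq_square mult_ac)
    also have "\<dots> \<le> L * (\<eta> * Y)"
      using e4L Y(2) \<eta> L by (intro mult_mono) auto
    finally show "\<bar>(r - S) * (r + S) / 2\<bar> \<le> L * \<eta> * Y" by (simp add: mult.assoc)
  qed
  also have "\<dots> = (3 + 2 * M\<^sup>2) * (L * \<eta>) * Y + \<delta> * h"
    by (simp add: algebra_simps)
  finally show "\<bar>exp r - 1 - S - S\<^sup>2 / 2 + Q\<bar> \<le>
      (3 + 2 * M\<^sup>2) * ((e3\<^sup>2 + e4\<^sup>2) * (e3 + e4\<^sup>2)) * (h ^ 3 * (1 + exp r)) + \<delta> * h"
    by (simp add: L_def Y_def \<eta>_def)
qed

section \<open>Numerator and denominator of the expectation\<close>

context laplace_core
begin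

text \<open>The size of the fifth-order Taylor error: the norm of \<open>z\<close> is
  \<open>sqrt (real d) * sqrt (m z)\<close>, so its fifth power against the cube of
  \<open>e5 / real d\<close> leaves d to the power 5/2 - 3.\<close>

definition \<delta> :: real where "\<delta> = e5 ^ 3 * real d powr (- 1 / 2)"
definition c' :: real where "c' = 3 + 2 * M\<^sup>2"
definition L :: real where "L = e3\<^sup>2 + e4\<^sup>2"
definition P :: real where "P = L * (e3 + e4\<^sup>2)"

lemma consts_nonneg: "\<delta> \<ge> 0" "c' \<ge> 0" "L \<ge> 0" "P \<ge> 0" "tl \<ge> 0"
  using e5 e3 by (auto simp: \<delta>_def c'_def L_def P_def tl_def)

lemma pointwise:
  assumes z: "z \<in> Rd d"
  shows "iB z * \<bar>exp (r z) - 1 - S z\<bar> \<le> c' * L * \<phi> z"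
    and "iB z * \<bar>exp (r z) - 1 - S z - (S z)\<^sup>2 / 2 + Q z\<bar> \<le> c' * P * \<phi> z + \<delta> * h z"
proof -
  have "iB z * \<bar>exp (r z) - 1 - S z\<bar> \<le> c' * L * \<phi> z \<and>
    iB z * \<bar>exp (r z) - 1 - S z - (S z)\<^sup>2 / 2 + Q z\<bar> \<le> c' * P * \<phi> z + \<delta> * h z"
  proof (cases "iB z = 0")
    case True
    then show ?thesis using consts_nonneg by simp
  next
    case False
    then have B: "iB z = 1" "sqnorm d z \<le> s\<^sup>2 * real d" by (auto simp: iB_def split: if_splits)
    have h1: "1 \<le> h z" by (rule h_ge_1)
    have m2: "(m z)\<^sup>2 / 24 \<le> h z"
    proof (cases "m z \<le> 1")
      case True
      then have "(m z)\<^sup>2 \<le> 1" by (simp add: power_le_one)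
      then show ?thesis using h1 by linarith
    next
      case False
      then have "(m z)\<^sup>2 \<le> m z ^ 3" by (intro power_increasing) auto
      then show ?thesis using m_le_h[of z] zero_le_power2[of "m z"] by linarith
    qed
    have r4: "\<bar>r z - S z\<bar> \<le> e4\<^sup>2 * h z"
      using r_le[OF z False] mult_left_mono[OF m2, of "e4\<^sup>2"] by simp
    have "\<bar>r z - S z + Q z\<bar> \<le> (e5 / real d) ^ 3 * (sqrt (sqnorm d z)) ^ 5 / 120"
      using taylor5[OF z B(2)] by (simp add: r_def)
    also have "\<dots> \<le> (e5 / real d) ^ 3 * (sqrt (sqnorm d z)) ^ 5"
      using e5 d by simp
    also have "\<dots> = \<delta> * sqrt (m z) ^ 5"
    proof -
      have "sqrt (sqnorm d z) = sqrt (real d) * sqrt (m z)"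
        using d by (simp add: m_def real_sqrt_mult[symmetric])
      moreover have "sqrt (real d) ^ 5 = real d ^ 3 * real d powr (- 1 / 2)"
      proof -
        have "real d powr (- 1 / 2) = inverse (real d powr (1 / 2))"
          by (simp add: powr_minus[symmetric])
        also have "\<dots> = inverse (sqrt (real d))"
          by (subst powr_half_sqrt) auto
        finally have p: "real d powr (- 1 / 2) = inverse (sqrt (real d))" .
        have "x ^ 5 = (x\<^sup>2) ^ 3 * inverse x" if "x > 0" for x :: real
          using that by (simp add: eval_nat_numeral)
        from this[of "sqrt (real d)"] show ?thesis
          using d p by simp
      qed
      ultimately show ?thesis
        using d by (simp add: \<delta>_def power_mult_distrib power_divide)
    qed
    also have "\<dots> \<le> \<delta> * h z"
    proof (rule mult_left_mono)
      show "sqrt (m z) ^ 5 \<le> h z"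
      proof (cases "m z \<le> 1")
        case True
        then have "sqrt (m z) ^ 5 \<le> 1" by (simp add: power_le_one)
        then show ?thesis using h1 by linarith
      next
        case False
        then have "sqrt (m z) ^ 5 \<le> sqrt (m z) ^ (2 * 3)" by (intro power_increasing) auto
        also have "\<dots> = m z ^ 3" unfolding power_mult by simp
        finally show ?thesis using m_le_h[of z] by linarith
      qed
    qed (rule consts_nonneg)
    finally have r5: "\<bar>r z - S z + Q z\<bar> \<le> \<delta> * h z" .
    show ?thesis
      using exp_expansion_bounds[OF h1 S_le_h[of z] r4 r5 e3 e4]
      by (simp add: B(1) \<phi>_def c'_def L_def P_def)
  qed
  then show "iB z * \<bar>exp (r z) - 1 - S z\<bar> \<le> c' * L * \<phi> z"
    "iB z * \<bar>exp (r z) - 1 - S z - (S z)\<^sup>2 / 2 + Q z\<bar> \<le> c' * P * \<phi> z + \<delta> * h z" by auto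
qed

lemma exp_iB_le_\<phi>: "exp (r z) * iB z \<le> \<phi> z"
proof -
  have "1 * (exp (r z) * iB z) \<le> h z ^ 3 * (1 + exp (r z) * iB z)"
    using h_ge_1[of z] iB_iC(2)[of z] by (intro mult_mono) (auto simp: one_le_power)
  then show ?thesis by (simp add: \<phi>_def)
qed

text \<open>In these coordinates the expectation of \<open>g\<close> under the target is
  \<open>num / den\<close>, the normalising constants having cancelled; \<open>tgt\<close> is the
  corrected integral.\<close>

definition num :: real where "num = (\<integral>z. indicator \<Theta> z * g z * exp (r z) \<partial>\<Gamma>)"
definition den :: real where "den = (\<integral>z. indicator \<Theta> z * exp (r z) \<partial>\<Gamma>)"
definition tgt :: real where "tgt = (\<integral>z. g z * (1 + S z) \<partial>\<Gamma>)"

lemma S_reflect: "S (reflect d z) = - S z" by (rule cubic_reflect)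

lemma int_gS: "integrable \<Gamma> (\<lambda>z. g z * S z)" "\<bar>\<integral>z. g z * S z \<partial>\<Gamma>\<bar> \<le> e3 * sqrt moment_const"
proof -
  have le: "\<bar>g z * S z\<bar> \<le> e3 * (\<bar>g z\<bar> * h z)" for z
    using mult_left_mono[OF S_le_h[of z], of "\<bar>g z\<bar>"] by (simp add: abs_mult mult_ac)
  have b: "(\<integral>\<^sup>+z. ennreal (e3 * (\<bar>g z\<bar> * h z)) \<partial>\<Gamma>) \<le> ennreal (e3 * sqrt moment_const)"
    by (intro nn_integral_cmult_le nn_gh e3) measurable
  show "integrable \<Gamma> (\<lambda>z. g z * S z)" "\<bar>\<integral>z. g z * S z \<partial>\<Gamma>\<bar> \<le> e3 * sqrt moment_const"
    using e3 moment_const_pos by (intro integral_abs_le_nn[OF _ le b]; simp)+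
qed

lemma int_g: "integrable \<Gamma> g"
proof (rule integral_abs_le_nn(1)[OF _ _ nn_gh])
  show "\<bar>g z\<bar> \<le> \<bar>g z\<bar> * h z" for z
    using mult_left_mono[OF h_ge_1[of z], of "\<bar>g z\<bar>"] by simp
qed (use moment_const_pos in auto)

lemma tgt_eq: "tgt = (\<integral>z. g z * S z \<partial>\<Gamma>)"
proof -
  have "(\<integral>z. g z \<partial>\<Gamma>) = 0"
    by (intro integral_std_gauss_odd g g_odd)
  moreover have "tgt = (\<integral>z. g z \<partial>\<Gamma>) + (\<integral>z. g z * S z \<partial>\<Gamma>)"
    unfolding tgt_def distrib_left mult_1_right by (intro Bochner_Integration.integral_add int_g int_gS)
  ultimately show ?thesis by simp
qed

lemma int_gB: "integrable \<Gamma> (\<lambda>z. g z * exp (r z) * iB z)"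
proof (rule integral_abs_le_nn(1)[OF _ _ nn_g\<phi>])
  fix z
  have "\<bar>g z\<bar> * (exp (r z) * iB z) \<le> \<bar>g z\<bar> * \<phi> z"
    by (intro mult_left_mono exp_iB_le_\<phi>) auto
  then show "\<bar>g z * exp (r z) * iB z\<bar> \<le> \<bar>g z\<bar> * \<phi> z"
    using iB_iC(2)[of z] by (simp add: abs_mult mult.assoc)
qed (use E_ge_1 second_const_pos in auto)

lemma int_B: "integrable \<Gamma> (\<lambda>z. exp (r z) * iB z)"
  using exp_iB_le_\<phi> iB_iC(2) E_ge_1 second_const_pos
  by (intro integral_abs_le_nn(1)[OF _ _ nn_1\<phi>]) (auto simp: abs_mult)

text \<open>\<open>\<Psi>\<close> is what remains once the odd part has been used: the remainder of
  the expansion on the ball, and minus \<open>S\<close> outside, where the local integral has no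
  counterpart to the \<open>S\<close> in \<open>tgt\<close>. The latter produces the term with
  \<open>tl\<close>.\<close>

lemma num_local:
  "\<bar>(\<integral>z. g z * exp (r z) * iB z \<partial>\<Gamma>) - tgt\<bar> \<le>
    c' * P * (sqrt (second_const M) * E) + \<delta> * sqrt moment_const + M * (moment_const * tl)"
proof -
  define \<Psi> where "\<Psi> = (\<lambda>z. iB z * (exp (r z) - 1 - S z - (S z)\<^sup>2 / 2 + Q z) - iC z * S z)"
  have [measurable]: "\<Psi> \<in> borel_measurable (lebesgue_Rd d)"
    unfolding \<Psi>_def by measurable
  define B where "B = c' * P * (sqrt (second_const M) * E) + \<delta> * sqrt moment_const + M * (moment_const * tl)"
  have B: "B \<ge> 0"
    unfolding B_def using consts_nonneg E_ge_1 second_const_pos moment_const_pos M_nonneg by simp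
  have le: "\<bar>g z * \<Psi> z\<bar> \<le> c' * P * (\<bar>g z\<bar> * \<phi> z) + \<delta> * (\<bar>g z\<bar> * h z) + M * (\<bar>g z\<bar> * (h z * iC z))"
    if "z \<in> space \<Gamma>" for z
  proof -
    have z: "z \<in> Rd d" using that by simp
    have "\<bar>S z\<bar> \<le> M * h z"
      using S_le_h[of z] mult_right_mono[OF e3M h_nonneg[of z]] by linarith
    then have "iC z * \<bar>S z\<bar> \<le> iC z * (M * h z)"
      using iB_iC(3) by (intro mult_left_mono) auto
    moreover have "\<bar>\<Psi> z\<bar> \<le> iB z * \<bar>exp (r z) - 1 - S z - (S z)\<^sup>2 / 2 + Q z\<bar> + iC z * \<bar>S z\<bar>"
      unfolding \<Psi>_def using iB_iC[of z] by (simp add: abs_mult order_trans[OF abs_triangle_ineq4])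
    ultimately have "\<bar>\<Psi> z\<bar> \<le> c' * P * \<phi> z + \<delta> * h z + M * (h z * iC z)"
      using pointwise(2)[OF z] by (simp add: mult_ac)
    then have "\<bar>g z\<bar> * \<bar>\<Psi> z\<bar> \<le> \<bar>g z\<bar> * (c' * P * \<phi> z + \<delta> * h z + M * (h z * iC z))"
      by (intro mult_left_mono) auto
    then show ?thesis by (simp add: abs_mult algebra_simps)
  qed
  have "(\<integral>\<^sup>+z. ennreal (c' * P * (\<bar>g z\<bar> * \<phi> z) + \<delta> * (\<bar>g z\<bar> * h z) + M * (\<bar>g z\<bar> * (h z * iC z))) \<partial>\<Gamma>) =
    (\<integral>\<^sup>+z. ennreal (c' * P) * ennreal (\<bar>g z\<bar> * \<phi> z) + ennreal \<delta> * ennreal (\<bar>g z\<bar> * h z) +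
      ennreal M * ennreal (\<bar>g z\<bar> * (h z * iC z)) \<partial>\<Gamma>)"
    using consts_nonneg M_nonneg iB_iC(3) by (simp add: ennreal_plus ennreal_mult)
  also have "\<dots> = ennreal (c' * P) * (\<integral>\<^sup>+z. ennreal (\<bar>g z\<bar> * \<phi> z) \<partial>\<Gamma>) + ennreal \<delta> * (\<integral>\<^sup>+z. ennreal (\<bar>g z\<bar> * h z) \<partial>\<Gamma>) +
      ennreal M * (\<integral>\<^sup>+z. ennreal (\<bar>g z\<bar> * (h z * iC z)) \<partial>\<Gamma>)"
    by (simp add: nn_integral_add nn_integral_cmult)
  also have "\<dots> \<le> ennreal (c' * P) * ennreal (sqrt (second_const M) * E) + ennreal \<delta> * ennreal (sqrt moment_const) +
      ennreal M * ennreal (moment_const * tl)"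
    by (intro add_mono mult_left_mono nn_g\<phi> nn_gh nn_ghC) auto
  also have "\<dots> = ennreal B"
    unfolding B_def using consts_nonneg E_ge_1 second_const_pos moment_const_pos M_nonneg
    by (simp add: ennreal_plus ennreal_mult)
  finally have b: "(\<integral>\<^sup>+z. ennreal (c' * P * (\<bar>g z\<bar> * \<phi> z) + \<delta> * (\<bar>g z\<bar> * h z) + M * (\<bar>g z\<bar> * (h z * iC z))) \<partial>\<Gamma>) \<le> ennreal B" .
  have I\<Psi>: "integrable \<Gamma> (\<lambda>z. g z * \<Psi> z)" and b\<Psi>: "\<bar>\<integral>z. g z * \<Psi> z \<partial>\<Gamma>\<bar> \<le> B"
    using B by (intro integral_abs_le_nn[OF _ le b]; simp)+
  define D where "D = (\<lambda>z. g z * exp (r z) * iB z - (g z + g z * S z))"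
  have ID: "integrable \<Gamma> D"
    unfolding D_def by (intro Bochner_Integration.integrable_diff Bochner_Integration.integrable_add int_gB int_g int_gS)
  have "(\<integral>z. D z - g z * \<Psi> z \<partial>\<Gamma>) = 0"
  proof (rule integral_std_gauss_odd)
    show "(\<lambda>z. D z - g z * \<Psi> z) \<in> borel_measurable (lebesgue_Rd d)"
      unfolding D_def by measurable
    fix z assume z: "z \<in> Rd d"
    \<comment> \<open>All that separates the difference from \<open>g * \<Psi>\<close> is
      \<open>g\<close> times an even function, the ball being symmetric, so its integral is
      0.\<close>
    have eq: "D w - g w * \<Psi> w = g w * iB w * (1 + (S w)\<^sup>2 / 2 - Q w) - g w" for w
      by (auto simp: D_def \<Psi>_def iB_def iC_def algebra_simps)
    show "D (reflect d z) - g (reflect d z) * \<Psi> (reflect d z) = - (D z - g z * \<Psi> z)"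
      unfolding eq using z by (simp add: g_odd Q_even S_reflect)
  qed
  then have "(\<integral>z. D z \<partial>\<Gamma>) = (\<integral>z. g z * \<Psi> z \<partial>\<Gamma>)"
    using ID I\<Psi> by simp
  moreover have "(\<integral>z. D z \<partial>\<Gamma>) = (\<integral>z. g z * exp (r z) * iB z \<partial>\<Gamma>) - tgt"
  proof -
    have "tgt = (\<integral>z. g z + g z * S z \<partial>\<Gamma>)" by (simp add: tgt_def distrib_left)
    then show ?thesis
      unfolding D_def by (simp only:) (intro Bochner_Integration.integral_diff Bochner_Integration.integrable_add int_gB int_g int_gS)
  qed
  ultimately show ?thesis using b\<Psi> by (simp add: B_def)
qed


lemma tl_le: "exp (- c0 * s * real d / 2) \<le> tl"
proof -
  have "0 \<le> c0 * s * real d" using c0 s_ge by simp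
  then show ?thesis unfolding tl_def exp_le_cancel_iff by simp
qed

lemma int_iC: "integrable \<Gamma> iC" "\<bar>\<integral>z. iC z \<partial>\<Gamma>\<bar> \<le> exp (- c0 * s * real d / 2)"
  using iB_iC by (intro integral_abs_le_nn[OF _ _ nn_iC]; simp)+

lemma int_iB: "integrable \<Gamma> iB"
  using iB_iC by (intro integrable_const_bound[of _ 1]) auto

lemma int_iBS: "integrable \<Gamma> (\<lambda>z. iB z * S z)" "(\<integral>z. iB z * S z \<partial>\<Gamma>) = 0"
proof -
  have "\<bar>iB z * S z\<bar> \<le> M * h z" for z
  proof -
    have "\<bar>iB z * S z\<bar> \<le> 1 * \<bar>S z\<bar>"
      unfolding abs_mult using iB_iC[of z] by (intro mult_right_mono) auto
    also have "\<dots> \<le> M * h z"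
      using S_le_h[of z] mult_right_mono[OF e3M h_nonneg[of z]] by linarith
    finally show ?thesis .
  qed
  moreover have "(\<integral>\<^sup>+z. ennreal (M * h z) \<partial>\<Gamma>) \<le> ennreal (M * moment_const)"
    using h_moment_le[of 1] M_nonneg by (intro nn_integral_cmult_le) auto
  ultimately show "integrable \<Gamma> (\<lambda>z. iB z * S z)"
    using M_nonneg moment_const_pos
    by (intro integral_abs_le_nn(1)[where F = "\<lambda>z. M * h z" and C = "M * moment_const"]) auto
  show "(\<integral>z. iB z * S z \<partial>\<Gamma>) = 0"
    by (intro integral_std_gauss_odd) (auto simp: S_reflect)
qed

text \<open>\<open>S\<close> integrates to 0 over the symmetric ball, so the first-order term
  disappears and the error has order \<open>L\<close>; the \<open>tl\<close> is the Gaussian mass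
  outside.\<close>

lemma den_local:
  "\<bar>(\<integral>z. exp (r z) * iB z \<partial>\<Gamma>) - 1\<bar> \<le> c' * L * (sqrt (second_const M) * E) + tl"
proof -
  define err where "err = (\<lambda>z. iB z * (exp (r z) - 1 - S z))"
  have [measurable]: "err \<in> borel_measurable (lebesgue_Rd d)"
    unfolding err_def by measurable
  have le: "\<bar>err z\<bar> \<le> c' * L * \<phi> z" if "z \<in> space \<Gamma>" for z
    using pointwise(1)[of z] that iB_iC(2)[of z] by (simp add: err_def abs_mult)
  have b: "(\<integral>\<^sup>+z. ennreal (c' * L * \<phi> z) \<partial>\<Gamma>) \<le> ennreal (c' * L * (sqrt (second_const M) * E))"
    using consts_nonneg by (intro nn_integral_cmult_le nn_1\<phi>) auto
  have I: "integrable \<Gamma> err" and B: "\<bar>\<integral>z. err z \<partial>\<Gamma>\<bar> \<le> c' * L * (sqrt (second_const M) * E)"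
    using consts_nonneg second_const_pos E_ge_1 by (intro integral_abs_le_nn[OF _ le b]; simp)+
  have "exp (r z) * iB z = err z + iB z * S z + (1 - iC z)" for z
    by (auto simp: err_def iB_def iC_def)
  then have "(\<integral>z. exp (r z) * iB z \<partial>\<Gamma>) = (\<integral>z. err z \<partial>\<Gamma>) + (\<integral>z. iB z * S z \<partial>\<Gamma>) + (1 - (\<integral>z. iC z \<partial>\<Gamma>))"
    using I int_iBS(1) int_iC(1) by (simp add: prob_space[simplified])
  then show ?thesis
    using B int_iBS(2) int_iC(2) tl_le by (simp add: abs_le_iff)
qed

lemma m2_moment: "integrable \<Gamma> (\<lambda>z. (m z)\<^sup>2)" "\<bar>\<integral>z. (m z)\<^sup>2 \<partial>\<Gamma>\<bar> \<le> 48"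
proof -
  have le: "(m z)\<^sup>2 \<le> 32 * exp (m z / 4)" for z
    using sqnorm_sq_le_exp[OF d, of z] d by (simp add: m_def power_divide field_simps)
  have "(\<integral>\<^sup>+z. ennreal (32 * exp (m z / 4)) \<partial>\<Gamma>) \<le> ennreal (32 * (3 / 2))"
    by (intro nn_integral_cmult_le exp_m_moment) auto
  then have b: "(\<integral>\<^sup>+z. ennreal (32 * exp (m z / 4)) \<partial>\<Gamma>) \<le> ennreal 48" by simp
  show "integrable \<Gamma> (\<lambda>z. (m z)\<^sup>2)" "\<bar>\<integral>z. (m z)\<^sup>2 \<partial>\<Gamma>\<bar> \<le> 48"
    using le by (intro integral_abs_le_nn[OF _ _ b]; simp)+
qed

text \<open>\<open>den_local\<close> gives no lower bound when its error exceeds 1, which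
  \<open>E\<close> may cause. Here the bound depends on \<open>M\<close> alone.\<close>

lemma den_lower: "exp (- 4 * M\<^sup>2) / 2 \<le> (\<integral>z. exp (r z) * iB z \<partial>\<Gamma>)"
proof -
  \<comment> \<open>\<open>exp\<close> is bounded below by its tangent at \<open>- 4 M\<^sup>2\<close>, in place of Jensen's inequality.\<close>
  define a where "a = 4 * M\<^sup>2"
  have a: "a \<ge> 0" by (simp add: a_def)
  have half: "(\<integral>z. iC z \<partial>\<Gamma>) \<le> 1 / 2"
  proof -
    have "8 * 1 \<le> (c0 * s) * real d"
      using c0s d by (intro mult_mono) auto
    then have "exp (- c0 * s * real d / 2) \<le> exp (- 1 :: real)"
      by simp
    also have "\<dots> \<le> 1 / 2"
      using exp_ge_add_one_self[of "1 :: real"] by (simp add: exp_minus field_simps)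
    finally show ?thesis using int_iC(2) by linarith
  qed
  have "exp (- a) * ((1 + a) * iB z + iB z * S z - M\<^sup>2 / 24 * (m z)\<^sup>2) \<le> exp (r z) * iB z" if z: "z \<in> space \<Gamma>" for z
  proof (cases "iB z = 0")
    case False
    then have B: "iB z = 1" by (auto simp: iB_def split: if_splits)
    have "e4\<^sup>2 * (m z)\<^sup>2 \<le> M\<^sup>2 * (m z)\<^sup>2"
      using e4 by (intro mult_right_mono power_mono) auto
    then have "S z - M\<^sup>2 / 24 * (m z)\<^sup>2 \<le> r z"
      using abs_le_D2[OF r_le[of z, OF _ False]] z by simp
    then have "(1 + a) + S z - M\<^sup>2 / 24 * (m z)\<^sup>2 \<le> exp (r z + a)"
      using exp_ge_add_one_self[of "r z + a"] by linarith
    then have "exp (- a) * ((1 + a) + S z - M\<^sup>2 / 24 * (m z)\<^sup>2) \<le> exp (- a) * exp (r z + a)"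
      by (intro mult_left_mono) auto
    then show ?thesis by (simp add: B exp_add[symmetric])
  qed simp
  then have "(\<integral>z. exp (- a) * ((1 + a) * iB z + iB z * S z - M\<^sup>2 / 24 * (m z)\<^sup>2) \<partial>\<Gamma>) \<le> (\<integral>z. exp (r z) * iB z \<partial>\<Gamma>)"
    using int_iB int_iBS(1) m2_moment(1) by (intro integral_mono int_B) auto
  moreover have "(\<integral>z. exp (- a) * ((1 + a) * iB z + iB z * S z - M\<^sup>2 / 24 * (m z)\<^sup>2) \<partial>\<Gamma>) =
    exp (- a) * ((1 + a) * (\<integral>z. iB z \<partial>\<Gamma>) - M\<^sup>2 / 24 * (\<integral>z. (m z)\<^sup>2 \<partial>\<Gamma>))"
    using int_iB int_iBS m2_moment(1) by simp
  moreover have "exp (- a) * (1 / 2) \<le> exp (- a) * ((1 + a) * (\<integral>z. iB z \<partial>\<Gamma>) - M\<^sup>2 / 24 * (\<integral>z. (m z)\<^sup>2 \<partial>\<Gamma>))"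
  proof (rule mult_left_mono)
    have "iB z = 1 - iC z" for z by (simp add: iB_def iC_def)
    then have "(\<integral>z. iB z \<partial>\<Gamma>) = 1 - (\<integral>z. iC z \<partial>\<Gamma>)"
      using int_iC(1) by (simp add: prob_space[simplified])
    then have "(1 + a) * (1 / 2) \<le> (1 + a) * (\<integral>z. iB z \<partial>\<Gamma>)"
      using half a by (intro mult_left_mono) auto
    \<comment> \<open>The mean of \<open>(m z)\<^sup>2\<close> is at most 48, so this loss is at
      most \<open>2 * M\<^sup>2\<close>; the tangent point \<open>a = 4 * M\<^sup>2\<close> makes
      \<open>(1 + a) / 2 - 2 * M\<^sup>2\<close> equal to 1/2.\<close>
    moreover have "M\<^sup>2 / 24 * (\<integral>z. (m z)\<^sup>2 \<partial>\<Gamma>) \<le> M\<^sup>2 / 24 * 48"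
      using m2_moment(2) by (intro mult_left_mono) auto
    ultimately show "1 / 2 \<le> (1 + a) * (\<integral>z. iB z \<partial>\<Gamma>) - M\<^sup>2 / 24 * (\<integral>z. (m z)\<^sup>2 \<partial>\<Gamma>)"
      unfolding a_def by (simp add: algebra_simps)
  qed simp
  ultimately have "exp (- a) * (1 / 2) \<le> (\<integral>z. exp (r z) * iB z \<partial>\<Gamma>)" by linarith
  then show ?thesis by (simp add: a_def)
qed

text \<open>Stated for a general \<open>f\<close> to serve the numerator, with \<open>f = g\<close>
  and \<open>a = ag\<close>, and the denominator, with \<open>f\<close> and \<open>a\<close> equal
  to 1.\<close>

lemma split_at_ball:
  assumes f [measurable]: "f \<in> borel_measurable (lebesgue_Rd d)" and a: "a \<ge> 0"
    and growth: "\<And>z. z \<in> Rd d \<Longrightarrow> \<bar>f z\<bar> \<le> a * exp (c0 * sqrt (real d) * sqrt (sqnorm d z) / 2)"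
    and int: "integrable \<Gamma> (\<lambda>z. f z * exp (r z) * iB z)"
  shows "(\<integral>z. indicator \<Theta> z * f z * exp (r z) \<partial>\<Gamma>) =
      (\<integral>z. f z * exp (r z) * iB z \<partial>\<Gamma>) + (\<integral>z. indicator \<Theta> z * iC z * f z * exp (r z) \<partial>\<Gamma>)"
    and "\<bar>\<integral>z. indicator \<Theta> z * iC z * f z * exp (r z) \<partial>\<Gamma>\<bar> \<le> a * tl"
proof -
  define F where "F = (\<lambda>z. indicator \<Theta> z * iC z * exp (c0 * sqrt (real d) * sqrt (sqnorm d z) / 2) * exp (r z))"
  have [measurable]: "F \<in> borel_measurable (lebesgue_Rd d)"
    unfolding F_def by measurable
  have le: "\<bar>indicator \<Theta> z * iC z * f z * exp (r z)\<bar> \<le> a * F z" if "z \<in> space \<Gamma>" for z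
  proof -
    have "indicator \<Theta> z * iC z * exp (r z) * \<bar>f z\<bar> \<le> indicator \<Theta> z * iC z * exp (r z) *
      (a * exp (c0 * sqrt (real d) * sqrt (sqnorm d z) / 2))"
      using that growth[of z] by (intro mult_left_mono) (auto simp: iB_iC)
    then show ?thesis by (simp add: F_def abs_mult iB_iC mult_ac)
  qed
  have b: "(\<integral>\<^sup>+z. ennreal (a * F z) \<partial>\<Gamma>) \<le> ennreal (a * tl)"
    unfolding F_def using a by (intro nn_integral_cmult_le nn_tail) auto
  have I: "integrable \<Gamma> (\<lambda>z. indicator \<Theta> z * iC z * f z * exp (r z))"
    and B: "\<bar>\<integral>z. indicator \<Theta> z * iC z * f z * exp (r z) \<partial>\<Gamma>\<bar> \<le> a * tl"
    using a consts_nonneg by (intro integral_abs_le_nn[OF _ le b]; simp)+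
  show "\<bar>\<integral>z. indicator \<Theta> z * iC z * f z * exp (r z) \<partial>\<Gamma>\<bar> \<le> a * tl" by (rule B)
  have "indicator \<Theta> z * f z * exp (r z) = f z * exp (r z) * iB z + indicator \<Theta> z * iC z * f z * exp (r z)"
    if "z \<in> space \<Gamma>" for z
    using that ball[of z] by (auto simp: iB_def iC_def indicator_def)
  then show "(\<integral>z. indicator \<Theta> z * f z * exp (r z) \<partial>\<Gamma>) =
      (\<integral>z. f z * exp (r z) * iB z \<partial>\<Gamma>) + (\<integral>z. indicator \<Theta> z * iC z * f z * exp (r z) \<partial>\<Gamma>)"
    by (simp only: Bochner_Integration.integral_add[OF int I, symmetric] cong: Bochner_Integration.integral_cong)
qed

lemma num_split: "num = (\<integral>z. g z * exp (r z) * iB z \<partial>\<Gamma>) + (\<integral>z. indicator \<Theta> z * iC z * g z * exp (r z) \<partial>\<Gamma>)"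
  and num_tail: "\<bar>\<integral>z. indicator \<Theta> z * iC z * g z * exp (r z) \<partial>\<Gamma>\<bar> \<le> ag * tl"
  unfolding num_def by (rule split_at_ball[OF g ag g_growth int_gB]; assumption)+

lemma den_split: "den = (\<integral>z. exp (r z) * iB z \<partial>\<Gamma>) + (\<integral>z. indicator \<Theta> z * iC z * exp (r z) \<partial>\<Gamma>)"
  and den_tail: "0 \<le> (\<integral>z. indicator \<Theta> z * iC z * exp (r z) \<partial>\<Gamma>)" "(\<integral>z. indicator \<Theta> z * iC z * exp (r z) \<partial>\<Gamma>) \<le> tl"
proof -
  have "\<bar>1 :: real\<bar> \<le> 1 * exp (c0 * sqrt (real d) * sqrt (sqnorm d z) / 2)" for z
    using c0 by simp
  from split_at_ball[where f = "\<lambda>_. 1" and a = 1, OF _ _ this]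
  show "den = (\<integral>z. exp (r z) * iB z \<partial>\<Gamma>) + (\<integral>z. indicator \<Theta> z * iC z * exp (r z) \<partial>\<Gamma>)"
    "(\<integral>z. indicator \<Theta> z * iC z * exp (r z) \<partial>\<Gamma>) \<le> tl"
    using int_B by (simp_all add: den_def)
  show "0 \<le> (\<integral>z. indicator \<Theta> z * iC z * exp (r z) \<partial>\<Gamma>)"
    by (intro integral_nonneg_AE) (auto simp: iB_iC)
qed

lemma den_pos: "0 < den"
  using den_lower den_split den_tail(1) exp_gt_zero[of "- 4 * M\<^sup>2"] by linarith

text \<open>The difference is written as \<open>(A + B - tgt * (C + D)) / den\<close>, with the
  local errors \<open>A\<close>, \<open>C\<close> and the tails \<open>B\<close>, \<open>D\<close>
  of numerator and denominator. Since \<open>tgt\<close> is at most a multiple of \<open>e3\<close>,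
  its product with the second-order error of the denominator is bounded by \<open>e3 * L\<close>,
  hence by \<open>P\<close>.\<close>

theorem core_bound:
  "\<bar>num / den - tgt\<bar> \<le> core_const M * (E * (e3\<^sup>2 + e4\<^sup>2) * (e3 + e4\<^sup>2) +
    real d powr (- 1 / 2) * e5 ^ 3 + max ag 1 * tl)"
proof -
  define A where "A = (\<integral>z. g z * exp (r z) * iB z \<partial>\<Gamma>) - tgt"
  define B where "B = (\<integral>z. indicator \<Theta> z * iC z * g z * exp (r z) \<partial>\<Gamma>)"
  define C where "C = (\<integral>z. exp (r z) * iB z \<partial>\<Gamma>) - 1"
  define D where "D = (\<integral>z. indicator \<Theta> z * iC z * exp (r z) \<partial>\<Gamma>)"
  define q where "q = sqrt (second_const M)"
  define w where "w = sqrt moment_const"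
  have nn: "q \<ge> 0" "w \<ge> 0" "E \<ge> 0" "tl \<ge> 0" "M \<ge> 0" "ag \<ge> 0" "c' \<ge> 0" "L \<ge> 0" "P \<ge> 0" "\<delta> \<ge> 0"
    using second_const_pos moment_const_pos E_ge_1 consts_nonneg M_nonneg ag by (auto simp: q_def w_def)
  have split: "num - tgt * den = A + B - tgt * (C + D)"
    unfolding num_split den_split A_def B_def C_def D_def by (simp add: algebra_simps)
  have eq: "num / den - tgt = (A + B - tgt * (C + D)) / den"
    unfolding split[symmetric] using den_pos by (simp add: diff_divide_distrib)
  have bA: "\<bar>A\<bar> \<le> c' * P * (q * E) + \<delta> * w + M * (moment_const * tl)"
    using num_local by (simp add: A_def q_def w_def)
  have bB: "\<bar>B\<bar> \<le> max ag 1 * tl"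
    using num_tail mult_right_mono[of ag "max ag 1" tl] nn by (simp add: B_def)
  have bT: "\<bar>tgt\<bar> \<le> e3 * w"
    using int_gS(2) by (simp add: tgt_eq w_def)
  have bCD: "\<bar>C + D\<bar> \<le> c' * L * (q * E) + 2 * tl"
    using den_local den_tail by (simp add: C_def D_def q_def abs_le_iff)
  have "\<bar>tgt * (C + D)\<bar> \<le> e3 * w * (c' * L * (q * E) + 2 * tl)"
    unfolding abs_mult using nn e3 by (intro mult_mono bT bCD) auto
  also have "\<dots> = w * c' * (e3 * L) * (q * E) + e3 * (2 * w * tl)"
    by (simp add: algebra_simps)
  also have "\<dots> \<le> w * c' * P * (q * E) + M * (2 * w * tl)"
  proof (intro add_mono mult_right_mono mult_left_mono)
    have "L * e3 \<le> L * (e3 + e4\<^sup>2)" using nn by (intro mult_left_mono) auto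
    then show "e3 * L \<le> P" by (simp add: P_def mult.commute)
  qed (use nn e3M in auto)
  finally have bTCD: "\<bar>tgt * (C + D)\<bar> \<le> w * c' * P * (q * E) + M * (2 * w * tl)" .
  define R where "R = c' * q * (1 + w) * (E * P) + w * \<delta> + (M * moment_const + 1 + 2 * (M * w)) * (max ag 1 * tl)"
  have tm: "tl \<le> max ag 1 * tl" using mult_right_mono[of 1 "max ag 1" tl] nn by simp
  have "\<bar>A + B - tgt * (C + D)\<bar> \<le> \<bar>A\<bar> + \<bar>B\<bar> + \<bar>tgt * (C + D)\<bar>" by linarith
  also have "\<dots> \<le> (c' * P * (q * E) + \<delta> * w + M * (moment_const * tl)) + max ag 1 * tl +
    (w * c' * P * (q * E) + M * (2 * w * tl))"
    by (intro add_mono bA bB bTCD)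
  also have "\<dots> = c' * q * (1 + w) * (E * P) + w * \<delta> + (M * moment_const * tl + max ag 1 * tl + 2 * (M * w) * tl)"
    by (simp add: algebra_simps)
  also have "\<dots> \<le> R"
  proof -
    have "M * moment_const * tl \<le> M * moment_const * (max ag 1 * tl)"
      using nn moment_const_pos by (intro mult_left_mono tm) auto
    moreover have "2 * (M * w) * tl \<le> 2 * (M * w) * (max ag 1 * tl)"
      using nn by (intro mult_left_mono tm) auto
    ultimately show ?thesis unfolding R_def by (simp add: distrib_right)
  qed
  finally have num: "\<bar>A + B - tgt * (C + D)\<bar> \<le> R" .
  have R0: "R \<ge> 0" using num by linarith
  have "exp (- 4 * M\<^sup>2) / 2 \<le> den"
    using den_lower den_split den_tail(1) by linarith
  then have "inverse den \<le> inverse (exp (- 4 * M\<^sup>2) / 2)"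
    by (intro le_imp_inverse_le) auto
  also have "\<dots> = 2 * exp (4 * M\<^sup>2)"
    by (rule inverse_unique) (simp add: exp_add[symmetric])
  finally have inv: "inverse den \<le> 2 * exp (4 * M\<^sup>2)" .
  have "\<bar>num / den - tgt\<bar> = \<bar>A + B - tgt * (C + D)\<bar> * inverse den"
    unfolding eq using den_pos by (simp add: divide_inverse abs_mult)
  also have "\<dots> \<le> R * (2 * exp (4 * M\<^sup>2))"
    using num inv den_pos R0 by (intro mult_mono) auto
  also have "R \<le> (c' * q * (1 + w) + w + (M * moment_const + 1 + 2 * (M * w))) * (E * P + \<delta> + max ag 1 * tl)"
  proof -
    have "a * x + b * y + c * z \<le> (a + b + c) * (x + y + z)"
      if "a \<ge> 0" "b \<ge> 0" "c \<ge> 0" "x \<ge> 0" "y \<ge> 0" "z \<ge> 0" for a b c x y z :: real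
    proof -
      have "0 \<le> a * y + a * z + b * x + b * z + c * x + c * y"
        using that by (intro add_nonneg_nonneg mult_nonneg_nonneg) auto
      then show ?thesis by (simp add: algebra_simps)
    qed
    then show ?thesis
      unfolding R_def using nn moment_const_pos by simp
  qed
  finally have "\<bar>num / den - tgt\<bar> \<le> (c' * q * (1 + w) + w + (M * moment_const + 1 + 2 * (M * w))) *
      (E * P + \<delta> + max ag 1 * tl) * (2 * exp (4 * M\<^sup>2))"
    by simp
  also have "\<dots> = core_const M * (E * P + \<delta> + max ag 1 * tl)"
    unfolding core_const_def c'_def q_def w_def by (simp only: mult_ac)
  also have "E * P + \<delta> = E * (e3\<^sup>2 + e4\<^sup>2) * (e3 + e4\<^sup>2) + real d powr (- 1 / 2) * e5 ^ 3"
    by (simp only: P_def L_def \<delta>_def mult.assoc mult.commute[of "e5 ^ 3"])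
  finally show ?thesis .
qed

end


section \<open>Taylor expansion along segments\<close>

text \<open>A basic open set of the product topology yields one radius per coordinate. Beyond
  \<open>d\<close> all points of \<open>Rd d\<close> take the value \<open>undefined\<close>, so
  only finitely many radii matter and their minimum is positive.\<close>

lemma openin_Rd_box:
  assumes op: "openin (top_of_set (Rd d)) \<Theta>" and p: "p \<in> \<Theta>"
  obtains e where "e > 0" "\<And>y. y \<in> Rd d \<Longrightarrow> (\<And>i. i < d \<Longrightarrow> \<bar>y i - p i\<bar> < e) \<Longrightarrow> y \<in> \<Theta>"
proof -
  from op obtain T where T: "open T" "\<Theta> = Rd d \<inter> T" by (auto simp: openin_open)
  have "openin (product_topology (\<lambda>_. euclidean) UNIV) T"
    using T(1) by (simp add: open_fun_def)
  moreover have "p \<in> T" using p T by auto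
  ultimately obtain X where X: "p \<in> (\<Pi>\<^sub>E i\<in>UNIV. X i)" "\<And>i. open (X i)" "(\<Pi>\<^sub>E i\<in>UNIV. X i) \<subseteq> T"
    using product_topology_open_contains_basis[of "\<lambda>_. euclidean" UNIV T p] by auto
  have "\<exists>e>0. \<forall>y. \<bar>y - p i\<bar> < e \<longrightarrow> y \<in> X i" for i
    using X(1) X(2)[of i] by (force simp: open_dist dist_real_def)
  then obtain e where e: "\<And>i. e i > 0" "\<And>i y. \<bar>y - p i\<bar> < e i \<Longrightarrow> y \<in> X i" by metis
  define e' where "e' = Min (insert 1 (e ` {..<d}))"
  have "e' > 0" using e(1) by (simp add: e'_def)
  moreover have "y \<in> \<Theta>" if y: "y \<in> Rd d" "\<And>i. i < d \<Longrightarrow> \<bar>y i - p i\<bar> < e'" for y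
  proof -
    have "y i \<in> X i" for i
    proof (cases "i < d")
      case True
      then have "e' \<le> e i" by (simp add: e'_def)
      then show ?thesis using y(2)[OF True] e(2) by (meson less_le_trans)
    next
      case False
      then have "y i = p i" using y(1) p T(2) by (auto simp: PiE_def extensional_def)
      then show ?thesis using X(1) by auto
    qed
    then show ?thesis using X(3) y(1) T(2) by auto
  qed
  ultimately show ?thesis using that by blast
qed

lemma continuous_on_Rd_box:
  fixes G :: "point \<Rightarrow> real"
  assumes op: "openin (top_of_set (Rd d)) \<Theta>" and p: "p \<in> \<Theta>" and G: "continuous_on \<Theta> G" and e: "e > 0"
  obtains \<delta> where "\<delta> > 0"
    "\<And>y. y \<in> Rd d \<Longrightarrow> (\<And>i. i < d \<Longrightarrow> \<bar>y i - p i\<bar> < \<delta>) \<Longrightarrow> y \<in> \<Theta> \<and> \<bar>G y - G p\<bar> < e"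
proof -
  have "openin (top_of_set \<Theta>) (\<Theta> \<inter> G -` ball (G p) e)"
    using G by (rule continuous_openin_preimage_gen) simp
  then have "openin (top_of_set (Rd d)) (\<Theta> \<inter> G -` ball (G p) e)"
    using op openin_trans by blast
  moreover have "p \<in> \<Theta> \<inter> G -` ball (G p) e" using p e by simp
  ultimately obtain \<delta> where "\<delta> > 0"
    "\<And>y. y \<in> Rd d \<Longrightarrow> (\<And>i. i < d \<Longrightarrow> \<bar>y i - p i\<bar> < \<delta>) \<Longrightarrow> y \<in> \<Theta> \<inter> G -` ball (G p) e"
    by (rule openin_Rd_box) blast
  then show ?thesis
    using that by (auto simp: dist_real_def abs_minus_commute)
qed

lemma MVT_segment:
  fixes f f' :: "real \<Rightarrow> real"
  assumes "\<And>x. \<bar>x - a\<bar> \<le> \<bar>b - a\<bar> \<Longrightarrow> (f has_real_derivative f' x) (at x)"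
  shows "\<exists>x. \<bar>x - a\<bar> \<le> \<bar>b - a\<bar> \<and> f b - f a = (b - a) * f' x"
proof (cases a b rule: linorder_cases)
  case less
  then have "\<exists>z. a < z \<and> z < b \<and> f b - f a = (b - a) * f' z"
    using assms by (intro MVT2) auto
  then show ?thesis by force
next
  case greater
  then have "\<exists>z. b < z \<and> z < a \<and> f a - f b = (a - b) * f' z"
    using assms by (intro MVT2) auto
  then obtain z where z: "b < z" "z < a" "f a - f b = (a - b) * f' z" by blast
  have "f b - f a = (b - a) * f' z"
    using z(3) by (simp add: algebra_simps)
  then show ?thesis using z(1,2) by (intro exI[of _ z]) auto
qed auto

definition ray :: "nat \<Rightarrow> point \<Rightarrow> point \<Rightarrow> real \<Rightarrow> point" where
  "ray d x u t = (\<lambda>i\<in>{..<d}. x i + t * u i)"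

lemma ray_in_Rd [simp]: "ray d x u t \<in> Rd d"
  by (simp add: ray_def)

text \<open>The chain rule from continuous partial derivatives: the increment is telescoped into
  steps parallel to the axes, and each step is evaluated by the mean value theorem at a point where
  the partial derivative is close to its value at \<open>p\<close>.\<close>

lemma DERIV_along_ray:
  fixes F :: "point \<Rightarrow> real" and G :: "nat \<Rightarrow> point \<Rightarrow> real"
  assumes op: "openin (top_of_set (Rd d)) \<Theta>"
    and part: "\<And>i y. i < d \<Longrightarrow> y \<in> \<Theta> \<Longrightarrow> ((\<lambda>\<tau>. F (y(i := \<tau>))) has_real_derivative G i y) (at (y i))"
    and cont: "\<And>i. i < d \<Longrightarrow> continuous_on \<Theta> (G i)"
    and t: "ray d x u t \<in> \<Theta>"
  shows "((\<lambda>t. F (ray d x u t)) has_real_derivative (\<Sum>i<d. u i * G i (ray d x u t))) (at t)"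
  unfolding DERIV_def
proof (rule LIM_I)
  fix e :: real assume e: "0 < e"
  define p where "p = ray d x u t"
  have p: "p \<in> \<Theta>" "p \<in> Rd d" using t by (simp_all add: p_def)
  \<comment> \<open>The extra 1 keeps \<open>K\<close> positive when \<open>u\<close> vanishes and
    makes the final bound \<open>(K - 1) * (e / K)\<close> strictly smaller than
    \<open>e\<close>.\<close>
  define K where "K = 1 + (\<Sum>i<d. \<bar>u i\<bar>)"
  have K: "K \<ge> 1" "\<And>i. i < d \<Longrightarrow> \<bar>u i\<bar> \<le> K"
  proof -
    show "K \<ge> 1" by (simp add: K_def sum_nonneg)
    fix i assume "i < d"
    then have "\<bar>u i\<bar> \<le> (\<Sum>i<d. \<bar>u i\<bar>)" by (intro member_le_sum) auto
    then show "\<bar>u i\<bar> \<le> K" by (simp add: K_def)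
  qed
  have "\<exists>\<delta>>0. \<forall>y\<in>Rd d. (\<forall>j<d. \<bar>y j - p j\<bar> < \<delta>) \<longrightarrow> y \<in> \<Theta> \<and> \<bar>G i y - G i p\<bar> < e / K" if "i < d" for i
  proof -
    have "e / K > 0" using K(1) e by simp
    from continuous_on_Rd_box[OF op p(1) cont[OF that] this] show ?thesis by metis
  qed
  then obtain \<delta> where \<delta>: "\<And>i. i < d \<Longrightarrow> \<delta> i > 0"
    "\<And>i y. i < d \<Longrightarrow> y \<in> Rd d \<Longrightarrow> (\<And>j. j < d \<Longrightarrow> \<bar>y j - p j\<bar> < \<delta> i) \<Longrightarrow> y \<in> \<Theta> \<and> \<bar>G i y - G i p\<bar> < e / K"
    by metis
  define \<delta>' where "\<delta>' = Min (insert 1 (\<delta> ` {..<d}))"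
  have \<delta>': "\<delta>' > 0" "\<And>i. i < d \<Longrightarrow> \<delta>' \<le> \<delta> i" using \<delta>(1) by (simp_all add: \<delta>'_def)
  show "\<exists>s>0. \<forall>h. h \<noteq> 0 \<and> norm (h - 0) < s \<longrightarrow>
    norm ((F (ray d x u (t + h)) - F (ray d x u t)) / h - (\<Sum>i<d. u i * G i (ray d x u t))) < e"
  proof (intro exI[of _ "\<delta>' / K"] conjI allI impI)
    show "0 < \<delta>' / K" using \<delta>' K by simp
    fix h :: real assume h: "h \<noteq> 0 \<and> norm (h - 0) < \<delta>' / K"
    then have hK: "\<bar>h\<bar> * K < \<delta>'" using K(1) by (simp add: pos_less_divide_eq)
    have hu: "\<bar>h * u i\<bar> < \<delta>'" if "i < d" for i
    proof -
      have "\<bar>h\<bar> * \<bar>u i\<bar> \<le> \<bar>h\<bar> * K" using K(2)[OF that] by (intro mult_left_mono) auto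
      then show ?thesis using hK by (simp add: abs_mult)
    qed
    \<comment> \<open>A staircase from \<open>p\<close> to the displaced point: \<open>q k\<close>
      has its first k coordinates moved, so consecutive points differ in coordinate k only and stay
      in the box around \<open>p\<close>.\<close>
    define q where "q = (\<lambda>k. \<lambda>i\<in>{..<d}. if i < k then p i + h * u i else p i)"
    have q0: "q 0 = p" using p(2) by (auto simp: q_def PiE_def extensional_def)
    have qd: "q d = ray d x u (t + h)"
      by (auto simp: q_def ray_def p_def fun_eq_iff algebra_simps)
    have "\<exists>y. \<bar>G k y - G k p\<bar> < e / K \<and> F (q (Suc k)) - F (q k) = h * u k * G k y" if k: "k < d" for k
    proof -
      have box: "(q k)(k := \<tau>) \<in> \<Theta> \<and> \<bar>G k ((q k)(k := \<tau>)) - G k p\<bar> < e / K" if \<tau>: "\<bar>\<tau> - p k\<bar> \<le> \<bar>h * u k\<bar>" for \<tau>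
      proof (rule \<delta>(2)[OF k])
        show "(q k)(k := \<tau>) \<in> Rd d" using k by (auto simp: q_def PiE_def extensional_def)
        fix j assume j: "j < d"
        have "\<bar>((q k)(k := \<tau>)) j - p j\<bar> \<le> \<bar>h * u j\<bar>"
          using j k \<tau> by (auto simp: q_def)
        also have "\<dots> < \<delta>'" by (rule hu[OF j])
        also have "\<dots> \<le> \<delta> k" by (rule \<delta>'(2)[OF k])
        finally show "\<bar>((q k)(k := \<tau>)) j - p j\<bar> < \<delta> k" .
      qed
      have "((\<lambda>\<tau>. F ((q k)(k := \<tau>))) has_real_derivative G k ((q k)(k := \<tau>))) (at \<tau>)"
        if "\<bar>\<tau> - p k\<bar> \<le> \<bar>(p k + h * u k) - p k\<bar>" for \<tau>
        using part[OF k, of "(q k)(k := \<tau>)"] box[of \<tau>] that by simp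
      from MVT_segment[OF this, of "p k" "p k + h * u k"]
      obtain \<tau> where \<tau>: "\<bar>\<tau> - p k\<bar> \<le> \<bar>h * u k\<bar>"
        "F ((q k)(k := p k + h * u k)) - F ((q k)(k := p k)) = h * u k * G k ((q k)(k := \<tau>))"
        by auto
      moreover have "(q k)(k := p k + h * u k) = q (Suc k)" "(q k)(k := p k) = q k"
        using k by (auto simp: q_def fun_eq_iff)
      ultimately show ?thesis using box[of \<tau>] by auto
    qed
    then obtain y where y: "\<And>k. k < d \<Longrightarrow> \<bar>G k (y k) - G k p\<bar> < e / K"
      "\<And>k. k < d \<Longrightarrow> F (q (Suc k)) - F (q k) = h * u k * G k (y k)" by metis
    have "F (q d) - F (q 0) = (\<Sum>k<d. F (q (Suc k)) - F (q k))"
      by (rule sum_lessThan_telescope[symmetric])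
    also have "\<dots> = (\<Sum>k<d. h * (u k * G k (y k)))"
      using y(2) by (intro sum.cong) auto
    finally have "(F (q d) - F (q 0)) / h = (\<Sum>k<d. u k * G k (y k))"
      using h by (simp add: sum_distrib_left[symmetric])
    then have "(F (q d) - F (q 0)) / h - (\<Sum>k<d. u k * G k p) = (\<Sum>k<d. u k * (G k (y k) - G k p))"
      by (simp add: sum_subtractf right_diff_distrib)
    also have "\<bar>\<dots>\<bar> \<le> (\<Sum>k<d. \<bar>u k\<bar> * (e / K))"
    proof (intro sum_abs[THEN order_trans] sum_mono)
      fix k assume "k \<in> {..<d}"
      then have "\<bar>G k (y k) - G k p\<bar> \<le> e / K" using y(1)[of k] by simp
      then show "\<bar>u k * (G k (y k) - G k p)\<bar> \<le> \<bar>u k\<bar> * (e / K)"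
        unfolding abs_mult by (intro mult_left_mono) auto
    qed
    also have "\<dots> = (K - 1) * (e / K)"
      unfolding sum_distrib_right[symmetric] by (simp add: K_def)
    also have "\<dots> < e" using K(1) e by (simp add: field_simps)
    finally show "norm ((F (ray d x u (t + h)) - F (ray d x u t)) / h - (\<Sum>i<d. u i * G i (ray d x u t))) < e"
      by (simp add: qd q0 p_def)
  qed
qed

lemma C_k_on_DERIV:
  assumes "C_k_on d k \<Theta> f" "set is \<subseteq> {..<d}" "length is < k" "i < d" "y \<in> \<Theta>"
  shows "((\<lambda>\<tau>. pderivs is f (y(i := \<tau>))) has_real_derivative pderivs (i # is) f y) (at (y i))"
  using assms by (simp add: C_k_on_def DERIV_deriv_iff_field_differentiable)

lemma C_k_on_continuous:
  "C_k_on d k \<Theta> f \<Longrightarrow> set is \<subseteq> {..<d} \<Longrightarrow> length is \<le> k \<Longrightarrow> continuous_on \<Theta> (pderivs is f)"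
  by (auto simp: C_k_on_def)

definition index_lists :: "nat \<Rightarrow> nat \<Rightarrow> nat list set" where
  "index_lists d k = {is. set is \<subseteq> {..<d} \<and> length is = k}"

lemma finite_index_lists [simp]: "finite (index_lists d k)"
  unfolding index_lists_def by (rule finite_lists_length_eq) simp

lemma index_lists_0: "index_lists d 0 = {[]}"
  by (auto simp: index_lists_def)

lemma sum_index_lists_Suc:
  "(\<Sum>is\<in>index_lists d (Suc k). f is) = (\<Sum>i<d. \<Sum>is\<in>index_lists d k. f (i # is))"
proof -
  have "index_lists d (Suc k) = (\<lambda>(i, is). i # is) ` ({..<d} \<times> index_lists d k)"
    by (auto simp: index_lists_def length_Suc_conv image_iff)
  moreover have "inj_on (\<lambda>(i, is). i # is) ({..<d} \<times> index_lists d k)"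
    by (auto simp: inj_on_def)
  ultimately show ?thesis
    by (simp add: sum.reindex sum.cartesian_product case_prod_unfold)
qed

lemma tensor_inner_eq: "tensor_inner d k T S = (\<Sum>is\<in>index_lists d k. T is * S is)"
  by (simp add: tensor_inner_def index_lists_def)

lemma tensor_inner_0: "tensor_inner d 0 T (tensor_power u) = T []"
  by (simp add: tensor_inner_eq index_lists_0 tensor_power_def)

lemma tensor_inner_2: "tensor_inner d 2 (nabla f x) (tensor_power u) = quad_form d (hessian f x) u"
  by (simp add: tensor_inner_eq numeral_2_eq_2 sum_index_lists_Suc index_lists_0 tensor_power_def
      quad_form_def nabla_def hessian_def mult_ac del: pderivs.simps)

lemma tensor_inner_3:
  "tensor_inner d 3 T (tensor_power u) = cubic d (\<lambda>i j k. T [i, j, k]) u"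
  by (simp add: tensor_inner_eq numeral_3_eq_3 sum_index_lists_Suc index_lists_0 tensor_power_def
      trilin_def mult_ac)

text \<open>Differentiation puts a new index in front of the list, just as \<open>pderivs\<close>
  does, so the sum over lists of length \<open>Suc j\<close> arises directly.\<close>

lemma DERIV_tensor_along_ray:
  assumes op: "openin (top_of_set (Rd d)) \<Theta>" and f: "C_k_on d n \<Theta> f" and j: "j < n"
    and t: "ray d x u t \<in> \<Theta>"
  shows "((\<lambda>t. tensor_inner d j (nabla f (ray d x u t)) (tensor_power u)) has_real_derivative
    tensor_inner d (Suc j) (nabla f (ray d x u t)) (tensor_power u)) (at t)"
proof -
  have "((\<lambda>t. pderivs is f (ray d x u t)) has_real_derivative
    (\<Sum>i<d. u i * pderivs (i # is) f (ray d x u t))) (at t)" if "is \<in> index_lists d j" for "is"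
  proof (rule DERIV_along_ray[OF op _ _ t])
    show "((\<lambda>\<tau>. pderivs is f (y(i := \<tau>))) has_real_derivative pderivs (i # is) f y) (at (y i))"
      if "i < d" "y \<in> \<Theta>" for i y
      using that j \<open>is \<in> _\<close> by (intro C_k_on_DERIV[OF f]) (auto simp: index_lists_def)
    show "continuous_on \<Theta> (pderivs (i # is) f)" if "i < d" for i
      using that j \<open>is \<in> _\<close> by (intro C_k_on_continuous[OF f]) (auto simp: index_lists_def)
  qed
  then have "((\<lambda>t. \<Sum>is\<in>index_lists d j. pderivs is f (ray d x u t) * tensor_power u is) has_real_derivative
    (\<Sum>is\<in>index_lists d j. (\<Sum>i<d. u i * pderivs (i # is) f (ray d x u t)) * tensor_power u is)) (at t)"
    by (intro DERIV_sum DERIV_cmult_right)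
  moreover have "(\<Sum>is\<in>index_lists d j. (\<Sum>i<d. u i * pderivs (i # is) f (ray d x u t)) * tensor_power u is) =
    tensor_inner d (Suc j) (nabla f (ray d x u t)) (tensor_power u)"
  proof -
    have "(\<Sum>is\<in>index_lists d j. (\<Sum>i<d. u i * pderivs (i # is) f (ray d x u t)) * tensor_power u is) =
      (\<Sum>is\<in>index_lists d j. \<Sum>i<d. nabla f (ray d x u t) (i # is) * tensor_power u (i # is))"
      unfolding sum_distrib_right
      by (intro sum.cong refl) (simp add: tensor_power_def nabla_def mult_ac del: pderivs.simps)
    also have "\<dots> = (\<Sum>i<d. \<Sum>is\<in>index_lists d j. nabla f (ray d x u t) (i # is) * tensor_power u (i # is))"
      by (rule sum.swap)
    finally show ?thesis
      by (simp only: tensor_inner_eq sum_index_lists_Suc)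
  qed
  ultimately show ?thesis by (simp add: tensor_inner_eq nabla_def)
qed

lemma Taylor_along_ray:
  assumes op: "openin (top_of_set (Rd d)) \<Theta>" and f: "C_k_on d n \<Theta> f" and n: "n > 0"
    and seg: "\<And>t. 0 \<le> t \<Longrightarrow> t \<le> 1 \<Longrightarrow> ray d x u t \<in> \<Theta>"
  obtains t where "0 \<le> t" "t \<le> 1"
    "f (ray d x u 1) = (\<Sum>j<n. tensor_inner d j (nabla f (ray d x u 0)) (tensor_power u) / fact j) +
      tensor_inner d n (nabla f (ray d x u t)) (tensor_power u) / fact n"
proof -
  define D where "D = (\<lambda>j t. tensor_inner d j (nabla f (ray d x u t)) (tensor_power u))"
  have "\<exists>t>0. t < 1 \<and> f (ray d x u 1) = (\<Sum>j<n. D j 0 / fact j * 1 ^ j) + D n t / fact n * 1 ^ n"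
    using n DERIV_tensor_along_ray[OF op f] seg
    by (intro Maclaurin) (auto simp: D_def tensor_inner_0 nabla_def)
  then obtain t where "0 < t" "t < 1" "f (ray d x u 1) = (\<Sum>j<n. D j 0 / fact j * 1 ^ j) + D n t / fact n * 1 ^ n"
    by blast
  then show ?thesis by (intro that[of t]) (simp_all add: D_def)
qed

text \<open>By openness the line through \<open>xh\<close> in direction \<open>u\<close> stays in
  \<open>\<Theta>\<close> for small parameters, where \<open>f\<close> along it has a local minimum
  at 0.\<close>

lemma gradient_zero:
  assumes op: "openin (top_of_set (Rd d)) \<Theta>" and f: "C_k_on d n \<Theta> f" and n: "n > 0"
    and xh: "xh \<in> \<Theta>" and min: "\<And>y. y \<in> \<Theta> \<Longrightarrow> f xh \<le> f y"
  shows "tensor_inner d 1 (nabla f xh) (tensor_power u) = 0"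
proof -
  have Rd: "xh \<in> Rd d" using op xh by (auto simp: openin_open)
  have r0: "ray d xh u 0 = xh"
    using Rd by (auto simp: ray_def PiE_def extensional_def fun_eq_iff)
  have D: "((\<lambda>t. f (ray d xh u t)) has_real_derivative tensor_inner d 1 (nabla f xh) (tensor_power u)) (at 0)"
    using DERIV_tensor_along_ray[OF op f n, of xh u 0] xh by (simp add: r0 tensor_inner_0 nabla_def)
  obtain e where e: "e > 0" "\<And>y. y \<in> Rd d \<Longrightarrow> (\<And>i. i < d \<Longrightarrow> \<bar>y i - xh i\<bar> < e) \<Longrightarrow> y \<in> \<Theta>"
    using openin_Rd_box[OF op xh] by blast
  define K where "K = 1 + (\<Sum>i<d. \<bar>u i\<bar>)"
  have K: "K \<ge> 1" "\<bar>u i\<bar> \<le> K" if "i < d" for i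
  proof -
    show "K \<ge> 1" by (simp add: K_def sum_nonneg)
    have "\<bar>u i\<bar> \<le> (\<Sum>i<d. \<bar>u i\<bar>)" using that by (intro member_le_sum) auto
    then show "\<bar>u i\<bar> \<le> K" by (simp add: K_def)
  qed
  have K0: "K > 0" by (simp add: K_def sum_nonneg add_pos_nonneg)
  show ?thesis
  proof (rule DERIV_local_min[OF D, of "e / K"])
    show "0 < e / K" using e K0 by simp
    show "\<forall>t. \<bar>0 - t\<bar> < e / K \<longrightarrow> f (ray d xh u 0) \<le> f (ray d xh u t)"
    proof (intro allI impI)
      fix t assume "\<bar>0 - t\<bar> < e / K"
      then have tK: "\<bar>t\<bar> * K < e" using K0 by (simp add: pos_less_divide_eq)
      have "ray d xh u t \<in> \<Theta>"
      proof (rule e(2))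
        fix i assume i: "i < d"
        have "\<bar>t\<bar> * \<bar>u i\<bar> \<le> \<bar>t\<bar> * K" using K(2)[OF i] by (intro mult_left_mono) auto
        then show "\<bar>ray d xh u t i - xh i\<bar> < e"
          using i tK by (simp add: ray_def abs_mult)
      qed simp
      then show "f (ray d xh u 0) \<le> f (ray d xh u t)"
        by (simp add: r0 min)
    qed
  qed
qed

text \<open>\<open>deriv\<close> depends only on values near the point, and near a point of the open
  set the induction hypothesis holds along each axis.\<close>

lemma pderivs_scale:
  assumes op: "openin (top_of_set (Rd d)) \<Theta>" and f: "C_k_on d k \<Theta> f"
  shows "set is \<subseteq> {..<d} \<Longrightarrow> length is \<le> k \<Longrightarrow> x \<in> \<Theta> \<Longrightarrow>
    pderivs is (\<lambda>x. c * f x) x = c * pderivs is f x"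
proof (induction "is" arbitrary: x)
  case (Cons i "is")
  then have i: "i < d" and IS: "set is \<subseteq> {..<d}" "length is < k" by auto
  have Rd: "x \<in> Rd d" using op Cons.prems by (auto simp: openin_open)
  obtain e where e: "e > 0" "\<And>y. y \<in> Rd d \<Longrightarrow> (\<And>i. i < d \<Longrightarrow> \<bar>y i - x i\<bar> < e) \<Longrightarrow> y \<in> \<Theta>"
    using openin_Rd_box[OF op Cons.prems(3)] by blast
  have "x(i := \<tau>) \<in> \<Theta>" if "dist \<tau> (x i) < e" for \<tau>
    using that e(1) Rd i by (intro e(2)) (auto simp: PiE_def extensional_def dist_real_def)
  then have "eventually (\<lambda>\<tau>. pderivs is (\<lambda>x. c * f x) (x(i := \<tau>)) = c * pderivs is f (x(i := \<tau>))) (nhds (x i))"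
    unfolding eventually_nhds_metric using e(1) IS by (auto intro!: exI[of _ e] Cons.IH)
  then have "pderivs (i # is) (\<lambda>x. c * f x) x = deriv (\<lambda>\<tau>. c * pderivs is f (x(i := \<tau>))) (x i)"
    by (simp add: deriv_cong_ev)
  also have "\<dots> = c * pderivs (i # is) f x"
    using DERIV_cmult[OF C_k_on_DERIV[OF f IS i Cons.prems(3)]] by (intro DERIV_imp_deriv)
  finally show ?case .
qed simp


section \<open>Finiteness of the tensor norms\<close>

lemma quad_form_scale: "quad_form d H (\<lambda>i. c * u i) = c\<^sup>2 * quad_form d H u"
  by (simp add: quad_form_def sum_distrib_left power2_eq_square mult_ac)

lemma mnorm_scale: "mnorm d H (\<lambda>i. c * u i) = \<bar>c\<bar> * mnorm d H u"
  by (simp add: mnorm_def quad_form_scale real_sqrt_mult)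

lemma mnorm_cong: "(\<And>i. i < d \<Longrightarrow> u i = w i) \<Longrightarrow> mnorm d H u = mnorm d H w"
  unfolding mnorm_def using quad_form_cong[of d u w H] by simp

lemma mnorm_nonneg:
  assumes "pos_def d H"
  shows "mnorm d H u \<ge> 0"
proof (cases "\<exists>i<d. u i \<noteq> 0")
  case True
  then show ?thesis using pos_def_pos[OF assms] by (force simp: mnorm_def)
qed (simp add: mnorm_def quad_form_def)

text \<open>Through the Cholesky factor the norm of \<open>u\<close> is the Euclidean norm of its
  coordinates \<open>z\<close>, and each component of \<open>u\<close> is a fixed linear combination
  of these. This makes the unit sphere of \<open>H\<close> bounded, as the suprema in
  \<open>tensor_norm\<close> require.\<close>

lemma pos_def_component_bound:
  assumes H: "pos_def d H"
  obtains C where "C \<ge> 0" "\<And>u i. i < d \<Longrightarrow> \<bar>u i\<bar> \<le> C * mnorm d H u"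
proof -
  obtain A where A: "\<And>i. i < d \<Longrightarrow> A i i > 0" "\<And>z. quad_form d H (tri_lin A z) = sqnorm d z"
    "\<And>x. \<exists>z. \<forall>i<d. tri_lin A z i = x i"
    using cholesky[OF H] by metis
  define C where "C = (\<Sum>i<d. \<Sum>j\<le>i. \<bar>A i j\<bar>)"
  have C0: "C \<ge> 0" unfolding C_def by (intro sum_nonneg) auto
  have "\<bar>u i\<bar> \<le> C * mnorm d H u" if i: "i < d" for u i
  proof -
    obtain z where z: "\<forall>i<d. tri_lin A z i = u i" using A(3) by blast
    have m: "mnorm d H u = sqrt (sqnorm d z)"
      unfolding mnorm_def A(2)[symmetric] using z by (intro arg_cong[of _ _ sqrt] quad_form_cong) simp
    have zj: "\<bar>z j\<bar> \<le> mnorm d H u" if "j < d" for j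
    proof -
      have "(z j)\<^sup>2 \<le> sqnorm d z"
        unfolding sqnorm_def using that by (intro member_le_sum) auto
      then show ?thesis unfolding m by (intro real_le_rsqrt) simp
    qed
    have "\<bar>u i\<bar> = \<bar>\<Sum>j\<le>i. A i j * z j\<bar>" using z i by (simp add: tri_lin_def)
    also have "\<dots> \<le> (\<Sum>j\<le>i. \<bar>A i j\<bar> * mnorm d H u)"
    proof (intro sum_abs[THEN order_trans] sum_mono)
      fix j assume "j \<in> {..i}"
      then show "\<bar>A i j * z j\<bar> \<le> \<bar>A i j\<bar> * mnorm d H u"
        unfolding abs_mult using i by (intro mult_left_mono zj) auto
    qed
    also have "\<dots> = (\<Sum>j\<le>i. \<bar>A i j\<bar>) * mnorm d H u" by (rule sum_distrib_right[symmetric])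
    also have "\<dots> \<le> C * mnorm d H u"
    proof (rule mult_right_mono)
      show "(\<Sum>j\<le>i. \<bar>A i j\<bar>) \<le> C"
        unfolding C_def using i by (intro member_le_sum[of i "{..<d}" "\<lambda>i. \<Sum>j\<le>i. \<bar>A i j\<bar>"] sum_nonneg) auto
    qed (simp add: mnorm_nonneg[OF H])
    finally show ?thesis .
  qed
  with C0 show ?thesis by (rule that)
qed

lemma tensor_power_abs_le:
  assumes "\<And>i. i < d \<Longrightarrow> \<bar>u i\<bar> \<le> C" "C \<ge> 0"
  shows "set is \<subseteq> {..<d} \<Longrightarrow> \<bar>tensor_power u is\<bar> \<le> C ^ length is"
proof (induction "is")
  case (Cons i "is")
  then have "\<bar>u i\<bar> * \<bar>tensor_power u is\<bar> \<le> C * C ^ length is"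
    using assms by (intro mult_mono) auto
  then show ?case by (simp add: tensor_power_def abs_mult)
qed (simp add: tensor_power_def)

lemma tensor_inner_abs_le:
  assumes "\<And>i. i < d \<Longrightarrow> \<bar>u i\<bar> \<le> C" "C \<ge> 0"
  shows "\<bar>tensor_inner d k T (tensor_power u)\<bar> \<le> (\<Sum>is\<in>index_lists d k. \<bar>T is\<bar>) * C ^ k"
  unfolding tensor_inner_eq sum_distrib_right
proof (intro sum_abs[THEN order_trans] sum_mono)
  fix "is" assume "is \<in> index_lists d k"
  then show "\<bar>T is * tensor_power u is\<bar> \<le> \<bar>T is\<bar> * C ^ k"
    unfolding abs_mult using tensor_power_abs_le[OF assms]
    by (intro mult_left_mono) (auto simp: index_lists_def)
qed

lemma tensor_norm_set_nonempty:
  assumes H: "pos_def d H" and d: "d \<ge> 1"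
  shows "{u \<in> Rd d. mnorm d H u = 1} \<noteq> {}"
proof -
  define w :: point where "w = (\<lambda>i. 1)"
  have "quad_form d H w > 0"
    using d by (intro pos_def_pos[OF H, of 0]) (auto simp: w_def)
  then have m: "mnorm d H w > 0" by (simp add: mnorm_def)
  define u where "u = (\<lambda>i\<in>{..<d}. 1 / mnorm d H w * w i)"
  have "mnorm d H u = mnorm d H (\<lambda>i. 1 / mnorm d H w * w i)"
    by (intro mnorm_cong) (simp add: u_def)
  also have "\<dots> = 1" using m by (simp only: mnorm_scale) simp
  finally have "u \<in> {u \<in> Rd d. mnorm d H u = 1}" by (simp add: u_def)
  then show ?thesis by blast
qed

text \<open>A real \<open>SUP\<close> is informative only over a set bounded above. The constant is
  uniform in \<open>T\<close>, so continuity of the entries bounds the norms over a compact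
  set.\<close>

lemma tensor_norm_bound:
  assumes H: "pos_def d H" and d: "d \<ge> 1"
  obtains C where "C \<ge> 0" "\<And>T. bdd_above ((\<lambda>u. \<bar>tensor_inner d k T (tensor_power u)\<bar>) ` {u \<in> Rd d. mnorm d H u = 1})"
    "\<And>T. tensor_norm d k H T \<le> C * (\<Sum>is\<in>index_lists d k. \<bar>T is\<bar>)"
proof -
  obtain C where C: "C \<ge> 0" "\<And>u i. i < d \<Longrightarrow> \<bar>u i\<bar> \<le> C * mnorm d H u"
    using pos_def_component_bound[OF H] by metis
  have b: "\<bar>tensor_inner d k T (tensor_power u)\<bar> \<le> C ^ k * (\<Sum>is\<in>index_lists d k. \<bar>T is\<bar>)"
    if "u \<in> {u \<in> Rd d. mnorm d H u = 1}" for u T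
    using tensor_inner_abs_le[of d u C k T] C(1) C(2)[of _ u] that by (simp add: mult.commute)
  show ?thesis
  proof (rule that[of "C ^ k"])
    show "0 \<le> C ^ k" using C by simp
    show "bdd_above ((\<lambda>u. \<bar>tensor_inner d k T (tensor_power u)\<bar>) ` {u \<in> Rd d. mnorm d H u = 1})" for T
      by (rule bdd_aboveI2[OF b])
    show "tensor_norm d k H T \<le> C ^ k * (\<Sum>is\<in>index_lists d k. \<bar>T is\<bar>)" for T
      unfolding tensor_norm_def by (rule cSUP_least[OF tensor_norm_set_nonempty[OF H d] b])
  qed
qed

lemma tensor_norm_nonneg:
  assumes H: "pos_def d H" and d: "d \<ge> 1"
  shows "0 \<le> tensor_norm d k H T"
proof -
  obtain u where u: "u \<in> {u \<in> Rd d. mnorm d H u = 1}"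
    using tensor_norm_set_nonempty[OF assms] by blast
  obtain C where "bdd_above ((\<lambda>u. \<bar>tensor_inner d k T (tensor_power u)\<bar>) ` {u \<in> Rd d. mnorm d H u = 1})"
    using tensor_norm_bound[OF assms, of k] by metis
  from cSUP_upper[OF u this] show ?thesis
    unfolding tensor_norm_def by (rule order_trans[rotated]) simp
qed

lemma tensor_inner_scale:
  "tensor_inner d k T (tensor_power (\<lambda>i. c * u i)) = c ^ k * tensor_inner d k T (tensor_power u)"
proof -
  have "tensor_power (\<lambda>i. c * u i) is = c ^ length is * tensor_power u is" for "is"
    by (induction "is") (simp_all add: tensor_power_def mult_ac)
  then show ?thesis
    unfolding tensor_inner_eq sum_distrib_left
    by (intro sum.cong refl) (simp add: index_lists_def mult_ac)
qed

lemma tensor_inner_cong: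
  assumes "\<And>i. i < d \<Longrightarrow> u i = w i"
  shows "tensor_inner d k T (tensor_power u) = tensor_inner d k T (tensor_power w)"
proof -
  have "tensor_power u is = tensor_power w is" if "set is \<subseteq> {..<d}" for "is"
    unfolding tensor_power_def using assms that by (intro arg_cong[of _ _ prod_list] map_cong refl) auto
  then show ?thesis
    unfolding tensor_inner_eq by (intro sum.cong refl) (simp add: index_lists_def)
qed

text \<open>Homogeneity reduces to the unit sphere. The vector 0 is separate; there
  \<open>k \<ge> 1\<close> makes both sides vanish.\<close>

lemma tensor_inner_le_norm:
  assumes H: "pos_def d H" and d: "d \<ge> 1" and k: "k \<ge> 1"
  shows "\<bar>tensor_inner d k T (tensor_power u)\<bar> \<le> tensor_norm d k H T * mnorm d H u ^ k"
proof (cases "mnorm d H u = 0")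
  case True
  have "u i = 0" if "i < d" for i
    using pos_def_pos[OF H that, of u] True by (cases "u i = 0") (simp_all add: mnorm_def)
  then have "\<bar>tensor_inner d k T (tensor_power u)\<bar> \<le> (\<Sum>is\<in>index_lists d k. \<bar>T is\<bar>) * 0 ^ k"
    by (intro tensor_inner_abs_le) auto
  then show ?thesis using True k by (simp add: power_0_left)
next
  case False
  then have m: "mnorm d H u > 0" using mnorm_nonneg[OF H, of u] by simp
  define w where "w = (\<lambda>i\<in>{..<d}. 1 / mnorm d H u * u i)"
  have "mnorm d H w = mnorm d H (\<lambda>i. 1 / mnorm d H u * u i)"
    by (intro mnorm_cong) (simp add: w_def)
  also have "\<dots> = 1" using m by (simp only: mnorm_scale) simp
  finally have w: "w \<in> {u \<in> Rd d. mnorm d H u = 1}" by (simp add: w_def)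
  obtain C where "bdd_above ((\<lambda>u. \<bar>tensor_inner d k T (tensor_power u)\<bar>) ` {u \<in> Rd d. mnorm d H u = 1})"
    using tensor_norm_bound[OF H d, of k] by metis
  from cSUP_upper[OF w this] have 1: "\<bar>tensor_inner d k T (tensor_power w)\<bar> \<le> tensor_norm d k H T"
    unfolding tensor_norm_def .
  have "tensor_inner d k T (tensor_power u) = tensor_inner d k T (tensor_power (\<lambda>i. mnorm d H u * w i))"
    using m by (intro tensor_inner_cong) (simp add: w_def)
  also have "\<dots> = mnorm d H u ^ k * tensor_inner d k T (tensor_power w)"
    by (rule tensor_inner_scale)
  finally have "\<bar>tensor_inner d k T (tensor_power u)\<bar> = mnorm d H u ^ k * \<bar>tensor_inner d k T (tensor_power w)\<bar>"
    using m by (simp add: abs_mult)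
  also have "\<dots> \<le> mnorm d H u ^ k * tensor_norm d k H T"
    using m by (intro mult_left_mono 1) auto
  finally show ?thesis by (simp add: mult.commute)
qed

text \<open>The ellipsoid is a closed subset of a product of compact sets: intervals below
  \<open>d\<close> and the singleton of \<open>undefined\<close> beyond, where the extensional
  functions are pinned.\<close>

lemma compact_ellipsoid:
  assumes H: "pos_def d H" and p: "p \<in> Rd d"
  shows "compact {x \<in> Rd d. mnorm d H (\<lambda>i. x i - p i) \<le> R}"
proof -
  obtain C where C: "C \<ge> 0" "\<And>u i. i < d \<Longrightarrow> \<bar>u i\<bar> \<le> C * mnorm d H u"
    using pos_def_component_bound[OF H] by metis
  define B where "B = (\<Pi>\<^sub>E i\<in>UNIV. if i < d then {p i - C * R..p i + C * R} else {undefined})"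
  have "compactin (product_topology (\<lambda>i. euclidean) UNIV) B"
    unfolding B_def by (subst compactin_PiE) (auto simp: compactin_euclidean_iff)
  then have cB: "compact B"
    by (simp add: euclidean_product_topology compactin_euclidean_iff)
  have "continuous_on UNIV (\<lambda>x. mnorm d H (\<lambda>i. x i - p i))"
    unfolding mnorm_def quad_form_def by (intro continuous_intros continuous_on_product_coordinates)
  then have cl: "closed {x. mnorm d H (\<lambda>i. x i - p i) \<le> R}"
    by (intro closed_Collect_le continuous_on_const)
  have "{x \<in> Rd d. mnorm d H (\<lambda>i. x i - p i) \<le> R} = B \<inter> {x. mnorm d H (\<lambda>i. x i - p i) \<le> R}"
  proof (intro equalityI subsetI)
    fix x assume x: "x \<in> {x \<in> Rd d. mnorm d H (\<lambda>i. x i - p i) \<le> R}"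
    have "\<bar>x i - p i\<bar> \<le> C * R" if "i < d" for i
      using C(2)[OF that, of "\<lambda>i. x i - p i"] x mult_left_mono[OF _ C(1)] by (force intro: order_trans)
    then have "x i \<in> {p i - C * R..p i + C * R}" if "i < d" for i
      using that by (fastforce simp: abs_le_iff)
    then show "x \<in> B \<inter> {x. mnorm d H (\<lambda>i. x i - p i) \<le> R}"
      using x by (auto simp: B_def PiE_def extensional_def)
  next
    fix x assume x: "x \<in> B \<inter> {x. mnorm d H (\<lambda>i. x i - p i) \<le> R}"
    have "x i = undefined" if "\<not> i < d" for i
    proof -
      have "x i \<in> (if i < d then {p i - C * R..p i + C * R} else {undefined})"
        using x unfolding B_def by (intro PiE_mem[OF IntD1[OF x[unfolded B_def]]] UNIV_I)
      then show ?thesis using that by simp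
    qed
    then show "x \<in> {x \<in> Rd d. mnorm d H (\<lambda>i. x i - p i) \<le> R}"
      using x by (auto simp: PiE_def extensional_def)
  qed
  then show ?thesis using compact_Int_closed[OF cB cl] by simp
qed

lemma tensor_norm_bounded_on_compact:
  assumes H: "pos_def d H" and d: "d \<ge> 1" and U: "compact U" "U \<subseteq> \<Theta>" and f: "C_k_on d k \<Theta> f"
  obtains B where "\<And>x. x \<in> U \<Longrightarrow> tensor_norm d k H (nabla f x) \<le> B"
proof -
  obtain C where C: "C \<ge> 0" "\<And>T. tensor_norm d k H T \<le> C * (\<Sum>is\<in>index_lists d k. \<bar>T is\<bar>)"
    using tensor_norm_bound[OF H d, of k] by metis
  have "continuous_on U (\<lambda>x. C * (\<Sum>is\<in>index_lists d k. \<bar>nabla f x is\<bar>))"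
    unfolding nabla_def
    by (intro continuous_intros continuous_on_subset[OF C_k_on_continuous[OF f] U(2)]) (auto simp: index_lists_def)
  then have "bounded ((\<lambda>x. C * (\<Sum>is\<in>index_lists d k. \<bar>nabla f x is\<bar>)) ` U)"
    using U(1) by (intro compact_imp_bounded compact_continuous_image)
  then obtain B where B: "\<And>x. x \<in> U \<Longrightarrow> \<bar>C * (\<Sum>is\<in>index_lists d k. \<bar>nabla f x is\<bar>)\<bar> \<le> B"
    by (auto simp: bounded_iff)
  show ?thesis
    using C(2) B by (intro that[of B]) (meson abs_le_D1 order_trans)
qed


section \<open>Transfer to the Laplace approximation\<close>

lemma trilin_scale: "trilin d (\<lambda>i j k. c * T i j k) x y z = c * trilin d T x y z"
  by (simp add: trilin_def sum_distrib_left mult.assoc)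

lemma trilin_swap12: "trilin d T x y z = trilin d (\<lambda>j i k. T i j k) y x z"
  unfolding trilin_def by (subst sum.swap) (intro sum.cong refl; simp add: mult_ac)

lemma trilin_swap23: "trilin d T x y z = trilin d (\<lambda>i k j. T i j k) x z y"
proof -
  have "(\<Sum>j<d. \<Sum>k<d. T i j k * x i * y j * z k) = (\<Sum>k<d. \<Sum>j<d. T i j k * x i * z k * y j)" for i
    by (subst sum.swap) (simp add: mult_ac)
  then show ?thesis by (simp only: trilin_def)
qed

lemma trilin_tri_lin1:
  obtains T' where "\<And>z y w. trilin d T (tri_lin A z) y w = trilin d T' z y w"
proof -
  define A0 where "A0 = (\<lambda>i a. if a \<le> i then A i a else 0)"
  define T' where "T' = (\<lambda>a j k. \<Sum>i<d. T i j k * A0 i a)"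
  have L: "tri_lin A z i = (\<Sum>a<d. A0 i a * z a)" if "i < d" for z i
  proof -
    have "(\<Sum>a<d. A0 i a * z a) = (\<Sum>a\<in>{a \<in> {..<d}. a \<le> i}. A i a * z a)"
      by (subst sum.inter_filter) (auto simp: A0_def intro!: sum.cong)
    also have "{a \<in> {..<d}. a \<le> i} = {..i}" using that by auto
    finally show ?thesis by (simp add: tri_lin_def)
  qed
  have "trilin d T (tri_lin A z) y w = trilin d T' z y w" for z y w
  proof -
    define \<beta> where "\<beta> = (\<lambda>i. \<Sum>j<d. \<Sum>k<d. T i j k * y j * w k)"
    have "trilin d T (tri_lin A z) y w = (\<Sum>i<d. (\<Sum>a<d. A0 i a * z a) * \<beta> i)"
      unfolding trilin_def \<beta>_def by (intro sum.cong refl) (simp add: L sum_distrib_left mult_ac)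
    also have "\<dots> = (\<Sum>a<d. \<Sum>i<d. A0 i a * z a * \<beta> i)"
      unfolding sum_distrib_right by (rule sum.swap)
    also have "\<dots> = (\<Sum>a<d. \<Sum>j<d. \<Sum>i<d. \<Sum>k<d. A0 i a * z a * (T i j k * y j * w k))"
      unfolding \<beta>_def sum_distrib_left by (intro sum.cong refl sum.swap)
    also have "\<dots> = (\<Sum>a<d. \<Sum>j<d. \<Sum>k<d. \<Sum>i<d. A0 i a * z a * (T i j k * y j * w k))"
      by (intro sum.cong refl sum.swap)
    also have "\<dots> = trilin d T' z y w"
      by (simp add: trilin_def T'_def sum_distrib_left sum_distrib_right mult_ac)
    finally show ?thesis .
  qed
  then show ?thesis by (rule that)
qed

text \<open>The substitution is carried out one slot at a time, permuting the slots so that the next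
  one comes first. Only the existence of coefficients is recorded, since the core sees the form
  through its bound.\<close>

lemma cubic_tri_lin:
  obtains T' where "\<And>z. cubic d T (tri_lin A z) = cubic d T' z"
proof -
  obtain T1 where 1: "\<And>z y w. trilin d T (tri_lin A z) y w = trilin d T1 z y w"
    by (rule trilin_tri_lin1) blast
  obtain T2 where 2: "\<And>z y w. trilin d (\<lambda>j i k. T1 i j k) (tri_lin A z) y w = trilin d T2 z y w"
    by (rule trilin_tri_lin1) blast
  obtain T3 where 3: "\<And>z y w. trilin d (\<lambda>k i j. T2 i j k) (tri_lin A z) y w = trilin d T3 z y w"
    by (rule trilin_tri_lin1) blast
  have "cubic d T (tri_lin A z) = cubic d T3 z" for z
  proof -
    have "cubic d T (tri_lin A z) = trilin d T1 z (tri_lin A z) (tri_lin A z)" by (rule 1)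
    also have "\<dots> = trilin d T2 z z (tri_lin A z)" by (subst trilin_swap12) (rule 2)
    also have "\<dots> = trilin d (\<lambda>i k j. T2 i j k) z (tri_lin A z) z" by (rule trilin_swap23)
    also have "\<dots> = trilin d (\<lambda>k i j. T2 i j k) (tri_lin A z) z z" by (rule trilin_swap12)
    also have "\<dots> = cubic d T3 z" by (rule 3)
    finally show ?thesis .
  qed
  then show ?thesis by (rule that)
qed

text \<open>Links the product sigma-algebra on d coordinates to the Borel sets of the topology on
  all sequences; the coordinates beyond \<open>d\<close> are constant on the space.\<close>

lemma id_measurable_Rd: "(\<lambda>x. x) \<in> measurable (lebesgue_Rd d) (borel :: point measure)"
proof (rule measurable_coordinatewise_then_product)
  fix i
  show "(\<lambda>x. x i) \<in> borel_measurable (lebesgue_Rd d)"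
  proof (cases "i < d")
    case False
    have "(\<lambda>x. x i) \<in> borel_measurable (lebesgue_Rd d) \<longleftrightarrow> (\<lambda>x. undefined :: real) \<in> borel_measurable (lebesgue_Rd d)"
      using False by (intro measurable_cong) (auto simp: space_PiM PiE_def extensional_def)
    then show ?thesis by simp
  qed (rule borel_measurable_component_Rd, auto)
qed

lemma openin_Rd_measurable:
  assumes "openin (top_of_set (Rd d)) X"
  shows "X \<in> sets (lebesgue_Rd d)"
proof -
  obtain Y where Y: "open Y" "X = Rd d \<inter> Y" using assms by (auto simp: openin_open)
  have "(\<lambda>x. x) -` Y \<inter> space (lebesgue_Rd d) \<in> sets (lebesgue_Rd d)"
    using Y(1) by (intro measurable_sets[OF id_measurable_Rd]) auto
  then show ?thesis using Y(2) by (simp add: space_PiM Int_commute)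
qed

text \<open>The potential is only known to be continuous on \<open>\<Theta>\<close>, so its
  extension by 0 is what is measurable.\<close>

lemma continuous_on_Rd_measurable:
  fixes f :: "point \<Rightarrow> real"
  assumes op: "openin (top_of_set (Rd d)) \<Theta>" and f: "continuous_on \<Theta> f"
  shows "(\<lambda>x. if x \<in> \<Theta> then f x else 0) \<in> borel_measurable (lebesgue_Rd d)"
proof (rule borel_measurableI)
  fix B :: "real set" assume "open B"
  then have "openin (top_of_set \<Theta>) (\<Theta> \<inter> f -` B)"
    using f by (intro continuous_openin_preimage_gen)
  then have 1: "\<Theta> \<inter> f -` B \<in> sets (lebesgue_Rd d)"
    using op openin_trans openin_Rd_measurable by blast
  have 2: "\<Theta> \<in> sets (lebesgue_Rd d)" using op by (rule openin_Rd_measurable)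
  then have sub: "\<Theta> \<subseteq> space (lebesgue_Rd d)" by (rule sets.sets_into_space)
  have "(\<lambda>x. if x \<in> \<Theta> then f x else 0) -` B \<inter> space (lebesgue_Rd d) =
    (\<Theta> \<inter> f -` B) \<union> (if 0 \<in> B then space (lebesgue_Rd d) - \<Theta> else {})"
    using sub by (auto split: if_splits)
  then show "(\<lambda>x. if x \<in> \<Theta> then f x else 0) -` B \<inter> space (lebesgue_Rd d) \<in> sets (lebesgue_Rd d)"
    using 1 2 by auto
qed

lemma tensor_inner_measurable:
  assumes "\<And>i. i < d \<Longrightarrow> (\<lambda>z. f z i) \<in> borel_measurable N"
  shows "(\<lambda>z. tensor_inner d k T (tensor_power (f z))) \<in> borel_measurable N"
proof -
  have "(\<lambda>z. tensor_power (f z) is) \<in> borel_measurable N" if "set is \<subseteq> {..<d}" for "is"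
    using that by (induction "is") (use assms in \<open>auto simp: tensor_power_def\<close>)
  then show ?thesis
    unfolding tensor_inner_eq by (intro borel_measurable_sum borel_measurable_times) (auto simp: index_lists_def)
qed

lemma tri_lin_measurable:
  assumes "i < d"
  shows "(\<lambda>z. tri_lin A z i) \<in> borel_measurable (lebesgue_Rd d)"
proof -
  have [measurable]: "(\<lambda>z. z j) \<in> borel_measurable (lebesgue_Rd d)" if "j \<le> i" for j
    using borel_measurable_component_Rd[of "\<lambda>z. z" "lebesgue_Rd d" d j] that assms by simp
  show ?thesis unfolding tri_lin_def by simp
qed

text \<open>The Jacobian and \<open>exp (- off)\<close> appear in the integral and in the
  normalising constant and cancel. The positivity hypothesis excludes the value 0 for the
  normalising integral, by which the density divides.\<close>

lemma integral_gibbs_tri_map: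
  fixes V g :: "point \<Rightarrow> real"
  assumes A: "\<And>i. i < d \<Longrightarrow> A i i > 0"
    and \<Theta> [measurable]: "\<Theta> \<in> sets (lebesgue_Rd d)"
    and V [measurable]: "(\<lambda>x. if x \<in> \<Theta> then V x else 0) \<in> borel_measurable (lebesgue_Rd d)"
    and g [measurable]: "g \<in> borel_measurable (lebesgue_Rd d)"
    and W: "\<And>z. z \<in> Rd d \<Longrightarrow> tri_map d p A z \<in> \<Theta> \<Longrightarrow> W z = V (tri_map d p A z) - off"
    and \<Theta>': "\<And>z. z \<in> Rd d \<Longrightarrow> z \<in> \<Theta>' \<longleftrightarrow> tri_map d p A z \<in> \<Theta>"
    and pos: "0 < (\<integral>z. indicator \<Theta>' z * exp (sqnorm d z / 2 - W z) \<partial>std_gauss d)"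
  shows "(\<integral>x. g x \<partial>gibbs d \<Theta> V) =
    (\<integral>z. indicator \<Theta>' z * g (tri_map d p A z) * exp (sqnorm d z / 2 - W z) \<partial>std_gauss d) /
    (\<integral>z. indicator \<Theta>' z * exp (sqnorm d z / 2 - W z) \<partial>std_gauss d)"
proof -
  define T where "T = tri_map d p A"
  have T [measurable]: "T \<in> measurable (lebesgue_Rd d) (lebesgue_Rd d)"
    unfolding T_def by measurable
  define c where "c = (\<Prod>i<d. A i i) * sqrt (2 * pi) ^ d"
  have c: "c > 0" unfolding c_def by (intro mult_pos_pos prod_pos) (auto intro: A)
  have leb: "lebesgue_Rd d =
    distr (density (std_gauss d) (\<lambda>z. ennreal (c * exp (sqnorm d z / 2)))) (lebesgue_Rd d) T"
    unfolding T_def c_def by (rule lebesgue_Rd_eq_distr[of d A p, OF A])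
  have I: "(\<integral>x. F x \<partial>lebesgue_Rd d) = (\<integral>z. c * exp (sqnorm d z / 2) * F (T z) \<partial>std_gauss d)"
    if F [measurable]: "F \<in> borel_measurable (lebesgue_Rd d)" for F :: "point \<Rightarrow> real"
  proof -
    have "(\<integral>x. F x \<partial>lebesgue_Rd d) = (\<integral>x. F x \<partial>distr (density (std_gauss d) (\<lambda>z. ennreal (c * exp (sqnorm d z / 2)))) (lebesgue_Rd d) T)"
      by (subst leb) (rule refl)
    also have "\<dots> = (\<integral>z. F (T z) \<partial>density (std_gauss d) (\<lambda>z. ennreal (c * exp (sqnorm d z / 2))))"
      by (subst integral_distr) auto
    also have "\<dots> = (\<integral>z. c * exp (sqnorm d z / 2) * F (T z) \<partial>std_gauss d)"
      using c by (subst integral_density) auto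
    finally show ?thesis .
  qed
  define \<rho> where "\<rho> = (\<lambda>x. indicator \<Theta> x * exp (- V x))"
  have "\<rho> = (\<lambda>x. indicator \<Theta> x * exp (- (if x \<in> \<Theta> then V x else 0)))"
    by (auto simp: \<rho>_def indicator_def)
  then have \<rho> [measurable]: "\<rho> \<in> borel_measurable (lebesgue_Rd d)" by simp
  have \<rho>_nonneg: "0 \<le> \<rho> x" for x by (simp add: \<rho>_def)
  define den where "den = (\<integral>z. indicator \<Theta>' z * exp (sqnorm d z / 2 - W z) \<partial>std_gauss d)"
  have pt: "c * exp (sqnorm d z / 2) * \<rho> (T z) = c * exp (- off) * (indicator \<Theta>' z * exp (sqnorm d z / 2 - W z))"
    if "z \<in> Rd d" for z
    using \<Theta>'[OF that] W[OF that] by (auto simp: \<rho>_def T_def indicator_def exp_diff exp_minus field_simps exp_add[symmetric])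
  define Z where "Z = (\<integral>x. \<rho> x \<partial>lebesgue_Rd d)"
  have "Z = (\<integral>z. c * exp (- off) * (indicator \<Theta>' z * exp (sqnorm d z / 2 - W z)) \<partial>std_gauss d)"
    unfolding Z_def I[OF \<rho>] by (intro Bochner_Integration.integral_cong refl) (simp add: pt)
  also have "\<dots> = c * exp (- off) * den" by (simp add: den_def)
  finally have Z: "Z = c * exp (- off) * den" .
  have den: "den > 0" using pos by (simp add: den_def)
  have Zpos: "Z > 0" using Z c den by simp
  have "gibbs d \<Theta> V = density (lebesgue_Rd d) (\<lambda>x. ennreal (\<rho> x / Z))"
    by (simp add: gibbs_def \<rho>_def Z_def)
  then have "(\<integral>x. g x \<partial>gibbs d \<Theta> V) = (\<integral>x. \<rho> x / Z * g x \<partial>lebesgue_Rd d)"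
    using Zpos \<rho>_nonneg by (simp only:) (subst integral_density, auto)
  also have "\<dots> = (\<integral>z. c * exp (sqnorm d z / 2) * (\<rho> (T z) / Z * g (T z)) \<partial>std_gauss d)"
    by (rule I) measurable
  also have "\<dots> = (\<integral>z. c * exp (- off) / Z * (indicator \<Theta>' z * g (T z) * exp (sqnorm d z / 2 - W z)) \<partial>std_gauss d)"
  proof (intro Bochner_Integration.integral_cong refl)
    fix z assume "z \<in> space (std_gauss d)"
    then have "c * exp (sqnorm d z / 2) * (\<rho> (T z) / Z * g (T z)) =
      c * exp (- off) * (indicator \<Theta>' z * exp (sqnorm d z / 2 - W z)) / Z * g (T z)"
      by (simp add: pt[symmetric])
    then show "c * exp (sqnorm d z / 2) * (\<rho> (T z) / Z * g (T z)) =
      c * exp (- off) / Z * (indicator \<Theta>' z * g (T z) * exp (sqnorm d z / 2 - W z))"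
      by (simp add: mult_ac)
  qed
  also have "\<dots> = c * exp (- off) / Z * (\<integral>z. indicator \<Theta>' z * g (T z) * exp (sqnorm d z / 2 - W z) \<partial>std_gauss d)"
    by (rule integral_mult_right_zero)
  also have "c * exp (- off) / Z = 1 / den" using c den by (simp add: Z)
  finally show ?thesis by (simp add: den_def T_def)
qed


lemma C_k_on_scale:
  assumes op: "openin (top_of_set (Rd d)) \<Theta>" and f: "C_k_on d k \<Theta> f"
  shows "C_k_on d k \<Theta> (\<lambda>x. c * f x)"
proof -
  have eq: "pderivs is (\<lambda>x. c * f x) x = c * pderivs is f x"
    if "x \<in> \<Theta>" "set is \<subseteq> {..<d}" "length is \<le> k" for "is" x
    using that by (intro pderivs_scale[OF op f])
  have D: "(\<lambda>t. pderivs is (\<lambda>x. c * f x) (x(i := t))) field_differentiable (at (x i))"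
    if hyp: "set is \<subseteq> {..<d}" "length is < k" "i < d" "x \<in> \<Theta>" for "is" i x
  proof -
    have Rd: "x \<in> Rd d" using op hyp by (auto simp: openin_open)
    obtain e where e: "e > 0" "\<And>y. y \<in> Rd d \<Longrightarrow> (\<And>i. i < d \<Longrightarrow> \<bar>y i - x i\<bar> < e) \<Longrightarrow> y \<in> \<Theta>"
      using openin_Rd_box[OF op hyp(4)] by blast
    have "x(i := \<tau>) \<in> \<Theta>" if "dist \<tau> (x i) < e" for \<tau>
      using that e(1) Rd \<open>i < d\<close> by (intro e(2)) (auto simp: PiE_def extensional_def dist_real_def)
    then have ev: "eventually (\<lambda>\<tau>. c * pderivs is f (x(i := \<tau>)) = pderivs is (\<lambda>x. c * f x) (x(i := \<tau>))) (nhds (x i))"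
      unfolding eventually_nhds_metric using e(1) hyp by (intro exI[of _ e]) (simp add: eq)
    have "((\<lambda>\<tau>. c * pderivs is f (x(i := \<tau>))) has_real_derivative c * pderivs (i # is) f x) (at (x i))"
      using hyp by (intro DERIV_cmult C_k_on_DERIV[OF f])
    then have "((\<lambda>\<tau>. pderivs is (\<lambda>x. c * f x) (x(i := \<tau>))) has_real_derivative c * pderivs (i # is) f x) (at (x i))"
      by (rule DERIV_cong_ev[OF refl ev refl, THEN iffD1])
    then show ?thesis unfolding field_differentiable_def by (rule exI)
  qed
  have "continuous_on \<Theta> (pderivs is (\<lambda>x. c * f x))" if "set is \<subseteq> {..<d}" "length is \<le> k" for "is"
  proof (rule continuous_on_cong[THEN iffD2, OF refl])
    show "continuous_on \<Theta> (\<lambda>x. c * pderivs is f x)"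
      using that by (intro continuous_intros C_k_on_continuous[OF f])
    show "pderivs is (\<lambda>x. c * f x) x = c * pderivs is f x" if "x \<in> \<Theta>" for x
      using that \<open>set is \<subseteq> {..<d}\<close> \<open>length is \<le> k\<close> by (rule eq)
  qed
  with D show ?thesis unfolding C_k_on_def by blast
qed

section \<open>Verification of the standardised hypotheses\<close>

locale laplace_setup =
  fixes C_A2 M :: real and d :: nat and n :: real and \<Theta> :: "point set" and v :: "point \<Rightarrow> real"
    and xh :: point and s0 c0 :: real and G :: "point \<Rightarrow> real" and aG s :: real
  assumes C_A2: "C_A2 > 0" and d: "d \<ge> 1" and n: "n > 0"
    and op: "openin (top_of_set (Rd d)) \<Theta>" and A1: "assumption_A1 d \<Theta> v xh"
    and A2: "assumption_A2 C_A2 d n \<Theta> v xh s0 c0" and C5: "C_k_on d 5 \<Theta> v"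
    and G [measurable]: "G \<in> borel_measurable (lebesgue_Rd d)"
    and var: "variance_of (laplace d (\<lambda>x. n * v x) xh) G > 0" and aG: "aG \<ge> 0"
    and G_growth: "\<forall>x \<in> Rd d. \<bar>G x - (\<integral>y. G y \<partial>laplace d (\<lambda>x. n * v x) xh)\<bar> \<le>
      aG * exp (c0 * sqrt (real d) * mnorm d (hessian (\<lambda>x. n * v x) xh) (\<lambda>i. x i - xh i) / 2)"
    and s: "s \<ge> s_star s0 c0" and U_sub: "local_region d n v xh s \<subseteq> \<Theta>"
    and e3M: "eps3 d (\<lambda>x. n * v x) xh \<le> M"
    and e4M: "eps4 d (\<lambda>x. n * v x) xh (local_region d n v xh s) \<le> M"
    and odd: "odd_about d xh (standardized (laplace d (\<lambda>x. n * v x) xh) G)"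
begin

definition V :: "point \<Rightarrow> real" where "V = (\<lambda>x. n * v x)"
definition H :: matrix where "H = hessian V xh"
definition U :: "point set" where "U = local_region d n v xh s"
definition \<gamma> :: "point measure" where "\<gamma> = laplace d V xh"
definition g :: "point \<Rightarrow> real" where "g = standardized \<gamma> G"
definition e3 :: real where "e3 = eps3 d V xh"
definition e4 :: real where "e4 = eps4 d V xh U"
definition e5 :: real where "e5 = eps5 d V xh U"
definition ag :: real where "ag = aG / sqrt (variance_of \<gamma> G)"

lemma xh: "xh \<in> \<Theta>" "xh \<in> Rd d" and xh_minimal: "\<And>x. x \<in> \<Theta> \<Longrightarrow> v xh \<le> v x" and Hv: "pos_def d (hessian v xh)"
proof -
  show 1: "xh \<in> \<Theta>" "pos_def d (hessian v xh)" using A1 by (auto simp: assumption_A1_def)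
  then show "xh \<in> Rd d" using op by (auto simp: openin_open)
  show "v xh \<le> v x" if "x \<in> \<Theta>" for x
    using A1 that by (cases "x = xh") (auto simp: assumption_A1_def)
qed

lemma nabla_V: "x \<in> \<Theta> \<Longrightarrow> is \<in> index_lists d k \<Longrightarrow> k \<le> 5 \<Longrightarrow> nabla V x is = n * nabla v x is"
  unfolding nabla_def V_def by (intro pderivs_scale[OF op C5]) (auto simp: index_lists_def)

lemma inner_V: "x \<in> \<Theta> \<Longrightarrow> k \<le> 5 \<Longrightarrow> tensor_inner d k (nabla V x) w = n * tensor_inner d k (nabla v x) w"
  unfolding tensor_inner_eq sum_distrib_left by (intro sum.cong refl) (simp add: nabla_V mult.assoc)

lemma H_eq: "i < d \<Longrightarrow> j < d \<Longrightarrow> H i j = n * hessian v xh i j"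
  using nabla_V[OF xh(1), of "[i, j]" 2] by (simp add: H_def hessian_def nabla_def index_lists_def del: pderivs.simps)

lemma quad_H: "quad_form d H u = n * quad_form d (hessian v xh) u"
  unfolding quad_form_def sum_distrib_left by (intro sum.cong refl) (simp add: H_eq mult_ac)

lemma mnorm_H: "mnorm d H u = sqrt n * mnorm d (hessian v xh) u"
  by (simp add: mnorm_def quad_H real_sqrt_mult)

lemma pos_def_H: "pos_def d H"
  unfolding pos_def_def
proof (intro conjI allI impI)
  show "H i j = H j i" if "i < d" "j < d" for i j
    using that pos_def_sym[OF Hv] by (simp add: H_eq)
  show "quad_form d H u > 0" if "\<exists>i<d. u i \<noteq> 0" for u
    using that pos_def_pos[OF Hv] n by (auto simp: quad_H)
qed

lemma region_eq: "local_region d n v xh t = {x \<in> Rd d. mnorm d H (\<lambda>i. x i - xh i) \<le> t * sqrt (real d)}"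
proof -
  have "mnorm d (hessian v xh) w \<le> t * sqrt (real d / n) \<longleftrightarrow> mnorm d H w \<le> t * sqrt (real d)" for w
  proof -
    have "sqrt n > 0" using n by simp
    then show ?thesis
      by (simp add: mnorm_H real_sqrt_divide pos_le_divide_eq mult.commute)
  qed
  then show ?thesis by (simp add: local_region_def)
qed

lemma U_eq: "U = {x \<in> Rd d. mnorm d H (\<lambda>i. x i - xh i) \<le> s * sqrt (real d)}"
  unfolding U_def by (rule region_eq)

lemma c0: "0 < c0" "c0 \<le> 1" and s0: "s0 > 0" "s0 \<le> s" and s_lower: "8 * ln (2 * exp 1 / c0) \<le> c0 * s"
proof -
  have "0 < C_A2 / sqrt (real d)" using C_A2 d by simp
  then show c: "0 < c0" using A2 by (auto simp: assumption_A2_def)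
  show "c0 \<le> 1" "s0 > 0" using A2 by (auto simp: assumption_A2_def)
  show "s0 \<le> s" using s by (simp add: s_star_def)
  have "8 / c0 * ln (2 * exp 1 / c0) \<le> s" using s by (simp add: s_star_def)
  then show "8 * ln (2 * exp 1 / c0) \<le> c0 * s" using c by (simp add: field_simps)
qed

lemma xh_U: "xh \<in> U"
  using xh(2) s0 unfolding U_eq by (simp add: mnorm_def quad_form_def)

lemma U_sub': "U \<subseteq> \<Theta>" using U_sub by (simp add: U_def)

lemma compact_U: "compact U"
  unfolding U_eq by (intro compact_ellipsoid pos_def_H xh)

lemma C_k_on_le: "k \<le> 5 \<Longrightarrow> C_k_on d k \<Theta> v"
  using C5 by (auto simp: C_k_on_def)

lemma tensor_norm_bounded:
  assumes "k \<le> 5"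
  obtains B where "\<And>x. x \<in> U \<Longrightarrow> tensor_norm d k H (nabla V x) \<le> B"
proof -
  have "C_k_on d k \<Theta> V"
    unfolding V_def by (intro C_k_on_scale op C_k_on_le assms)
  from tensor_norm_bounded_on_compact[OF pos_def_H d compact_U U_sub' this]
  show ?thesis using that by blast
qed

text \<open>Compactness of the local region makes the suprema in \<open>eps4\<close> and
  \<open>eps5\<close> dominate their members; \<open>xh\<close> lies in the region, which gives
  nonnegativity.\<close>

lemma eps_bounds:
  shows "0 \<le> e3" "0 \<le> e4" "0 \<le> e5"
    and "tensor_norm d 3 H (nabla V xh) = e3 / real d"
    and "x \<in> U \<Longrightarrow> tensor_norm d 4 H (nabla V x) \<le> (e4 / real d)\<^sup>2"
    and "x \<in> U \<Longrightarrow> tensor_norm d 5 H (nabla V x) \<le> (e5 / real d) ^ 3"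
proof -
  note tn = tensor_norm_nonneg[OF pos_def_H d]
  show 3: "tensor_norm d 3 H (nabla V xh) = e3 / real d"
    using d by (simp add: e3_def eps3_def H_def)
  show "0 \<le> e3" using tn[of 3 "nabla V xh"] d by (simp add: e3_def eps3_def H_def)
  obtain B4 where B4: "\<And>x. x \<in> U \<Longrightarrow> tensor_norm d 4 H (nabla V x) \<le> B4"
    using tensor_norm_bounded[of 4] by auto
  obtain B5 where B5: "\<And>x. x \<in> U \<Longrightarrow> tensor_norm d 5 H (nabla V x) \<le> B5"
    using tensor_norm_bounded[of 5] by auto
  have "bdd_above ((\<lambda>x. sqrt (tensor_norm d 4 H (nabla V x))) ` U)"
    by (rule bdd_aboveI2[of _ _ "sqrt B4"]) (simp add: B4)
  then have "sqrt (tensor_norm d 4 H (nabla V x)) \<le> (SUP x\<in>U. sqrt (tensor_norm d 4 H (nabla V x)))" if "x \<in> U" for x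
    by (intro cSUP_upper that)
  then have 4: "sqrt (tensor_norm d 4 H (nabla V x)) \<le> e4 / real d" if "x \<in> U" for x
    using that d by (simp add: e4_def eps4_def H_def)
  have "bdd_above ((\<lambda>x. root 3 (tensor_norm d 5 H (nabla V x))) ` U)"
    by (rule bdd_aboveI2[of _ _ "root 3 B5"]) (simp add: B5)
  then have "root 3 (tensor_norm d 5 H (nabla V x)) \<le> (SUP x\<in>U. root 3 (tensor_norm d 5 H (nabla V x)))" if "x \<in> U" for x
    by (intro cSUP_upper that)
  then have 5: "root 3 (tensor_norm d 5 H (nabla V x)) \<le> e5 / real d" if "x \<in> U" for x
    using that d by (simp add: e5_def eps5_def H_def)
  show "tensor_norm d 4 H (nabla V x) \<le> (e4 / real d)\<^sup>2" if "x \<in> U"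
    using power_mono[OF 4[OF that], of 2] tn by simp
  show "tensor_norm d 5 H (nabla V x) \<le> (e5 / real d) ^ 3" if "x \<in> U"
    using power_mono[OF 5[OF that], of 3] tn by simp
  have "0 \<le> sqrt (tensor_norm d 4 H (nabla V xh))" "0 \<le> root 3 (tensor_norm d 5 H (nabla V xh))"
    using tn by simp_all
  then have "0 \<le> e4 / real d" "0 \<le> e5 / real d"
    using 4[OF xh_U] 5[OF xh_U] by linarith+
  then show "0 \<le> e4" "0 \<le> e5" using d by (simp_all add: zero_le_divide_iff)
qed

text \<open>The gradient vanishes at the minimiser, so \<open>\<Delta>\<close> is what the quadratic
  and cubic terms leave. Taylor's formula of order 4 puts the fourth derivative at an intermediate
  point of the region; that of order 5 keeps it at \<open>xh\<close> and pays with the fifth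
  derivative.\<close>

lemma taylor_bounds:
  assumes u: "mnorm d H u \<le> s * sqrt (real d)"
  defines "\<Delta> \<equiv> V (ray d xh u 1) - V xh - quad_form d H u / 2 - tensor_inner d 3 (nabla V xh) (tensor_power u) / 6"
  shows "\<bar>\<Delta>\<bar> \<le> (e4 / real d)\<^sup>2 * mnorm d H u ^ 4 / 24"
    and "\<bar>\<Delta> - tensor_inner d 4 (nabla V xh) (tensor_power u) / 24\<bar> \<le> (e5 / real d) ^ 3 * mnorm d H u ^ 5 / 120"
proof -
  have inU: "ray d xh u t \<in> U" if "0 \<le> t" "t \<le> 1" for t
  proof -
    have "mnorm d H (\<lambda>i. ray d xh u t i - xh i) = mnorm d H (\<lambda>i. t * u i)"
      by (intro mnorm_cong) (simp add: ray_def)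
    also have "\<dots> = t * mnorm d H u" using that by (simp add: mnorm_scale)
    also have "\<dots> \<le> 1 * mnorm d H u" using that mnorm_nonneg[OF pos_def_H] by (intro mult_right_mono) auto
    finally show ?thesis using u by (simp add: U_eq)
  qed
  have r0: "ray d xh u 0 = xh"
    using xh(2) by (auto simp: ray_def PiE_def extensional_def fun_eq_iff)
  have exp: "\<exists>t. 0 \<le> t \<and> t \<le> 1 \<and> V (ray d xh u 1) =
    (\<Sum>j<k. tensor_inner d j (nabla V xh) (tensor_power u) / fact j) +
      tensor_inner d k (nabla V (ray d xh u t)) (tensor_power u) / fact k" if k: "0 < k" "k \<le> 5" for k
  proof -
    obtain t where t: "0 \<le> t" "t \<le> 1" "v (ray d xh u 1) =
      (\<Sum>j<k. tensor_inner d j (nabla v (ray d xh u 0)) (tensor_power u) / fact j) +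
      tensor_inner d k (nabla v (ray d xh u t)) (tensor_power u) / fact k"
      using Taylor_along_ray[OF op C_k_on_le[OF k(2)] k(1), of xh u] inU U_sub' by blast
    have "V (ray d xh u 1) = (\<Sum>j<k. n * tensor_inner d j (nabla v xh) (tensor_power u) / fact j) +
      n * tensor_inner d k (nabla v (ray d xh u t)) (tensor_power u) / fact k"
      unfolding V_def t(3) r0 by (simp add: distrib_left sum_distrib_left)
    also have "\<dots> = (\<Sum>j<k. tensor_inner d j (nabla V xh) (tensor_power u) / fact j) +
      tensor_inner d k (nabla V (ray d xh u t)) (tensor_power u) / fact k"
      using k xh(1) inU[OF t(1,2)] U_sub' by (intro arg_cong2[of _ _ _ _ "(+)"] sum.cong) (auto simp: inner_V)
    finally show ?thesis using t by blast
  qed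
  have t1: "tensor_inner d 1 (nabla V xh) (tensor_power u) = 0"
    using gradient_zero[OF op C5 _ xh(1) xh_minimal, of u] xh(1) by (simp add: inner_V)
  have t2: "tensor_inner d 2 (nabla V xh) (tensor_power u) = quad_form d H u"
    unfolding H_def by (rule tensor_inner_2)
  have sum4: "(\<Sum>j<4. f j) = f 0 + f 1 + f 2 + f 3" and sum5: "(\<Sum>j<5. f j) = f 0 + f 1 + f 2 + f 3 + f 4"
    for f :: "nat \<Rightarrow> real"
    by (simp_all add: eval_nat_numeral)
  have t0: "tensor_inner d 0 (nabla V xh) (tensor_power u) = V xh"
    by (simp add: tensor_inner_0 nabla_def)
  obtain t where t: "0 \<le> t" "t \<le> 1" "V (ray d xh u 1) =
    (\<Sum>j<4. tensor_inner d j (nabla V xh) (tensor_power u) / fact j) +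
      tensor_inner d 4 (nabla V (ray d xh u t)) (tensor_power u) / fact 4"
    using exp[of 4] by auto
  have "\<Delta> = tensor_inner d 4 (nabla V (ray d xh u t)) (tensor_power u) / 24"
    unfolding \<Delta>_def t(3) sum4 t0 t1 t2 by (simp add: fact_numeral)
  then have "\<bar>\<Delta>\<bar> = \<bar>tensor_inner d 4 (nabla V (ray d xh u t)) (tensor_power u)\<bar> / 24" by simp
  also have "\<dots> \<le> (e4 / real d)\<^sup>2 * mnorm d H u ^ 4 / 24"
    using tensor_inner_le_norm[OF pos_def_H d, of 4 "nabla V (ray d xh u t)" u]
      mult_right_mono[OF eps_bounds(5)[OF inU[OF t(1,2)]], of "mnorm d H u ^ 4"] mnorm_nonneg[OF pos_def_H, of u]
    by simp
  finally show "\<bar>\<Delta>\<bar> \<le> (e4 / real d)\<^sup>2 * mnorm d H u ^ 4 / 24" .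
  obtain t where t: "0 \<le> t" "t \<le> 1" "V (ray d xh u 1) =
    (\<Sum>j<5. tensor_inner d j (nabla V xh) (tensor_power u) / fact j) +
      tensor_inner d 5 (nabla V (ray d xh u t)) (tensor_power u) / fact 5"
    using exp[of 5] by auto
  have "\<Delta> - tensor_inner d 4 (nabla V xh) (tensor_power u) / 24 =
    tensor_inner d 5 (nabla V (ray d xh u t)) (tensor_power u) / 120"
    unfolding \<Delta>_def t(3) sum5 t0 t1 t2 by (simp add: fact_numeral)
  then have "\<bar>\<Delta> - tensor_inner d 4 (nabla V xh) (tensor_power u) / 24\<bar> =
    \<bar>tensor_inner d 5 (nabla V (ray d xh u t)) (tensor_power u)\<bar> / 120"
    by (simp only: abs_divide abs_numeral)
  also have "\<dots> \<le> (e5 / real d) ^ 3 * mnorm d H u ^ 5 / 120"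
    using tensor_inner_le_norm[OF pos_def_H d, of 5 "nabla V (ray d xh u t)" u]
      mult_right_mono[OF eps_bounds(6)[OF inU[OF t(1,2)]], of "mnorm d H u ^ 5"] mnorm_nonneg[OF pos_def_H, of u]
    by simp
  finally show "\<bar>\<Delta> - tensor_inner d 4 (nabla V xh) (tensor_power u) / 24\<bar> \<le> (e5 / real d) ^ 3 * mnorm d H u ^ 5 / 120" .
qed


lemma laplace_bound:
  "\<bar>(\<integral>x. g x \<partial>gibbs d \<Theta> V) - corrected_integral d V xh g\<bar> \<le> core_const M *
    (exp ((e3\<^sup>2 + e4\<^sup>2) * s ^ 4) * (e3\<^sup>2 + e4\<^sup>2) * (e3 + e4\<^sup>2) + real d powr (- 1 / 2) * e5 ^ 3 +
      max ag 1 * exp (- c0 * s * real d / 8))"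
proof -
  obtain A where A: "\<And>i. i < d \<Longrightarrow> A i i > 0" "\<And>z. quad_form d H (tri_lin A z) = sqnorm d z"
    using cholesky[OF pos_def_H] by metis
  have Hsym: "H i j = H j i" if "i < d" "j < d" for i j
    using pos_def_sym[OF pos_def_H that] .
  define T where "T = tri_map d xh A"
  have Tray: "T z = ray d xh (tri_lin A z) 1" for z
    by (simp add: T_def tri_map_eq ray_def)
  have T [measurable]: "T \<in> measurable (lebesgue_Rd d) (lebesgue_Rd d)"
    unfolding T_def by measurable
  have TRd: "T z \<in> Rd d" for z by (simp add: Tray)
  have mT: "mnorm d H (tri_lin A z) = sqrt (sqnorm d z)" for z by (simp add: mnorm_def A(2))
  have mT': "mnorm d H (\<lambda>i. T z i - xh i) = sqrt (sqnorm d z)" for z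
    unfolding mT[symmetric] by (intro mnorm_cong) (simp add: Tray ray_def)
  have \<gamma>T: "\<gamma> = distr (std_gauss d) (lebesgue_Rd d) T"
    unfolding \<gamma>_def laplace_def H_def[symmetric] T_def using A Hsym by (intro gaussian_eq_distr)
  obtain T3 where T3: "\<And>z. cubic d (\<lambda>i j k. - (1 / 6) * nabla V xh [i, j, k]) (tri_lin A z) = cubic d T3 z"
    using cubic_tri_lin by blast
  have S_eq: "cubic d T3 z = - (1 / 6) * tensor_inner d 3 (nabla V xh) (tensor_power (tri_lin A z))" for z
    unfolding T3[symmetric] tensor_inner_3 by (rule trilin_scale)
  have skew: "skew_correction d V xh (T z) = cubic d T3 z" for z
  proof -
    have "tensor_inner d 3 (nabla V xh) (tensor_power (\<lambda>i. T z i - xh i)) =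
      tensor_inner d 3 (nabla V xh) (tensor_power (tri_lin A z))"
      by (intro tensor_inner_cong) (simp add: Tray ray_def)
    then show ?thesis by (simp add: skew_correction_def S_eq)
  qed
  have \<Theta> [measurable]: "\<Theta> \<in> sets (lebesgue_Rd d)" by (rule openin_Rd_measurable[OF op])
  have contV: "continuous_on \<Theta> V"
    unfolding V_def using C_k_on_continuous[OF C5, of "[]"] by (intro continuous_intros) simp
  have V1 [measurable]: "(\<lambda>x. if x \<in> \<Theta> then V x else 0) \<in> borel_measurable (lebesgue_Rd d)"
    by (rule continuous_on_Rd_measurable[OF op contV])
  define \<Theta>' where "\<Theta>' = T -` \<Theta> \<inter> Rd d"
  define W where "W = (\<lambda>z. (if T z \<in> \<Theta> then V (T z) else 0) - V xh)"
  define Q where "Q = (\<lambda>z. tensor_inner d 4 (nabla V xh) (tensor_power (tri_lin A z)) / 24)"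
  define gT where "gT = (\<lambda>z. g (T z))"
  have g_meas [measurable]: "g \<in> borel_measurable (lebesgue_Rd d)"
    unfolding g_def standardized_def by measurable
  have reflect: "T (reflect d z) = (\<lambda>i\<in>{..<d}. xh i - tri_lin A z i)" for z
  proof -
    have "tri_lin A (reflect d z) i = - tri_lin A z i" if "i < d" for i
      using that by (simp add: tri_lin_def reflect_def sum_negf[symmetric])
    then show ?thesis by (auto simp: T_def tri_map_eq fun_eq_iff)
  qed
  have inU: "T z \<in> U" if "sqnorm d z \<le> s\<^sup>2 * real d" for z
  proof -
    have "sqrt (sqnorm d z) \<le> sqrt (s\<^sup>2 * real d)" using that by simp
    also have "\<dots> = s * sqrt (real d)" using s0 by (simp add: real_sqrt_mult)
    finally show ?thesis by (simp add: U_eq mT' TRd)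
  qed
  have gcore: "laplace_core d T3 e3 e4 e5 s c0 M ag \<Theta>' W Q gT"
  proof unfold_locales
    show "1 \<le> d" "0 \<le> e3" "0 \<le> e4" "0 \<le> e5" "0 < c0" "c0 \<le> 1" "8 * ln (2 * exp 1 / c0) \<le> c0 * s"
      by (rule d eps_bounds c0 s_lower)+
    show "e3 \<le> M" "e4 \<le> M" using e3M e4M by (simp_all add: e3_def e4_def V_def U_def)
    show "\<bar>cubic d T3 z\<bar> \<le> e3 / (6 * real d) * sqrt (sqnorm d z) ^ 3" for z
      using tensor_inner_le_norm[OF pos_def_H d, of 3 "nabla V xh" "tri_lin A z"] by (simp add: S_eq eps_bounds(4) mT abs_mult)
    show "\<Theta>' \<in> sets (lebesgue_Rd d)"
      using measurable_sets[OF T \<Theta>] by (simp add: \<Theta>'_def space_PiM)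
    show "z \<in> \<Theta>'" if "z \<in> Rd d" "sqnorm d z \<le> s\<^sup>2 * real d" for z
      using inU[OF that(2)] U_sub' that by (auto simp: \<Theta>'_def)
    show "W \<in> borel_measurable (lebesgue_Rd d)"
      unfolding W_def using measurable_compose[OF T V1] by simp
    show "Q \<in> borel_measurable (lebesgue_Rd d)"
      unfolding Q_def by (intro borel_measurable_divide borel_measurable_const tensor_inner_measurable tri_lin_measurable)
    show "gT \<in> borel_measurable (lebesgue_Rd d)"
      unfolding gT_def by measurable
    show "Q (reflect d z) = Q z" for z
    proof -
      have "tensor_inner d 4 (nabla V xh) (tensor_power (tri_lin A (reflect d z))) =
        tensor_inner d 4 (nabla V xh) (tensor_power (\<lambda>i. (- 1) * tri_lin A z i))"
        by (intro tensor_inner_cong) (simp add: tri_lin_def reflect_def sum_negf[symmetric])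
      then show ?thesis unfolding Q_def tensor_inner_scale by simp
    qed
    show "gT (reflect d z) = - gT z" for z
    proof -
      define y where "y = (\<lambda>i\<in>{..<d}. tri_lin A z i)"
      have y: "y \<in> Rd d" by (simp add: y_def)
      have "g (\<lambda>i\<in>{..<d}. xh i + y i) = - g (\<lambda>i\<in>{..<d}. xh i - y i)"
        using odd y unfolding odd_about_def g_def \<gamma>_def V_def by blast
      moreover have "(\<lambda>i\<in>{..<d}. xh i + y i) = T z" "(\<lambda>i\<in>{..<d}. xh i - y i) = T (reflect d z)"
        unfolding reflect by (auto simp: T_def tri_map_eq y_def fun_eq_iff)
      ultimately show ?thesis by (simp add: gT_def)
    qed
    show "(\<integral>\<^sup>+z. ennreal ((gT z)\<^sup>2) \<partial>std_gauss d) \<le> 1"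
    proof -
      define \<mu> where "\<mu> = (\<integral>y. G y \<partial>\<gamma>)"
      have var': "variance_of \<gamma> G > 0" using var by (simp add: \<gamma>_def V_def)
      \<comment> \<open>A function that is not integrable has integral 0, so a positive variance
        forces the square to be integrable.\<close>
      then have int: "integrable \<gamma> (\<lambda>x. (G x - \<mu>)\<^sup>2)"
        unfolding variance_of_def \<mu>_def[symmetric] using not_integrable_integral_eq by fastforce
      have "(\<integral>\<^sup>+z. ennreal ((gT z)\<^sup>2) \<partial>std_gauss d) = (\<integral>\<^sup>+x. ennreal ((g x)\<^sup>2) \<partial>\<gamma>)"
        unfolding \<gamma>T by (subst nn_integral_distr) (auto simp: gT_def)
      also have "\<dots> = (\<integral>\<^sup>+x. ennreal (1 / variance_of \<gamma> G) * ennreal ((G x - \<mu>)\<^sup>2) \<partial>\<gamma>)"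
        using var' by (intro nn_integral_cong) (simp add: g_def standardized_def \<mu>_def power_divide ennreal_mult[symmetric])
      also have "\<dots> = ennreal (1 / variance_of \<gamma> G) * (\<integral>\<^sup>+x. ennreal ((G x - \<mu>)\<^sup>2) \<partial>\<gamma>)"
        using int by (intro nn_integral_cmult) auto
      also have "(\<integral>\<^sup>+x. ennreal ((G x - \<mu>)\<^sup>2) \<partial>\<gamma>) = ennreal (variance_of \<gamma> G)"
        unfolding variance_of_def \<mu>_def[symmetric] by (intro nn_integral_eq_integral int) auto
      also have "ennreal (1 / variance_of \<gamma> G) * ennreal (variance_of \<gamma> G) = 1"
        using var' by (subst ennreal_mult[symmetric]) auto
      finally show ?thesis by simp
    qed
    show "\<bar>sqnorm d z / 2 - W z - cubic d T3 z\<bar> \<le> e4\<^sup>2 * (sqnorm d z / real d)\<^sup>2 / 24"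
      "\<bar>sqnorm d z / 2 - W z - cubic d T3 z + Q z\<bar> \<le> (e5 / real d) ^ 3 * sqrt (sqnorm d z) ^ 5 / 120"
      if "sqnorm d z \<le> s\<^sup>2 * real d" for z
    proof -
      have "T z \<in> U" by (rule inU[OF that])
      then have W: "W z = V (ray d xh (tri_lin A z) 1) - V xh" "mnorm d H (tri_lin A z) \<le> s * sqrt (real d)"
        using U_sub' by (auto simp: W_def Tray[symmetric] U_eq mT mT')
      have sq: "sqrt (sqnorm d z) ^ 4 = (sqnorm d z)\<^sup>2"
        using power_mult[of "sqrt (sqnorm d z)" 2 2] by simp
      note tb = taylor_bounds[OF W(2), unfolded W(1)[symmetric] mT A(2) sq]
      have "\<bar>W z - sqnorm d z / 2 - tensor_inner d 3 (nabla V xh) (tensor_power (tri_lin A z)) / 6\<bar> =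
        \<bar>sqnorm d z / 2 - W z - cubic d T3 z\<bar>"
        unfolding S_eq by (subst abs_minus_cancel[symmetric]) (simp add: algebra_simps)
      with tb(1) show "\<bar>sqnorm d z / 2 - W z - cubic d T3 z\<bar> \<le> e4\<^sup>2 * (sqnorm d z / real d)\<^sup>2 / 24"
        by (simp add: power_divide)
      have "\<bar>W z - sqnorm d z / 2 - tensor_inner d 3 (nabla V xh) (tensor_power (tri_lin A z)) / 6 -
          tensor_inner d 4 (nabla V xh) (tensor_power (tri_lin A z)) / 24\<bar> =
        \<bar>sqnorm d z / 2 - W z - cubic d T3 z + Q z\<bar>"
        unfolding S_eq Q_def by (subst abs_minus_cancel[symmetric]) (simp add: algebra_simps)
      with tb(2) show "\<bar>sqnorm d z / 2 - W z - cubic d T3 z + Q z\<bar> \<le> (e5 / real d) ^ 3 * sqrt (sqnorm d z) ^ 5 / 120"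
        by simp
    qed
    show "c0 * sqrt (real d) * sqrt (sqnorm d z) \<le> W z" if "z \<in> \<Theta>'" "s\<^sup>2 * real d < sqnorm d z" for z
    proof -
      have T\<Theta>: "T z \<in> \<Theta>" using that by (simp add: \<Theta>'_def)
      \<comment> \<open>The growth assumption starts beyond the radius \<open>s0\<close>, which
        \<open>s_star\<close> keeps below \<open>s\<close>; points outside the ball of the core are
        therefore covered.\<close>
      have "s0 * sqrt (real d) \<le> s * sqrt (real d)" using s0 by (intro mult_right_mono) auto
      also have "\<dots> = sqrt (s\<^sup>2 * real d)" using s0 by (simp add: real_sqrt_mult)
      also have "\<dots> < sqrt (sqnorm d z)" using that by simp
      finally have "T z \<notin> local_region d n v xh s0" by (simp add: region_eq mT')
      then have "c0 * sqrt (real d / n) * mnorm d (hessian v xh) (\<lambda>i. T z i - xh i) \<le> v (T z) - v xh"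
        using A2 T\<Theta> by (simp add: assumption_A2_def)
      then have "n * (c0 * sqrt (real d / n) * mnorm d (hessian v xh) (\<lambda>i. T z i - xh i)) \<le> n * (v (T z) - v xh)"
        using n by (intro mult_left_mono) auto
      also have "\<dots> = W z" using T\<Theta> by (simp add: W_def V_def right_diff_distrib)
      also have "n * (c0 * sqrt (real d / n) * mnorm d (hessian v xh) (\<lambda>i. T z i - xh i)) =
        c0 * sqrt (real d) * sqrt (sqnorm d z)"
      proof -
        have "sqrt n * sqrt n = n" using n by simp
        then have "n * sqrt (real d / n) = sqrt (real d) * sqrt n"
          using n by (simp add: real_sqrt_divide field_simps)
        then have "n * (c0 * sqrt (real d / n) * x) = c0 * sqrt (real d) * (sqrt n * x)" for x
          by (metis mult.assoc mult.commute)
        then show ?thesis unfolding mT'[symmetric] mnorm_H .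
      qed
      finally show ?thesis .
    qed
    show "0 \<le> ag" using aG var by (simp add: ag_def \<gamma>_def V_def)
    show "\<bar>gT z\<bar> \<le> ag * exp (c0 * sqrt (real d) * sqrt (sqnorm d z) / 2)" for z
    proof -
      have "\<bar>G (T z) - (\<integral>y. G y \<partial>\<gamma>)\<bar> \<le> aG * exp (c0 * sqrt (real d) * sqrt (sqnorm d z) / 2)"
        using G_growth TRd[of z] unfolding mT'[symmetric] H_def \<gamma>_def V_def by blast
      then have "\<bar>G (T z) - (\<integral>y. G y \<partial>\<gamma>)\<bar> / sqrt (variance_of \<gamma> G) \<le>
        aG * exp (c0 * sqrt (real d) * sqrt (sqnorm d z) / 2) / sqrt (variance_of \<gamma> G)"
        using var by (intro divide_right_mono) (auto simp: \<gamma>_def V_def)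
      moreover have "\<bar>gT z\<bar> = \<bar>G (T z) - (\<integral>y. G y \<partial>\<gamma>)\<bar> / sqrt (variance_of \<gamma> G)"
        using var by (simp add: gT_def g_def standardized_def \<gamma>_def V_def)
      ultimately show ?thesis by (simp add: ag_def)
    qed
  qed
  interpret core: laplace_core d T3 e3 e4 e5 s c0 M ag \<Theta>' W Q gT by (rule gcore)
  have "(\<integral>x. g x \<partial>gibbs d \<Theta> V) =
    (\<integral>z. indicator \<Theta>' z * g (tri_map d xh A z) * exp (sqnorm d z / 2 - W z) \<partial>std_gauss d) /
    (\<integral>z. indicator \<Theta>' z * exp (sqnorm d z / 2 - W z) \<partial>std_gauss d)"
  proof (rule integral_gibbs_tri_map[where off = "V xh"])
    show "0 < (\<integral>z. indicator \<Theta>' z * exp (sqnorm d z / 2 - W z) \<partial>std_gauss d)"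
      using core.den_pos by (simp add: core.den_def core.r_def)
  qed (use A in \<open>auto simp: W_def T_def \<Theta>'_def\<close>)
  then have "(\<integral>x. g x \<partial>gibbs d \<Theta> V) = core.num / core.den"
    unfolding core.num_def core.den_def core.r_def unfolding gT_def T_def .
  moreover have "corrected_integral d V xh g = core.tgt"
  proof -
    have [measurable]: "skew_correction d V xh \<in> borel_measurable (lebesgue_Rd d)"
      unfolding skew_correction_def
      by (intro borel_measurable_times borel_measurable_const tensor_inner_measurable borel_measurable_diff
          borel_measurable_component_Rd[of "\<lambda>x. x"]) auto
    show ?thesis
      unfolding corrected_integral_def \<gamma>_def[symmetric] \<gamma>T core.tgt_def
      by (subst integral_distr) (auto simp: gT_def skew)
  qed
  ultimately show ?thesis
    using core.core_bound by (simp add: core.E_def core.tl_def)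
qed

lemma laplace_bound_tau:
  "\<bar>(\<integral>x. g x \<partial>gibbs d \<Theta> V) - corrected_integral d V xh g\<bar> \<le> core_const M *
    (exp ((e3\<^sup>2 + e4\<^sup>2) * s ^ 4) * (e3\<^sup>2 + e4\<^sup>2) * (e3 + e4\<^sup>2) + real d powr (- 1 / 2) * e5 ^ 3 +
      max ag 1 * tau d c0 s)"
proof -
  have "0 \<le> M" using eps_bounds(1) e3M by (simp add: e3_def V_def)
  then have "core_const M \<ge> 0"
    using moment_const_pos by (simp add: core_const_def second_const_def)
  moreover have "exp (- c0 * s * real d / 8) \<le> tau d c0 s"
    using d unfolding tau_def by (simp add: mult_le_cancel_right1)
  ultimately show ?thesis
    by (intro order_trans[OF laplace_bound] mult_left_mono add_left_mono) auto
qed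

end

theorem theorem2p18:
  fixes C_A2 M :: real
  assumes "C_A2 > 0" and "M > 0"
  shows "\<exists>K>0. \<forall>(d::nat) (n::real) (\<Theta>::point set) (v::point \<Rightarrow> real) (xh::point)
      (s0::real) (c0::real) (G::point \<Rightarrow> real) (aG::real) (s::real).
    let V = (\<lambda>x. n * v x);
        U = local_region d n v xh s;
        \<gamma> = laplace d V xh;
        g = standardized \<gamma> G;
        ag = aG / sqrt (variance_of \<gamma> G);
        e3 = eps3 d V xh; e4 = eps4 d V xh U; e5 = eps5 d V xh U;
        E = exp ((e3\<^sup>2 + e4\<^sup>2) * s ^ 4)
    in d \<ge> 1 \<longrightarrow> n > 0 \<longrightarrow>
       openin (top_of_set (Rd d)) \<Theta> \<longrightarrow>
       assumption_A1 d \<Theta> v xh \<longrightarrow>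
       assumption_A2 C_A2 d n \<Theta> v xh s0 c0 \<longrightarrow>
       C_k_on d 5 \<Theta> v \<longrightarrow>
       G \<in> borel_measurable (lebesgue_Rd d) \<longrightarrow>
       variance_of \<gamma> G > 0 \<longrightarrow>
       aG \<ge> 0 \<longrightarrow>
       (\<forall>x \<in> Rd d. \<bar>G x - (\<integral>y. G y \<partial>\<gamma>)\<bar> \<le>
          aG * exp (c0 * sqrt (real d) * mnorm d (hessian V xh) (\<lambda>i. x i - xh i) / 2)) \<longrightarrow>
       s \<ge> s_star s0 c0 \<longrightarrow>
       U \<subseteq> \<Theta> \<longrightarrow>
       e3 \<le> M \<longrightarrow> e4 \<le> M \<longrightarrow>
       odd_about d xh g \<longrightarrow>
       \<bar>(\<integral>x. g x \<partial>gibbs d \<Theta> V) - corrected_integral d V xh g\<bar> \<le>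
         K * (E * (e3\<^sup>2 + e4\<^sup>2) * (e3 + e4\<^sup>2) + real d powr (- 1 / 2) * e5 ^ 3 + max ag 1 * tau d c0 s)"
proof -
  have K: "core_const M > 0"
  proof -
    define q where "q = sqrt (second_const M)"
    have q: "q \<ge> 0"
      unfolding q_def second_const_def using moment_const_pos by simp
    have "0 \<le> (3 + 2 * M\<^sup>2) * q * (1 + sqrt moment_const) + sqrt moment_const"
      "0 \<le> M * moment_const" "0 \<le> 2 * (M * sqrt moment_const)"
      using q moment_const_pos assms by auto
    then have "0 < (3 + 2 * M\<^sup>2) * q * (1 + sqrt moment_const) + sqrt moment_const +
      (M * moment_const + 1 + 2 * (M * sqrt moment_const))" by linarith
    then show ?thesis unfolding core_const_def q_def[symmetric] by simp
  qed
  show ?thesis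
    unfolding Let_def
  proof (intro exI[of _ "core_const M"] conjI K allI impI, goal_cases)
    case (1 d n \<Theta> v xh s0 c0 G aG s)
    then interpret laplace_setup C_A2 M d n \<Theta> v xh s0 c0 G aG s
      using assms by unfold_locales
    show ?case
      using laplace_bound_tau unfolding g_def \<gamma>_def V_def U_def e3_def e4_def e5_def ag_def .
  qed
qed

end
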